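(* Let $N$ be a triply periodic network in $\mathbb R^3$ with quotient graph $D_1\square D_2$, length $L$ and spanned volume $V$. Then $$\frac{L^3}{V}\ \ge\ \frac{81}{4}.$$ Equality holds exactly for a one-parameter family (up to similarity) of (non-similar) Steiner networks, the minimizing ths networks, all with the same lattice $\Lambda$ up to similarity, for instance the lattice generated by $(1,0,0)$, $(0,1,0)$, $(\frac12,\frac12,\frac{\sqrt3}2)$. Moreover, each of these minimizing ths networks can be homotoped (through a continuous family of triply periodic networks) into a Steiner network with quotient graph $K_4$ of smaller length, such that along the homotopy the length is non-increasing and the lattice remains fixed.
   Context: An ($n$-periodic) network $N$ (triply periodic if $n=3$) is a connected simple graph immersed with straight edges of positive length into $\mathbb R^n$ such that: $N$ is invariant under a lattice $\Lambda\subset\mathbb R^n$ of rank $n$, and the quotient $N/\Lambda$ is a finite graph, possibly with loops and multiple edges. "Immersed" means that for each vertex the restriction of the map to the union of the incident edges is injective. The length is $L=L(N/\Lambda)$, the total edge length of the quotient, and the (spanned) volume is $V=V(\mathbb R^n/\Lambda)$. A Steiner network is a network all of whose vertices have degree $3$, such that at each vertex the three unit edge vectors sum to zero (edges meet at $120^\circ$). $K_4$ is the complete graph on four vertices. $D_1\square D_2$ is the $3$-regular multigraph with four vertices $A,B,C,D$ and six edges: $e_1,e_2$ both joining $A$ and $B$; $e_3,e_4$ both joining $C$ and $D$; $e_5$ joining $A$ and $C$; $e_6$ joining $B$ and $D$. The minimizing ths networks are the triply periodic Steiner networks with quotient $D_1\square D_2$ whose edge lengths $x_i>0$ (of $e_i$)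 satisfy $x_1=x_2=x_3=x_4=2x_5+2x_6$ and for which the plane containing the edges at (lifts of) $A$ and the plane containing the edges at (lifts of) $C$ are perpendicular. Up to similarity the parameter of the family is $x_5/x_1$. A homotopy (continuous family) of networks $N_t$ with fixed lattice $\Lambda$ means that $N_t$ is the $\Lambda$-orbit of finitely many straight segments whose endpoints (vertices) depend continuously on $t$. The combinatorial type may change at a parameter value where two vertices joined by an edge coincide, the segment between them having length $0$ there. *)

theory Defs
  imports "HOL-Analysis.Analysis"
begin

section \<open>Lattices\<close>

definition int_span :: "'a::real_vector set \<Rightarrow> 'a set"
  where "int_span B = {\<Sum>b\<in>B. of_int (k b) *\<^sub>R b | k. True}"

definition lattice_basis :: "'a::euclidean_space set \<Rightarrow> 'a set \<Rightarrow> bool"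
  where "lattice_basis \<Lambda> B \<longleftrightarrow> independent B \<and> span B = UNIV \<and> int_span B = \<Lambda>"

definition full_lattice :: "'a::euclidean_space set \<Rightarrow> bool"
  where "full_lattice \<Lambda> \<longleftrightarrow> (\<exists>B. lattice_basis \<Lambda> B)"

definition fundamental_parallelepiped :: "'a::euclidean_space set \<Rightarrow> 'a set"
  where "fundamental_parallelepiped B =
    {\<Sum>b\<in>B. k b *\<^sub>R b | k. \<forall>b\<in>B. 0 \<le> k b \<and> k b < (1::real)}"

text \<open>The volume of the torus \<open>\<real>\<^sup>n/\<Lambda>\<close>; it does not depend on the basis chosen.\<close>

definition covolume :: "'a::euclidean_space set \<Rightarrow> real"
  where "covolume \<Lambda> =
    measure lebesgue (fundamental_parallelepiped (SOME B. lattice_basis \<Lambda> B))"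

definition similarity :: "('a::euclidean_space \<Rightarrow> 'a) \<Rightarrow> bool"
  where "similarity S \<longleftrightarrow>
    (\<exists>c f b. c > 0 \<and> orthogonal_transformation f \<and> S = (\<lambda>x. c *\<^sub>R f x + b))"

definition similar_lattices :: "'a::euclidean_space set \<Rightarrow> 'a set \<Rightarrow> bool"
  where "similar_lattices \<Lambda> \<Lambda>' \<longleftrightarrow> (\<exists>S. similarity S \<and> S 0 = 0 \<and> S ` \<Lambda> = \<Lambda>')"


section \<open>Finite multigraphs\<close>

text \<open>Undirected, with loops and multiple edges; the set of ends of an edge is a singleton
  exactly when the edge is a loop.\<close>

record ('v, 'e) multigraph =
  mverts :: "'v set"
  medges :: "'e set"
  mends :: "'e \<Rightarrow> 'v set"

definition multigraph_iso ::
  "('v \<Rightarrow> 'w) \<Rightarrow> ('e \<Rightarrow> 'f) \<Rightarrow> ('v, 'e) multigraph \<Rightarrow> ('w, 'f) multigraph \<Rightarrow> bool"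
  where "multigraph_iso f g G H \<longleftrightarrow>
    bij_betw f (mverts G) (mverts H) \<and> bij_betw g (medges G) (medges H) \<and>
    (\<forall>e\<in>medges G. mends H (g e) = f ` mends G e)"

definition isomorphic :: "('v, 'e) multigraph \<Rightarrow> ('w, 'f) multigraph \<Rightarrow> bool"
  where "isomorphic G H \<longleftrightarrow> (\<exists>f g. multigraph_iso f g G H)"

datatype quad = VA | VB | VC | VD

definition K4 :: "(quad, quad set) multigraph"
  where "K4 = \<lparr>mverts = UNIV, medges = {e. card e = 2}, mends = (\<lambda>e. e)\<rparr>"

definition D1_square_D2 :: "(quad, nat) multigraph"
  where "D1_square_D2 = \<lparr>mverts = UNIV, medges = {1..6},
    mends = (\<lambda>i. if i \<in> {1, 2} then {VA, VB}
                 else if i \<in> {3, 4} then {VC, VD}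
                 else if i = 5 then {VA, VC}
                 else {VB, VD})\<rparr>"


section \<open>Periodic networks\<close>

text \<open>
  An immersion need not be injective on vertices, so the simple graph is kept abstract and
  \<^term>\<open>pos\<close> places its vertices; edges are two-element sets of vertices, mapped to straight
  segments. Invariance under the lattice \<^term>\<open>periods\<close> is an action \<^term>\<open>shift\<close> of the
  lattice by graph automorphisms that covers the translations; the quotient is taken
  with respect to this action.
\<close>

record ('v, 'a) network =
  vertices :: "'v set"
  edges :: "'v set set"
  pos :: "'v \<Rightarrow> 'a"
  periods :: "'a set"
  shift :: "'a \<Rightarrow> 'v \<Rightarrow> 'v"

definition vertex_orbit :: "('v, 'a) network \<Rightarrow> 'v \<Rightarrow> 'v set"
  where "vertex_orbit N v = (\<lambda>a. shift N a v) ` periods N"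

definition edge_orbit :: "('v, 'a) network \<Rightarrow> 'v set \<Rightarrow> 'v set set"
  where "edge_orbit N e = (\<lambda>a. shift N a ` e) ` periods N"

definition quotient_graph :: "('v, 'a) network \<Rightarrow> ('v set, 'v set set) multigraph"
  where "quotient_graph N = \<lparr>mverts = vertex_orbit N ` vertices N,
    medges = edge_orbit N ` edges N,
    mends = (\<lambda>E. vertex_orbit N ` \<Union>E)\<rparr>"

definition neighbours :: "('v, 'a) network \<Rightarrow> 'v \<Rightarrow> 'v set"
  where "neighbours N v = {w. {v, w} \<in> edges N}"

text \<open>All requirements on a periodic network except that edges have positive length and
  that the placement is an immersion.\<close>

definition periodic_placed_graph :: "('v, 'a::euclidean_space) network \<Rightarrow> bool"
  where "periodic_placed_graph N \<longleftrightarrow>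
    full_lattice (periods N) \<and>
    vertices N \<noteq> {} \<and>
    (\<forall>e\<in>edges N. e \<subseteq> vertices N \<and> card e = 2) \<and>
    (\<forall>u\<in>vertices N. \<forall>v\<in>vertices N. (u, v) \<in> {(x, y). {x, y} \<in> edges N}\<^sup>*) \<and>
    (\<forall>v\<in>vertices N. shift N 0 v = v) \<and>
    (\<forall>a\<in>periods N. \<forall>b\<in>periods N. \<forall>v\<in>vertices N.
       shift N (a + b) v = shift N a (shift N b v)) \<and>
    (\<forall>a\<in>periods N. \<forall>v\<in>vertices N.
       shift N a v \<in> vertices N \<and> pos N (shift N a v) = pos N v + a) \<and>
    (\<forall>a\<in>periods N. \<forall>e\<in>edges N. shift N a ` e \<in> edges N) \<and>
    finite (mverts (quotient_graph N)) \<and> finite (medges (quotient_graph N))"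

text \<open>The union of the edges incident to \<open>v\<close> is parametrised by \<open>(w, t)\<close>, the point at
  parameter \<open>t\<close> on the edge from \<open>v\<close> to \<open>w\<close>, with the common end \<open>v\<close> represented once, by
  \<open>(v, 0)\<close>.\<close>

definition immersed :: "('v, 'a::euclidean_space) network \<Rightarrow> bool"
  where "immersed N \<longleftrightarrow>
    (\<forall>v\<in>vertices N. inj_on (\<lambda>(w, t::real). pos N v + t *\<^sub>R (pos N w - pos N v))
       (insert (v, 0) (neighbours N v \<times> {0<..1})))"

definition periodic_network :: "('v, 'a::euclidean_space) network \<Rightarrow> bool"
  where "periodic_network N \<longleftrightarrow> periodic_placed_graph N \<and>
    (\<forall>u v. {u, v} \<in> edges N \<longrightarrow> dist (pos N u) (pos N v) > 0) \<and> immersed N"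

definition edge_length :: "('v, 'a::euclidean_space) network \<Rightarrow> 'v set \<Rightarrow> real"
  where "edge_length N e = (THE l. \<exists>u v. e = {u, v} \<and> l = dist (pos N u) (pos N v))"

text \<open>The length of an edge of the quotient, which is the common length of its lifts.\<close>

definition orbit_length :: "('v, 'a::euclidean_space) network \<Rightarrow> 'v set set \<Rightarrow> real"
  where "orbit_length N E = the_elem (edge_length N ` E)"

definition total_length :: "('v, 'a::euclidean_space) network \<Rightarrow> real"
  where "total_length N = (\<Sum>E\<in>medges (quotient_graph N). orbit_length N E)"

definition spanned_volume :: "('v, 'a::euclidean_space) network \<Rightarrow> real"
  where "spanned_volume N = covolume (periods N)"

definition steiner_network :: "('v, 'a::euclidean_space) network \<Rightarrow> bool"
  where "steiner_network N \<longleftrightarrow> periodic_network N \<and>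
    (\<forall>v\<in>vertices N. card (neighbours N v) = 3 \<and>
       (\<Sum>w\<in>neighbours N v. sgn (pos N w - pos N v)) = 0)"

text \<open>Similarity of the immersed graphs alone: the lattices are not required to correspond.\<close>

definition similar_networks ::
  "('v, 'a::euclidean_space) network \<Rightarrow> ('w, 'a) network \<Rightarrow> bool"
  where "similar_networks N N' \<longleftrightarrow>
    (\<exists>S h. similarity S \<and> bij_betw h (vertices N) (vertices N') \<and>
       (`) h ` edges N = edges N' \<and>
       (\<forall>v\<in>vertices N. pos N' (h v) = S (pos N v)))"


section \<open>Minimizing ths networks\<close>

text \<open>The linear direction space of the affine hull of the edges at \<open>v\<close>.\<close>

definition star_plane :: "('v, 'a::euclidean_space) network \<Rightarrow> 'v \<Rightarrow> 'a set"
  where "star_plane N v = span ((\<lambda>w. pos N w - pos N v) ` neighbours N v)"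

definition perpendicular_planes :: "(real^3) set \<Rightarrow> (real^3) set \<Rightarrow> bool"
  where "perpendicular_planes P Q \<longleftrightarrow> dim P = 2 \<and> dim Q = 2 \<and>
    (\<forall>m \<in> orthogonal_comp P. \<forall>n \<in> orthogonal_comp Q. orthogonal m n)"

text \<open>The real number \<open>s\<close> is the parameter \<open>x\<^sub>5 / x\<^sub>1\<close>; it depends on the identification of the
  quotient with \<^term>\<open>D1_square_D2\<close>.\<close>

definition minimizing_ths_with_parameter :: "('v, real^3) network \<Rightarrow> real \<Rightarrow> bool"
  where "minimizing_ths_with_parameter N s \<longleftrightarrow> steiner_network N \<and>
    (\<exists>f g. multigraph_iso f g D1_square_D2 (quotient_graph N) \<and>
       (let x = (\<lambda>i. orbit_length N (g i)) in
          x 1 = x 2 \<and> x 2 = x 3 \<and> x 3 = x 4 \<and> x 4 = 2 * x 5 + 2 * x 6 \<and>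
          (\<forall>a\<in>f VA. \<forall>c\<in>f VC. perpendicular_planes (star_plane N a) (star_plane N c)) \<and>
          s = x 5 / x 1))"

definition minimizing_ths :: "('v, real^3) network \<Rightarrow> bool"
  where "minimizing_ths N \<longleftrightarrow> (\<exists>s. minimizing_ths_with_parameter N s)"

definition ths_lattice :: "(real^3) set"
  where "ths_lattice = int_span {vector [1, 0, 0], vector [0, 1, 0], vector [1/2, 1/2, sqrt 3 / 2]}"


section \<open>Homotopies of networks\<close>

text \<open>\<open>M\<close> arises from \<open>K\<close> by contracting exactly the edges of length zero.\<close>

definition collapses_to ::
  "('v, 'a::euclidean_space) network \<Rightarrow> ('w, 'a) network \<Rightarrow> bool"
  where "collapses_to K M \<longleftrightarrow> periods K = periods M \<and>
    (\<exists>c. c ` vertices K = vertices M \<and>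
       (\<forall>v\<in>vertices K. pos M (c v) = pos K v) \<and>
       (\<forall>a\<in>periods K. \<forall>v\<in>vertices K. c (shift K a v) = shift M a (c v)) \<and>
       (\<forall>u\<in>vertices K. \<forall>v\<in>vertices K. c u = c v \<longleftrightarrow>
          (u, v) \<in> {(x, y). {x, y} \<in> edges K \<and> pos K x = pos K y}\<^sup>*) \<and>
       bij_betw ((`) c) {e \<in> edges K. inj_on (pos K) e} (edges M))"

text \<open>A family \<open>M t\<close>, \<open>0 \<le> t \<le> 1\<close>, of networks with the fixed lattice \<open>\<Lambda>\<close>. On each of finitely
  many consecutive closed time intervals it is given by one \<open>\<Lambda>\<close>-periodic graph \<open>K\<close> with finite
  quotient whose vertices move continuously; so \<open>M t\<close> is there the \<open>\<Lambda>\<close>-orbit of finitely many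
  segments with continuous end points, those of length zero being contracted. The graph \<open>K\<close> can be
  replaced only at the common end of two intervals, where both graphs contract to the same
  network, so the combinatorial type changes only through edges of length zero.\<close>

definition network_homotopy ::
  "'a::euclidean_space set \<Rightarrow> (real \<Rightarrow> ('v, 'a) network) \<Rightarrow> bool"
  where "network_homotopy \<Lambda> M \<longleftrightarrow>
    (\<forall>t\<in>{0..1}. periodic_network (M t) \<and> periods (M t) = \<Lambda>) \<and>
    (\<exists>(m::nat) \<tau>. \<tau> 0 = 0 \<and> \<tau> m = 1 \<and>
       (\<forall>j<m. \<tau> j < \<tau> (Suc j) \<and>
          (\<exists>(K :: ('v, 'a) network) p.
             (\<forall>v\<in>vertices K. continuous_on {\<tau> j..\<tau> (Suc j)} (\<lambda>t. p t v)) \<and>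
             (\<forall>t\<in>{\<tau> j..\<tau> (Suc j)}. periodic_placed_graph (K\<lparr>pos := p t\<rparr>) \<and>
                collapses_to (K\<lparr>pos := p t\<rparr>) (M t)))))"

end

theory Submission
  imports Defs
begin

text \<open>
  Lifting the quotient to three independent cycles writes the lattice as generated by
  \<open>a = d\<^sub>1 - d\<^sub>2\<close>, \<open>b = d\<^sub>3 - d\<^sub>4\<close> and \<open>c = d\<^sub>1 + d\<^sub>6 - d\<^sub>3 - d\<^sub>5\<close>, where \<open>d\<^sub>i\<close> are the edge vectors. With \<open>n\<close> the
  unit normal of the plane of \<open>a\<close> and \<open>b\<close>, projecting each edge on its direction in the optimal network
  gives \<open>L \<ge> \<surd>3/2 |a| + \<surd>3/2 |b| + n \<bullet> c\<close>, while \<open>V \<le> |a| |b| (n \<bullet> c)\<close>, so the bound is the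
  inequality of arithmetic and geometric means; equality forces the normal form \<open>ths_form\<close>.
  For the homotopy, \<open>C\<close> and \<open>D\<close> slide along \<open>n\<close> at constant length until \<open>C\<close> meets \<open>A\<close>; the vertex of
  degree 4 is then split the other way, and the vertices move linearly to the balanced network of type
  \<open>K\<^sub>4\<close>. The length is convex along this segment and minimal at its end.
\<close>

section \<open>Lattices\<close>

text \<open>The six test directions, taken outward, sum to zero at each vertex. So the sum of the
  projections does not change when vertices move; it depends on \<open>a\<close>, \<open>b\<close>,
  \<open>c\<close> alone. One calculation bounds all placements, and equality splits into six
  equality cases of Cauchy-Schwarz. With \<open>p\<close>, \<open>q\<close>, \<open>r\<close> the
  three terms of the bound, the volume is at most 4/3 of \<open>p * q * r\<close>, and 27 * 3/4 =
  81/4. A network is an abstract graph with a lattice action, so inequality, similarity and homotopy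
  are all reduced to one finite description: base vertices, and for each edge of the quotient a
  lattice vector, its voltage. Edge 5, from \<open>A\<close> to \<open>C\<close>, has voltage zero.
  Exchanging the sources \<open>A\<close> and \<open>C\<close> of the edges 2 and 3 turns the graph
  of type \<open>D1_square_D2\<close> into one of type \<open>K4\<close> with the same voltages, and
  identifying \<open>C\<close> with \<open>A\<close> makes both equal. Hence the graphs of the
  homotopy live on orbits of the same vertices, and the path starts at \<open>N\<close>
  itself.\<close>

definition add_subgroup :: "'a::ab_group_add set \<Rightarrow> bool"
  where "add_subgroup G \<longleftrightarrow> 0 \<in> G \<and> (\<forall>x\<in>G. \<forall>y\<in>G. x - y \<in> G)"

lemma add_subgroup_zero: "add_subgroup G \<Longrightarrow> 0 \<in> G"
  and add_subgroup_diff: "add_subgroup G \<Longrightarrow> x \<in> G \<Longrightarrow> y \<in> G \<Longrightarrow> x - y \<in> G"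
  by (auto simp: add_subgroup_def)

lemma add_subgroup_minus: "add_subgroup G \<Longrightarrow> x \<in> G \<Longrightarrow> - x \<in> G"
  using add_subgroup_diff[of G 0 x] add_subgroup_zero[of G] by simp

lemma add_subgroup_add: "add_subgroup G \<Longrightarrow> x \<in> G \<Longrightarrow> y \<in> G \<Longrightarrow> x + y \<in> G"
  using add_subgroup_diff[of G x "- y"] add_subgroup_minus[of G y] by simp

lemma add_subgroup_translate:
  assumes "add_subgroup G" "a \<in> G"
  shows "(\<lambda>b. b + a) ` G = G"
proof (intro equalityI subsetI)
  fix x assume "x \<in> G"
  then show "x \<in> (\<lambda>b. b + a) ` G"
    using assms by (intro image_eqI[of _ _ "x - a"]) (auto intro: add_subgroup_diff)
qed (use assms in \<open>auto intro: add_subgroup_add\<close>)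

lemma add_subgroup_scaleR_nat:
  fixes x :: "'a::real_vector"
  shows "add_subgroup G \<Longrightarrow> x \<in> G \<Longrightarrow> real k *\<^sub>R x \<in> G"
  by (induction k) (auto simp: add_subgroup_zero add_subgroup_add scaleR_add_left)

lemma add_subgroup_scaleR_int:
  fixes x :: "'a::real_vector"
  assumes "add_subgroup G" "x \<in> G"
  shows "real_of_int k *\<^sub>R x \<in> G"
proof (cases k)
  case (nonneg n)
  then show ?thesis using add_subgroup_scaleR_nat[OF assms, of n] by simp
next
  case (neg n)
  have "- (real (Suc n) *\<^sub>R x) \<in> G"
    by (intro add_subgroup_minus add_subgroup_scaleR_nat assms)
  moreover have "- (real (Suc n) *\<^sub>R x) = real_of_int k *\<^sub>R x"
    using neg by (simp flip: scaleR_minus_left)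
  ultimately show ?thesis by metis
qed

lemma add_subgroup_int_span: "add_subgroup (int_span B)"
proof -
  have "0 \<in> int_span B"
    by (auto simp: int_span_def intro!: exI[of _ "\<lambda>_. 0"])
  moreover have "x - y \<in> int_span B" if xy: "x \<in> int_span B" "y \<in> int_span B" for x y
  proof -
    obtain k m where "x = (\<Sum>b\<in>B. of_int (k b) *\<^sub>R b)" "y = (\<Sum>b\<in>B. of_int (m b) *\<^sub>R b)"
      using xy by (auto simp: int_span_def)
    then have "x - y = (\<Sum>b\<in>B. of_int (k b - m b) *\<^sub>R b)"
      by (simp add: sum_subtractf scaleR_diff_left)
    then show ?thesis
      unfolding int_span_def by (intro CollectI exI[of _ "\<lambda>b. k b - m b"]) simp
  qed
  ultimately show ?thesis by (auto simp: add_subgroup_def)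
qed

lemma int_span_base:
  assumes "finite B" "x \<in> B"
  shows "x \<in> int_span B"
proof -
  have "x = (\<Sum>b\<in>B. of_int (if b = x then 1 else 0) *\<^sub>R b)"
    using assms by (simp add: if_distrib[of "\<lambda>c. of_int c *\<^sub>R _"] cong: if_cong)
  then show ?thesis
    unfolding int_span_def by (intro CollectI exI[of _ "\<lambda>b. if b = x then 1 else 0"]) simp
qed

lemma add_subgroup_sum:
  assumes "add_subgroup G" "\<And>x. x \<in> A \<Longrightarrow> f x \<in> G"
  shows "sum f A \<in> G"
  using assms(2)
  by (induction A rule: infinite_finite_induct)
    (auto simp: add_subgroup_zero[OF assms(1)] add_subgroup_add[OF assms(1)])

lemma int_span_least:
  assumes "add_subgroup G" "B \<subseteq> G"
  shows "int_span B \<subseteq> G"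
  unfolding int_span_def
  by (auto intro!: add_subgroup_sum[OF assms(1)] add_subgroup_scaleR_int[OF assms(1)]
      dest: subsetD[OF assms(2)])

lemma int_span_triple:
  assumes "distinct [a, b, c]"
  shows "int_span {a, b, c} =
    {of_int i *\<^sub>R a + of_int j *\<^sub>R b + of_int k *\<^sub>R c | i j k. True}" (is "_ = ?R")
proof
  show "int_span {a, b, c} \<subseteq> ?R"
    using assms by (auto simp: int_span_def add.assoc)
  have "a \<in> int_span {a, b, c}" "b \<in> int_span {a, b, c}" "c \<in> int_span {a, b, c}"
    by (auto intro: int_span_base)
  then show "?R \<subseteq> int_span {a, b, c}"
    by (auto simp: add_subgroup_int_span intro!: add_subgroup_add add_subgroup_scaleR_int)
qed

lemma int_span_image:
  assumes "linear T" "inj_on T B"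
  shows "int_span (T ` B) = T ` int_span B"
proof -
  have *: "T (\<Sum>b\<in>B. of_int (k b) *\<^sub>R b) = (\<Sum>b\<in>B. of_int (k b) *\<^sub>R T b)" for k :: "'a \<Rightarrow> int"
    using assms(1) by (simp add: linear_sum linear_cmul)
  show ?thesis
  proof (intro equalityI subsetI)
    fix x assume "x \<in> int_span (T ` B)"
    then obtain k where "x = (\<Sum>b\<in>T ` B. of_int (k b) *\<^sub>R b)" by (auto simp: int_span_def)
    then have "x = T (\<Sum>b\<in>B. of_int (k (T b)) *\<^sub>R b)"
      by (simp add: * sum.reindex[OF assms(2)])
    then show "x \<in> T ` int_span B"
      unfolding int_span_def by (rule image_eqI) (intro CollectI exI[of _ "\<lambda>b. k (T b)"], simp)
  next
    fix x assume "x \<in> T ` int_span B"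
    then obtain k where "x = T (\<Sum>b\<in>B. of_int (k b) *\<^sub>R b)" by (auto simp: int_span_def)
    then have "x = (\<Sum>b\<in>T ` B. of_int (k (inv_into B T b)) *\<^sub>R b)"
      by (simp add: * sum.reindex[OF assms(2)] inv_into_f_f[OF assms(2)])
    then show "x \<in> int_span (T ` B)"
      unfolding int_span_def by (intro CollectI exI[of _ "\<lambda>b. k (inv_into B T b)"]) simp
  qed
qed

lemma add_subgroup_full_lattice: "full_lattice \<Lambda> \<Longrightarrow> add_subgroup \<Lambda>"
  using add_subgroup_int_span by (auto simp: full_lattice_def lattice_basis_def)


section \<open>Lifts of finite graphs\<close>

lemma edge_length_doubleton: "edge_length N {u, v} = dist (pos N u) (pos N v)"
  unfolding edge_length_def by (intro the_equality) (auto simp: doubleton_eq_iff dist_commute)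

text \<open>A voltage presentation of a periodic graph: \<open>vol j\<close> tells which translate
  of the target base vertex is reached by the lift of \<open>j\<close> that starts at the source
  base vertex. \<open>no_loop\<close> excludes loops and antiparallel pairs, so the two ends of a
  lifted edge determine its orientation; with \<open>parallel\<close>, different labels have
  different lifts.\<close>

locale lifted_graph =
  fixes N :: "('v, 'a::euclidean_space) network"
    and I :: "'i set" and base :: "'i \<Rightarrow> 'v"
    and J :: "'j set" and src tgt :: "'j \<Rightarrow> 'i" and vol :: "'j \<Rightarrow> 'a"
  assumes lattice: "full_lattice (periods N)"
    and finite_I: "finite I" and I_nonempty: "I \<noteq> {}" and finite_J: "finite J"
    and vertices_eq: "vertices N = {shift N a (base i) | a i. a \<in> periods N \<and> i \<in> I}"
    and shift_base_inj: "\<lbrakk>a \<in> periods N; b \<in> periods N; i \<in> I; i' \<in> I;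
      shift N a (base i) = shift N b (base i')\<rbrakk> \<Longrightarrow> a = b \<and> i = i'"
    and shift_zero: "i \<in> I \<Longrightarrow> shift N 0 (base i) = base i"
    and shift_shift: "\<lbrakk>a \<in> periods N; b \<in> periods N; i \<in> I\<rbrakk> \<Longrightarrow>
      shift N a (shift N b (base i)) = shift N (a + b) (base i)"
    and pos_shift: "\<lbrakk>a \<in> periods N; i \<in> I\<rbrakk> \<Longrightarrow> pos N (shift N a (base i)) = pos N (base i) + a"
    and src: "j \<in> J \<Longrightarrow> src j \<in> I" and tgt: "j \<in> J \<Longrightarrow> tgt j \<in> I"
    and vol: "j \<in> J \<Longrightarrow> vol j \<in> periods N"
    and edges_eq: "edges N =
      {{shift N a (base (src j)), shift N (a + vol j) (base (tgt j))} | a j. a \<in> periods N \<and> j \<in> J}"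
    and no_loop: "\<lbrakk>j \<in> J; k \<in> J; src j = tgt k\<rbrakk> \<Longrightarrow> tgt j \<noteq> src k"
    and parallel: "\<lbrakk>j \<in> J; k \<in> J; src j = src k; tgt j = tgt k; vol j = vol k\<rbrakk> \<Longrightarrow> j = k"
begin

abbreviation P :: "'a \<Rightarrow> 'i \<Rightarrow> 'v" where "P a i \<equiv> shift N a (base i)"

definition lift :: "'a \<Rightarrow> 'j \<Rightarrow> 'v set"
  where "lift a j = {P a (src j), P (a + vol j) (tgt j)}"

definition evec :: "'j \<Rightarrow> 'a"
  where "evec j = pos N (base (tgt j)) + vol j - pos N (base (src j))"

text \<open>Half-edges at \<open>i\<close>; the flag is \<open>True\<close> when \<open>i\<close> is
  the source. They index the neighbours of every lift of \<open>i\<close>, which turns sums over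
  neighbours into finite sums over labels.\<close>

definition darts :: "'i \<Rightarrow> ('j \<times> bool) set"
  where "darts i = {j \<in> J. src j = i} \<times> {True} \<union> {j \<in> J. tgt j = i} \<times> {False}"

fun dart_end :: "'a \<Rightarrow> 'j \<times> bool \<Rightarrow> 'v"
  where "dart_end a (j, True) = P (a + vol j) (tgt j)"
  | "dart_end a (j, False) = P (a - vol j) (src j)"

definition dart_vec :: "'j \<times> bool \<Rightarrow> 'a"
  where "dart_vec x = (if snd x then evec (fst x) else - evec (fst x))"

section \<open>Quotient graph and edge lengths of a lifted graph\<close>

lemma subgroup: "add_subgroup (periods N)"
  by (rule add_subgroup_full_lattice[OF lattice])

lemmas period_add = add_subgroup_add[OF subgroup]
  and period_diff = add_subgroup_diff[OF subgroup]
  and period_minus = add_subgroup_minus[OF subgroup]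
  and period_zero = add_subgroup_zero[OF subgroup]

lemma P_eq_iff: "a \<in> periods N \<Longrightarrow> b \<in> periods N \<Longrightarrow> i \<in> I \<Longrightarrow> k \<in> I \<Longrightarrow>
    P a i = P b k \<longleftrightarrow> a = b \<and> i = k"
  using shift_base_inj by blast

lemma vertexE:
  assumes "v \<in> vertices N"
  obtains a i where "a \<in> periods N" "i \<in> I" "v = P a i"
  using assms by (auto simp: vertices_eq)

lemma P_vertex: "a \<in> periods N \<Longrightarrow> i \<in> I \<Longrightarrow> P a i \<in> vertices N"
  by (auto simp: vertices_eq)

lemma edges_lift: "edges N = {lift a j | a j. a \<in> periods N \<and> j \<in> J}"
  by (simp add: edges_eq lift_def)

text \<open>If the ends match source to source, \<open>parallel\<close> identifies the labels; a
  crosswise match contradicts \<open>no_loop\<close>.\<close>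

lemma lift_eq_iff:
  assumes "a \<in> periods N" "b \<in> periods N" "j \<in> J" "k \<in> J"
  shows "lift a j = lift b k \<longleftrightarrow> a = b \<and> j = k"
proof
  assume "lift a j = lift b k"
  then consider "P a (src j) = P b (src k)" "P (a + vol j) (tgt j) = P (b + vol k) (tgt k)"
    | "P a (src j) = P (b + vol k) (tgt k)" "P (a + vol j) (tgt j) = P b (src k)"
    by (auto simp: lift_def doubleton_eq_iff)
  then show "a = b \<and> j = k"
  proof cases
    case 1
    then have "a = b \<and> src j = src k" "a + vol j = b + vol k \<and> tgt j = tgt k"
      by (auto simp: P_eq_iff assms src tgt vol period_add)
    then show ?thesis using parallel[OF assms(3,4)] by auto
  next
    case 2
    then have "src j = tgt k" "tgt j = src k"
      by (auto simp: P_eq_iff assms src tgt vol period_add)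
    then show ?thesis using no_loop[OF assms(3,4)] by auto
  qed
qed auto

lemma shift_lift: "a \<in> periods N \<Longrightarrow> b \<in> periods N \<Longrightarrow> j \<in> J \<Longrightarrow> shift N a ` lift b j = lift (a + b) j"
  by (simp add: lift_def shift_shift src tgt vol period_add add.assoc)

lemmas plus_periods = add_subgroup_translate[OF subgroup]

lemma vertex_orbit_P:
  assumes "a \<in> periods N" "i \<in> I"
  shows "vertex_orbit N (P a i) = {P b i | b. b \<in> periods N}"
proof -
  have "vertex_orbit N (P a i) = (\<lambda>b. P b i) ` (\<lambda>b. b + a) ` periods N"
    using assms by (auto simp: vertex_orbit_def image_image shift_shift)
  then show ?thesis using assms by (auto simp: plus_periods)
qed

lemma edge_orbit_lift:
  assumes "a \<in> periods N" "j \<in> J"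
  shows "edge_orbit N (lift a j) = {lift b j | b. b \<in> periods N}"
proof -
  have "edge_orbit N (lift a j) = (\<lambda>b. lift b j) ` (\<lambda>b. b + a) ` periods N"
    using assms by (auto simp: edge_orbit_def image_image shift_lift)
  then show ?thesis using assms by (auto simp: plus_periods)
qed

lemma vertex_orbit_base: "i \<in> I \<Longrightarrow> vertex_orbit N (base i) = {P b i | b. b \<in> periods N}"
  using vertex_orbit_P[of 0 i] period_zero by (simp add: shift_zero)

text \<open>The action is free and has \<open>base\<close> and the lifts at 0 as representatives of
  the orbits, so the labels themselves form the quotient.\<close>

lemma quotient_iso:
  "multigraph_iso (\<lambda>i. vertex_orbit N (base i)) (\<lambda>j. edge_orbit N (lift 0 j))
    \<lparr>mverts = I, medges = J, mends = (\<lambda>j. {src j, tgt j})\<rparr> (quotient_graph N)"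
proof -
  have "inj_on (\<lambda>i. vertex_orbit N (base i)) I"
  proof (rule inj_onI)
    fix i k assume ik: "i \<in> I" "k \<in> I" "vertex_orbit N (base i) = vertex_orbit N (base k)"
    then have "P 0 i \<in> vertex_orbit N (base k)"
      using period_zero by (auto simp: vertex_orbit_base)
    then show "i = k"
      using ik period_zero by (auto simp: vertex_orbit_base P_eq_iff)
  qed
  moreover have "(\<lambda>i. vertex_orbit N (base i)) ` I = vertex_orbit N ` vertices N"
  proof -
    have "vertex_orbit N ` vertices N = {vertex_orbit N (P a i) | a i. a \<in> periods N \<and> i \<in> I}"
      by (auto simp: vertices_eq)
    also have "\<dots> = {vertex_orbit N (base i) | a i. a \<in> periods N \<and> i \<in> I}"
      using vertex_orbit_P vertex_orbit_base by (metis (no_types, lifting))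
    also have "\<dots> = (\<lambda>i. vertex_orbit N (base i)) ` I"
      using period_zero by auto
    finally show ?thesis by simp
  qed
  ultimately have 1: "bij_betw (\<lambda>i. vertex_orbit N (base i)) I (vertex_orbit N ` vertices N)"
    by (simp add: bij_betw_def)
  have "inj_on (\<lambda>j. edge_orbit N (lift 0 j)) J"
  proof (rule inj_onI)
    fix j k assume jk: "j \<in> J" "k \<in> J" "edge_orbit N (lift 0 j) = edge_orbit N (lift 0 k)"
    then have "lift 0 j \<in> edge_orbit N (lift 0 k)"
      using period_zero by (auto simp: edge_orbit_lift)
    then show "j = k"
      using jk period_zero by (auto simp: edge_orbit_lift lift_eq_iff)
  qed
  moreover have "(\<lambda>j. edge_orbit N (lift 0 j)) ` J = edge_orbit N ` edges N"
  proof -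
    have "edge_orbit N ` edges N = {edge_orbit N (lift a j) | a j. a \<in> periods N \<and> j \<in> J}"
      by (auto simp: edges_lift)
    also have "\<dots> = {edge_orbit N (lift 0 j) | a j. a \<in> periods N \<and> j \<in> J}"
      using edge_orbit_lift period_zero by (metis (no_types, lifting))
    also have "\<dots> = (\<lambda>j. edge_orbit N (lift 0 j)) ` J"
      using period_zero by auto
    finally show ?thesis by simp
  qed
  ultimately have 2: "bij_betw (\<lambda>j. edge_orbit N (lift 0 j)) J (edge_orbit N ` edges N)"
    by (simp add: bij_betw_def)
  have 3: "vertex_orbit N ` \<Union>(edge_orbit N (lift 0 j)) =
      {vertex_orbit N (base (src j)), vertex_orbit N (base (tgt j))}" if j: "j \<in> J" for j
  proof -
    have "\<Union>(edge_orbit N (lift 0 j)) =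
        {P b (src j) | b. b \<in> periods N} \<union> {P (b + vol j) (tgt j) | b. b \<in> periods N}"
      unfolding edge_orbit_lift[OF period_zero j] by (auto simp: lift_def)
    moreover have "vertex_orbit N ` {P b (src j) | b. b \<in> periods N} =
        (\<lambda>b. vertex_orbit N (base (src j))) ` periods N"
      using vertex_orbit_P[OF _ src[OF j]] vertex_orbit_base[OF src[OF j]] by (auto simp: image_def)
    moreover have "vertex_orbit N ` {P (b + vol j) (tgt j) | b. b \<in> periods N} =
        (\<lambda>b. vertex_orbit N (base (tgt j))) ` periods N"
      using vertex_orbit_P[OF period_add[OF _ vol[OF j]] tgt[OF j]] vertex_orbit_base[OF tgt[OF j]]
      by (auto simp: image_def)
    ultimately show ?thesis using period_zero by (auto simp: image_Un)
  qed
  show ?thesis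
    using 1 2 3 by (auto simp: multigraph_iso_def quotient_graph_def)
qed

lemma edge_length_lift:
  assumes "a \<in> periods N" "j \<in> J"
  shows "edge_length N (lift a j) = norm (evec j)"
proof -
  have "dist (pos N (P a (src j))) (pos N (P (a + vol j) (tgt j))) = norm (evec j)"
    using assms by (simp add: dist_norm norm_minus_commute evec_def pos_shift src tgt vol period_add
        algebra_simps)
  then show ?thesis by (simp add: lift_def edge_length_doubleton)
qed

lemma orbit_length_lift: "j \<in> J \<Longrightarrow> orbit_length N (edge_orbit N (lift 0 j)) = norm (evec j)"
proof -
  assume j: "j \<in> J"
  have "edge_length N ` edge_orbit N (lift 0 j) = {norm (evec j)}"
  proof -
    have "edge_length N ` edge_orbit N (lift 0 j) = (\<lambda>b. edge_length N (lift b j)) ` periods N"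
      unfolding edge_orbit_lift[OF period_zero j] by auto
    also have "\<dots> = (\<lambda>b. norm (evec j)) ` periods N"
      using j by (intro image_cong) (auto simp: edge_length_lift)
    finally show ?thesis using period_zero by auto
  qed
  then show ?thesis by (simp add: orbit_length_def)
qed

lemma total_length_eq: "total_length N = (\<Sum>j\<in>J. norm (evec j))"
proof -
  have "bij_betw (\<lambda>j. edge_orbit N (lift 0 j)) J (medges (quotient_graph N))"
    using quotient_iso by (simp add: multigraph_iso_def)
  then have "total_length N = (\<Sum>j\<in>J. orbit_length N (edge_orbit N (lift 0 j)))"
    unfolding total_length_def by (rule sum.reindex_bij_betw[symmetric])
  then show ?thesis by (simp add: orbit_length_lift)
qed

lemma edge_lengths:
  "{dist (pos N u) (pos N v) | u v. {u, v} \<in> edges N} = (\<lambda>j. norm (evec j)) ` J"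
proof -
  have "{dist (pos N u) (pos N v) | u v. {u, v} \<in> edges N} = edge_length N ` edges N"
  proof -
    have "\<exists>u v. e = {u, v}" if "e \<in> edges N" for e
      using that by (auto simp: edges_lift lift_def)
    then show ?thesis
      unfolding image_def by (intro Collect_cong) (metis edge_length_doubleton)
  qed
  also have "\<dots> = (\<lambda>j. norm (evec j)) ` J"
    using period_zero by (force simp: edges_lift edge_length_lift image_iff)
  finally show ?thesis .
qed

section \<open>Stars of vertices, balance and immersion\<close>

lemma neighbours_P:
  assumes "a \<in> periods N" "i \<in> I"
  shows "neighbours N (P a i) = dart_end a ` darts i"
proof (intro equalityI subsetI)
  fix w assume "w \<in> neighbours N (P a i)"
  then obtain b j where bj: "b \<in> periods N" "j \<in> J"
    and "{P a i, w} = {P b (src j), P (b + vol j) (tgt j)}"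
    by (auto simp: neighbours_def edges_lift lift_def)
  then consider "P a i = P b (src j)" "w = P (b + vol j) (tgt j)"
    | "P a i = P (b + vol j) (tgt j)" "w = P b (src j)"
    by (auto simp: doubleton_eq_iff)
  then show "w \<in> dart_end a ` darts i"
  proof cases
    case 1
    then have "a = b" "i = src j" using assms bj by (auto simp: P_eq_iff src)
    then show ?thesis using 1 bj by (intro image_eqI[of _ _ "(j, True)"]) (auto simp: darts_def)
  next
    case 2
    then have "a = b + vol j" "i = tgt j" using assms bj by (auto simp: P_eq_iff tgt vol period_add)
    then show ?thesis using 2 bj by (intro image_eqI[of _ _ "(j, False)"]) (auto simp: darts_def)
  qed
next
  fix w assume "w \<in> dart_end a ` darts i"
  then consider j where "j \<in> J" "src j = i" "w = P (a + vol j) (tgt j)"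
    | j where "j \<in> J" "tgt j = i" "w = P (a - vol j) (src j)"
    by (auto simp: darts_def)
  then show "w \<in> neighbours N (P a i)"
  proof cases
    case (1 j)
    then show ?thesis using assms by (auto simp: neighbours_def edges_eq)
  next
    case (2 j)
    then have "{P a i, w} = {P (a - vol j) (src j), P (a - vol j + vol j) (tgt j)}" by auto
    then show ?thesis using assms 2 vol period_diff unfolding neighbours_def edges_eq by blast
  qed
qed

text \<open>Neighbours are vertices while darts are labels; injectivity is what allows counting and
  summing over darts instead. \<open>no_loop\<close> keeps outgoing and incoming darts apart,
  \<open>parallel\<close> separates darts of the same kind.\<close>

lemma dart_end_inj: "a \<in> periods N \<Longrightarrow> inj_on (dart_end a) (darts i)"
proof (rule inj_onI)
  fix x y assume a: "a \<in> periods N" and xy: "x \<in> darts i" "y \<in> darts i"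
    and eq: "dart_end a x = dart_end a y"
  obtain j p k q where [simp]: "x = (j, p)" "y = (k, q)" by (cases x, cases y)
  have jk: "j \<in> J" "k \<in> J" using xy by (auto simp: darts_def)
  show "x = y"
    using xy eq jk no_loop[OF jk] no_loop[OF jk(2,1)] parallel[OF jk]
    by (cases p; cases q)
      (auto simp: darts_def P_eq_iff a src tgt vol period_add period_diff)
qed

lemma pos_dart_end:
  assumes "a \<in> periods N" "x \<in> darts i"
  shows "pos N (dart_end a x) - pos N (P a i) = dart_vec x"
  using assms
  by (auto simp: darts_def dart_vec_def evec_def pos_shift src tgt vol period_add period_diff)

lemma star_plane_P:
  assumes "a \<in> periods N" "i \<in> I"
  shows "star_plane N (P a i) = span (dart_vec ` darts i)"
proof -
  have "(\<lambda>w. pos N w - pos N (P a i)) ` neighbours N (P a i) = dart_vec ` darts i"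
    by (simp add: neighbours_P[OF assms] image_image pos_dart_end[OF assms(1)])
  then show ?thesis by (simp add: star_plane_def)
qed

lemma steiner_P:
  assumes "a \<in> periods N" "i \<in> I"
  shows "card (neighbours N (P a i)) = card (darts i)"
    and "(\<Sum>w\<in>neighbours N (P a i). sgn (pos N w - pos N (P a i))) = (\<Sum>x\<in>darts i. sgn (dart_vec x))"
  by (simp_all add: neighbours_P[OF assms] card_image[OF dart_end_inj[OF assms(1)]]
      sum.reindex[OF dart_end_inj[OF assms(1)]] pos_dart_end[OF assms(1)])

text \<open>Points on two edges at a vertex, away from the vertex, can coincide only if the edges
  have the same direction. So pairwise different unit directions suffice, and nonzero edge vectors
  separate the point at parameter 0 from the rest.\<close>

lemma immersedI:
  assumes nz: "\<And>j. j \<in> J \<Longrightarrow> evec j \<noteq> 0"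
    and inj: "\<And>i. i \<in> I \<Longrightarrow> inj_on (\<lambda>x. sgn (dart_vec x)) (darts i)"
  shows "immersed N"
  unfolding immersed_def
proof (intro ballI)
  fix v assume "v \<in> vertices N"
  then obtain a i where ai: "a \<in> periods N" "i \<in> I" and v: "v = P a i" by (rule vertexE)
  have nz': "dart_vec x \<noteq> 0" if "x \<in> darts i" for x
    using that nz by (auto simp: darts_def dart_vec_def)
  show "inj_on (\<lambda>(w, t::real). pos N v + t *\<^sub>R (pos N w - pos N v))
       (insert (v, 0) (neighbours N v \<times> {0<..1}))"
  proof (rule inj_onI, clarify)
    fix w t w' and t' :: real
    assume 1: "(w, t) \<in> insert (v, 0) (neighbours N v \<times> {0<..1})"
      and 2: "(w', t') \<in> insert (v, 0) (neighbours N v \<times> {0<..1})"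
      and "pos N v + t *\<^sub>R (pos N w - pos N v) = pos N v + t' *\<^sub>R (pos N w' - pos N v)"
    then have eq: "t *\<^sub>R (pos N w - pos N v) = t' *\<^sub>R (pos N w' - pos N v)" by simp
    have nb: "\<exists>x\<in>darts i. w = dart_end a x \<and> pos N w - pos N v = dart_vec x"
      if "w \<in> neighbours N v" for w
      using that pos_dart_end[OF ai(1)] unfolding v neighbours_P[OF ai] by blast
    show "w = w' \<and> t = t'"
    proof (cases "t = 0 \<or> t' = 0")
      case True
      moreover have "pos N w \<noteq> pos N v" if "w \<in> neighbours N v" for w
        using nb[OF that] nz' by auto
      ultimately show ?thesis using 1 2 eq by auto
    next
      case False
      then have w: "w \<in> neighbours N v" "w' \<in> neighbours N v" and t: "t > 0" "t' > 0"
        using 1 2 by auto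
      obtain x x' where x: "x \<in> darts i" "w = dart_end a x" "pos N w - pos N v = dart_vec x"
        and x': "x' \<in> darts i" "w' = dart_end a x'" "pos N w' - pos N v = dart_vec x'"
        using nb w by metis
      have "sgn (t *\<^sub>R dart_vec x) = sgn (t' *\<^sub>R dart_vec x')" using eq x x' by simp
      then have "sgn (dart_vec x) = sgn (dart_vec x')" using t by (simp add: sgn_scaleR)
      then have "x = x'" using inj[OF ai(2)] x x' by (auto dest: inj_onD)
      then have "(t - t') *\<^sub>R dart_vec x = 0" using eq x x' by (simp add: algebra_simps)
      then show ?thesis using \<open>x = x'\<close> x x' nz'[of x] by simp
    qed
  qed
qed

section \<open>Connectedness and generation of the lattice\<close>

abbreviation adj_rel :: "('v \<times> 'v) set"
  where "adj_rel \<equiv> {(x, y). {x, y} \<in> edges N}"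

lemma adj_rel_lift: "a \<in> periods N \<Longrightarrow> j \<in> J \<Longrightarrow> (P a (src j), P (a + vol j) (tgt j)) \<in> adj_rel"
  by (auto simp: edges_eq)

lemma adj_rel_sym: "sym (adj_rel\<^sup>*)"
  by (intro sym_rtrancl) (auto simp: sym_def insert_commute)

text \<open>Quantifying over all subgroups allows instantiation both with the group of translations
  reachable by paths and with an integer span.\<close>

definition generating :: bool
  where "generating \<longleftrightarrow> (\<forall>G. add_subgroup G \<and> vol ` J \<subseteq> G \<longrightarrow> periods N \<subseteq> G)"

text \<open>The hypothesis \<open>tree\<close> joins every vertex to the root over the same lattice
  element. The translations that can be realised by paths between lifts of the root then form a
  subgroup containing all voltages, hence the whole lattice.\<close>

lemma placed_graphI:
  assumes r: "r \<in> I" and tree: "\<And>a i. a \<in> periods N \<Longrightarrow> i \<in> I \<Longrightarrow> (P a i, P a r) \<in> adj_rel\<^sup>*"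
    and gen: "generating"
  shows "periodic_placed_graph N"
proof -
  let ?R = "adj_rel\<^sup>*"
  note sym = symD[OF adj_rel_sym]
  let ?G = "{g \<in> periods N. \<forall>a\<in>periods N. (P a r, P (a + g) r) \<in> ?R}"
  have "add_subgroup ?G"
    unfolding add_subgroup_def
  proof (intro conjI ballI)
    show "0 \<in> ?G" using period_zero by simp
    fix x y assume x: "x \<in> ?G" and y: "y \<in> ?G"
    have "(P a r, P (a + (x - y)) r) \<in> ?R" if a: "a \<in> periods N" for a
    proof -
      \<comment> \<open>Closure under differences: the path for \<open>y\<close> is walked backwards
        from \<open>a\<close> to \<open>a - y\<close>, then the path for \<open>x\<close> is walked
        from there.\<close>
      have ay: "a - y \<in> periods N" using y a by (auto intro: period_diff)
      have "(P (a - y) r, P (a - y + y) r) \<in> ?R" using y ay by blast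
      then have "(P a r, P (a - y) r) \<in> ?R" using sym by simp
      moreover have "(P (a - y) r, P (a - y + x) r) \<in> ?R" using x ay by blast
      ultimately have "(P a r, P (a - y + x) r) \<in> ?R"
        by (rule rtrancl_trans)
      then show ?thesis by (simp add: algebra_simps)
    qed
    then show "x - y \<in> ?G" using x y by (auto intro: period_diff)
  qed
  moreover have "vol ` J \<subseteq> ?G"
  proof clarify
    fix j assume j: "j \<in> J"
    have "(P a r, P (a + vol j) r) \<in> ?R" if a: "a \<in> periods N" for a
    proof -
      have "(P a r, P a (src j)) \<in> ?R" by (rule sym[OF tree[OF a src[OF j]]])
      also have "(P a (src j), P (a + vol j) (tgt j)) \<in> ?R" using adj_rel_lift[OF a j] by blast
      also have "(P (a + vol j) (tgt j), P (a + vol j) r) \<in> ?R"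
        by (intro tree a tgt j period_add vol)
      finally show ?thesis .
    qed
    then show "vol j \<in> periods N \<and> (\<forall>a\<in>periods N. (P a r, P (a + vol j) r) \<in> ?R)"
      using vol[OF j] by blast
  qed
  ultimately have G: "periods N \<subseteq> ?G" using gen unfolding generating_def by blast
  have "(u, v) \<in> ?R" if uv: "u \<in> vertices N" "v \<in> vertices N" for u v
  proof -
    obtain a i b k where ab: "a \<in> periods N" "b \<in> periods N" "i \<in> I" "k \<in> I"
      and [simp]: "u = P a i" "v = P b k" using uv by (metis vertexE)
    have "(P a i, P a r) \<in> ?R" by (intro tree ab)
    also have "(P a r, P (a + (b - a)) r) \<in> ?R"
      using G ab period_diff[of b a] by blast
    also have "(P (a + (b - a)) r, P b k) \<in> ?R" using tree ab sym by simp
    finally show ?thesis by simp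
  qed
  moreover have "e \<subseteq> vertices N \<and> card e = 2" if e: "e \<in> edges N" for e
  proof -
    obtain a j where aj: "a \<in> periods N" "j \<in> J" and e: "e = {P a (src j), P (a + vol j) (tgt j)}"
      using e by (auto simp: edges_eq)
    have "P a (src j) \<noteq> P (a + vol j) (tgt j)"
      using aj no_loop[of j j] by (auto simp: P_eq_iff src tgt vol period_add)
    then show ?thesis using aj by (auto simp: e intro!: P_vertex src tgt vol period_add)
  qed
  moreover have "shift N a ` e \<in> edges N" if "a \<in> periods N" "e \<in> edges N" for a e
    using that by (auto simp: edges_lift shift_lift) (metis period_add)
  moreover have "finite (mverts (quotient_graph N))" "finite (medges (quotient_graph N))"
    using quotient_iso finite_I finite_J bij_betw_finite
    by (force simp: multigraph_iso_def)+
  moreover have "vertices N \<noteq> {}" using I_nonempty period_zero by (auto simp: vertices_eq)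
  moreover have "\<forall>v\<in>vertices N. shift N 0 v = v"
    using period_zero by (auto simp: vertices_eq shift_shift)
  moreover have "\<forall>a\<in>periods N. \<forall>b\<in>periods N. \<forall>v\<in>vertices N.
       shift N (a + b) v = shift N a (shift N b v)"
    by (auto simp: vertices_eq shift_shift period_add add.assoc)
  moreover have "\<forall>a\<in>periods N. \<forall>v\<in>vertices N.
       shift N a v \<in> vertices N \<and> pos N (shift N a v) = pos N v + a"
  proof (intro ballI)
    fix a v assume a: "a \<in> periods N" and "v \<in> vertices N"
    then obtain b i where bi: "b \<in> periods N" "i \<in> I" "v = P b i" by (metis vertexE)
    then show "shift N a v \<in> vertices N \<and> pos N (shift N a v) = pos N v + a"
      using a P_vertex[of "a + b" i] by (simp add: shift_shift pos_shift period_add)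
  qed
  ultimately show ?thesis
    using lattice unfolding periodic_placed_graph_def by blast
qed

text \<open>An edge changes the lattice coordinate by plus or minus a voltage, so a path starting at
  coordinate 0 never leaves \<open>G\<close>. By connectedness it can reach every period.\<close>

lemma placed_imp_generating:
  assumes placed: "periodic_placed_graph N"
  shows "generating"
  unfolding generating_def
proof (intro allI impI, elim conjE)
  fix G assume G: "add_subgroup G" "vol ` J \<subseteq> G"
  obtain r where r: "r \<in> I" using I_nonempty by blast
  let ?W = "{P a i | a i. a \<in> periods N \<and> a \<in> G \<and> i \<in> I}"
  have W_step: "y \<in> ?W" if x: "x \<in> ?W" and xy: "{x, y} \<in> edges N" for x y
  proof -
    obtain a i where ai: "a \<in> periods N" "a \<in> G" "i \<in> I" "x = P a i"
      using x by blast
    then have "y \<in> dart_end a ` darts i"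
      using xy neighbours_P[of a i] by (auto simp: neighbours_def)
    then consider j where "j \<in> J" "src j = i" "y = P (a + vol j) (tgt j)"
      | j where "j \<in> J" "tgt j = i" "y = P (a - vol j) (src j)"
      by (auto simp: darts_def)
    then show ?thesis
    proof cases
      case (1 j)
      then have "a + vol j \<in> periods N" "a + vol j \<in> G" "tgt j \<in> I"
        using ai G by (auto intro: period_add vol add_subgroup_add tgt)
      then show ?thesis using 1 by blast
    next
      case (2 j)
      then have "a - vol j \<in> periods N" "a - vol j \<in> G" "src j \<in> I"
        using ai G by (auto intro: period_diff vol add_subgroup_diff src)
      then show ?thesis using 2 by blast
    qed
  qed
  show "periods N \<subseteq> G"
  proof
    fix a assume a: "a \<in> periods N"
    have "(P 0 r, P a r) \<in> adj_rel\<^sup>*"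
    proof -
      have "\<forall>u\<in>vertices N. \<forall>v\<in>vertices N. (u, v) \<in> adj_rel\<^sup>*"
        using placed by (simp add: periodic_placed_graph_def)
      then show ?thesis using P_vertex[OF period_zero r] P_vertex[OF a r] by blast
    qed
    then have "P a r \<in> ?W"
    proof (induction rule: rtrancl_induct)
      case base
      show ?case using add_subgroup_zero[OF G(1)] period_zero r by blast
    next
      case (step y z)
      then show ?case using W_step[of y z] by simp
    qed
    then obtain b i where "P a r = P b i" "b \<in> periods N" "b \<in> G" "i \<in> I" by blast
    then show "a \<in> G" using a r by (simp add: P_eq_iff)
  qed
qed

lemma periodic_networkI:
  assumes "periodic_placed_graph N" "\<And>j. j \<in> J \<Longrightarrow> evec j \<noteq> 0"
    and "\<And>i. i \<in> I \<Longrightarrow> inj_on (\<lambda>x. sgn (dart_vec x)) (darts i)"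
  shows "periodic_network N"
proof -
  have "dist (pos N u) (pos N v) > 0" if "{u, v} \<in> edges N" for u v
  proof -
    have "dist (pos N u) (pos N v) \<in> (\<lambda>j. norm (evec j)) ` J"
      using that by (subst edge_lengths[symmetric]) blast
    then show ?thesis using assms(2) by auto
  qed
  then show ?thesis
    unfolding periodic_network_def using assms immersedI by blast
qed

lemma evec_nonzero:
  assumes "periodic_network N" "j \<in> J"
  shows "evec j \<noteq> 0"
proof -
  have "norm (evec j) \<in> {dist (pos N u) (pos N v) | u v. {u, v} \<in> edges N}"
    using assms(2) by (simp add: edge_lengths)
  then show ?thesis using assms(1) by (auto simp: periodic_network_def)
qed

lemma steiner_iff:
  "steiner_network N \<longleftrightarrow> periodic_network N \<and>
    (\<forall>i\<in>I. card (darts i) = 3 \<and> (\<Sum>x\<in>darts i. sgn (dart_vec x)) = 0)"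
proof -
  have "(\<forall>v\<in>vertices N. Q v) \<longleftrightarrow> (\<forall>i\<in>I. \<forall>a\<in>periods N. Q (P a i))" for Q
    by (auto simp: vertices_eq)
  then show ?thesis
    unfolding steiner_network_def using steiner_P period_zero by (auto simp: shift_zero)
qed

end

section \<open>Replacing edges and positions, and contracting an edge\<close>

definition regraph ::
  "('v, 'a::euclidean_space) network \<Rightarrow> 'i set \<Rightarrow> ('i \<Rightarrow> 'v) \<Rightarrow> 'j set \<Rightarrow> ('j \<Rightarrow> 'i) \<Rightarrow> ('j \<Rightarrow> 'i) \<Rightarrow>
    ('j \<Rightarrow> 'a) \<Rightarrow> ('v \<Rightarrow> 'a) \<Rightarrow> ('v, 'a) network"
  where "regraph N I base J src tgt vol q =
    N\<lparr>vertices := {shift N a (base i) | a i. a \<in> periods N \<and> i \<in> I},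
      edges := {{shift N a (base (src j)), shift N (a + vol j) (base (tgt j))} | a j.
        a \<in> periods N \<and> j \<in> J},
      pos := q\<rparr>"

lemma regraph_simps [simp]:
  "pos (regraph N I base J src tgt vol q) = q"
  "periods (regraph N I base J src tgt vol q) = periods N"
  "shift (regraph N I base J src tgt vol q) = shift N"
  "(regraph N I base J src tgt vol q)\<lparr>pos := q'\<rparr> = regraph N I base J src tgt vol q'"
  by (simp_all add: regraph_def)

text \<open>Rebuilding a graph from its own data gives back the record itself, not a copy; this lets
  the homotopy start exactly at the given network.\<close>

lemma (in lifted_graph) regraph_same: "regraph N I base J src tgt vol q = N\<lparr>pos := q\<rparr>"
  unfolding regraph_def vertices_eq[symmetric] edges_eq[symmetric] by simp

text \<open>The free action is inherited, so only the edge data and the equivariance of the new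
  positions remain to be checked. A proper subset \<open>I'\<close> drops whole orbits of
  vertices.\<close>

lemma (in lifted_graph) lifted_regraph:
  assumes "I' \<subseteq> I" "I' \<noteq> {}" "finite J'"
    and "\<And>j. j \<in> J' \<Longrightarrow> src' j \<in> I'" "\<And>j. j \<in> J' \<Longrightarrow> tgt' j \<in> I'"
    and "\<And>j. j \<in> J' \<Longrightarrow> vol' j \<in> periods N"
    and "\<And>j k. j \<in> J' \<Longrightarrow> k \<in> J' \<Longrightarrow> src' j = tgt' k \<Longrightarrow> tgt' j \<noteq> src' k"
    and "\<And>j k. j \<in> J' \<Longrightarrow> k \<in> J' \<Longrightarrow> src' j = src' k \<Longrightarrow> tgt' j = tgt' k \<Longrightarrow> vol' j = vol' k \<Longrightarrow> j = k"
    and "\<And>a i. a \<in> periods N \<Longrightarrow> i \<in> I' \<Longrightarrow> q (shift N a (base i)) = q (base i) + a"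
  shows "lifted_graph (regraph N I' base J' src' tgt' vol' q) I' base J' src' tgt' vol'"
proof
  show "finite I'" using finite_subset[OF assms(1) finite_I] .
  show "a = b \<and> i = i'" if "a \<in> periods (regraph N I' base J' src' tgt' vol' q)"
    "b \<in> periods (regraph N I' base J' src' tgt' vol' q)" "i \<in> I'" "i' \<in> I'"
    "shift (regraph N I' base J' src' tgt' vol' q) a (base i) =
      shift (regraph N I' base J' src' tgt' vol' q) b (base i')" for a b i i'
    using that assms(1) shift_base_inj[of a b i i'] by auto
qed (use assms lattice shift_zero shift_shift in \<open>auto simp: regraph_def subset_iff\<close>)

lemma collapses_to_refl:
  assumes "periodic_network M"
  shows "collapses_to M M"
proof -
  have e: "\<exists>u v. e = {u, v} \<and> pos M u \<noteq> pos M v" if "e \<in> edges M" for e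
  proof -
    have "card e = 2" using assms that by (auto simp: periodic_network_def periodic_placed_graph_def)
    then obtain u v where "e = {u, v}" by (auto simp: card_2_iff)
    then show ?thesis using assms that by (auto simp: periodic_network_def)
  qed
  have no_zero: "{(x, y). {x, y} \<in> edges M \<and> pos M x = pos M y} = {}"
    using assms by (force simp: periodic_network_def)
  have "{e \<in> edges M. inj_on (pos M) e} = edges M"
    using e by fastforce
  then show ?thesis
    unfolding collapses_to_def no_zero by (intro conjI exI[of _ id]) (simp_all add: bij_betw_def)
qed

text \<open>The orbit of \<open>z\<close> is folded onto that of \<open>y\<close>, translate by
  translate. Since \<open>vol e = 0\<close>, the lifts of \<open>e\<close> join equal translates, so
  the folding is equivariant and its fibres are the components of the zero-length edges. The other
  edges keep label and voltage and only have an end renamed.\<close>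

lemma contraction_collapses:
  assumes "lifted_graph K I base J src tgt vol"
    and "lifted_graph M (I - {z}) base (J - {e}) src' tgt' vol"
    and same: "periods M = periods K" "shift M = shift K" "pos M = pos K"
    and e: "e \<in> J" "src e = y" "tgt e = z" "vol e = 0"
    and src': "\<And>j. j \<in> J - {e} \<Longrightarrow> src' j = (if src j = z then y else src j)"
    and tgt': "\<And>j. j \<in> J - {e} \<Longrightarrow> tgt' j = (if tgt j = z then y else tgt j)"
    and pos: "pos K (base y) = pos K (base z)"
    and nz: "\<And>j. j \<in> J - {e} \<Longrightarrow> pos K (base (tgt j)) + vol j \<noteq> pos K (base (src j))"
  shows "collapses_to K M"
proof -
  interpret K: lifted_graph K I base J src tgt vol by fact
  interpret M: lifted_graph M "I - {z}" base "J - {e}" src' tgt' vol by fact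
  have yz: "y \<in> I" "z \<in> I" "y \<noteq> z"
    using K.src[OF e(1)] K.tgt[OF e(1)] K.no_loop[OF e(1) e(1)] e by auto
  define r where "r i = (if i = z then y else i)" for i
  \<comment> \<open>The action is free, so the description operator recovers the unique lattice
    coordinate of a lift of \<open>z\<close>; all other vertices stay fixed.\<close>
  define c where "c v = (if \<exists>a\<in>periods K. v = K.P a z then K.P (THE a. a \<in> periods K \<and> v = K.P a z) y
    else v)" for v
  have c: "c (K.P a i) = K.P a (r i)" if "a \<in> periods K" "i \<in> I" for a i
  proof (cases "i = z")
    case True
    have "(THE b. b \<in> periods K \<and> K.P a i = K.P b z) = a"
      using that yz True by (intro the_equality) (auto simp: K.P_eq_iff)
    then show ?thesis using that True by (auto simp: c_def r_def)
  next
    case False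
    then show ?thesis using that yz by (auto simp: c_def r_def K.P_eq_iff)
  qed
  let ?R = "{(x, y). {x, y} \<in> edges K \<and> pos K x = pos K y}"
  have clift: "c ` K.lift a j = M.lift a j" if "a \<in> periods K" "j \<in> J - {e}" for a j
    using that by (auto simp: K.lift_def M.lift_def c K.src K.tgt K.period_add K.vol src' tgt' r_def same)
  have inj_lift: "inj_on (pos K) (K.lift a j) \<longleftrightarrow> j \<noteq> e" if "a \<in> periods K" "j \<in> J" for a j
  proof -
    have "K.P a (src j) \<noteq> K.P (a + vol j) (tgt j)"
      using that K.no_loop[of j j] by (auto simp: K.P_eq_iff K.src K.tgt K.vol K.period_add)
    then have "inj_on (pos K) (K.lift a j) \<longleftrightarrow>
        pos K (base (tgt j)) + vol j \<noteq> pos K (base (src j))"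
      using that by (auto simp: inj_on_def K.lift_def K.pos_shift K.src K.tgt K.vol K.period_add algebra_simps)
    then show ?thesis using that nz pos e by auto
  qed
  have zero_edges: "{u \<in> edges K. inj_on (pos K) u} = {K.lift a j | a j. a \<in> periods K \<and> j \<in> J - {e}}"
    unfolding K.edges_lift using inj_lift by blast
  have "bij_betw ((`) c) {u \<in> edges K. inj_on (pos K) u} (edges M)"
    unfolding bij_betw_def
  proof
    show "inj_on ((`) c) {u \<in> edges K. inj_on (pos K) u}"
      unfolding zero_edges
      by (rule inj_onI) (auto simp: clift M.lift_eq_iff same)
    have "(`) c ` {K.lift a j | a j. a \<in> periods K \<and> j \<in> J - {e}} =
        {c ` K.lift a j | a j. a \<in> periods K \<and> j \<in> J - {e}}" by auto
    also have "\<dots> = {M.lift a j | a j. a \<in> periods K \<and> j \<in> J - {e}}"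
      using clift by (metis (no_types, lifting))
    finally show "(`) c ` {u \<in> edges K. inj_on (pos K) u} = edges M"
      by (simp add: zero_edges M.edges_lift same)
  qed
  moreover have "c u = c v \<longleftrightarrow> (u, v) \<in> ?R\<^sup>*" if uv: "u \<in> vertices K" "v \<in> vertices K" for u v
  proof
    obtain a i b k where [simp]: "u = K.P a i" "v = K.P b k"
      and ab: "a \<in> periods K" "b \<in> periods K" "i \<in> I" "k \<in> I"
      using uv by (metis K.vertexE)
    assume "c u = c v"
    then have "a = b" "r i = r k"
      using ab yz by (auto simp: c K.P_eq_iff r_def split: if_splits)
    \<comment> \<open>Distinct vertices with the same image are the two ends of a single lift of
      \<open>e\<close>, so one step of the relation joins them.\<close>
    then consider "u = v" | "u = K.P a y" "v = K.P a z" | "u = K.P a z" "v = K.P a y"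
      by (auto simp: r_def split: if_splits)
    moreover have "(K.P a y, K.P a z) \<in> ?R" "(K.P a z, K.P a y) \<in> ?R"
      using ab pos yz K.adj_rel_lift[OF ab(1) e(1)] by (auto simp: e K.pos_shift insert_commute)
    ultimately show "(u, v) \<in> ?R\<^sup>*" by cases auto
  next
    assume "(u, v) \<in> ?R\<^sup>*"
    then show "c u = c v"
    proof (induction rule: rtrancl_induct)
      case (step x w)
      have "c x = c w" if "x \<noteq> w"
      proof -
        obtain a j where aj: "a \<in> periods K" "j \<in> J" "{x, w} = K.lift a j"
          using step by (auto simp: K.edges_lift)
        moreover have "\<not> inj_on (pos K) {x, w}" using that step by (auto simp: inj_on_def)
        ultimately have "{x, w} = K.lift a e" using inj_lift by auto
        then show ?thesis
          using yz aj by (auto simp: K.lift_def e doubleton_eq_iff c r_def)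
      qed
      then show ?case using step by auto
    qed simp
  qed
  moreover have "c ` vertices K = vertices M"
  proof -
    have "c ` vertices K = {c (K.P a i) | a i. a \<in> periods K \<and> i \<in> I}"
      by (auto simp: K.vertices_eq)
    also have "\<dots> = {K.P a (r i) | a i. a \<in> periods K \<and> i \<in> I}"
      using c by (metis (no_types, lifting))
    also have "\<dots> = {K.P a i | a i. a \<in> periods K \<and> i \<in> I - {z}}"
      using yz unfolding r_def by (auto split: if_splits)
    finally show ?thesis by (simp add: M.vertices_eq same)
  qed
  moreover have "pos M (c v) = pos K v" if v: "v \<in> vertices K" for v
  proof -
    obtain a i where "v = K.P a i" "a \<in> periods K" "i \<in> I" using v by (rule K.vertexE)
    then show ?thesis using pos yz by (auto simp: c r_def same K.pos_shift)
  qed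
  moreover have "c (shift K a v) = shift M a (c v)" if a: "a \<in> periods K" and v: "v \<in> vertices K" for a v
  proof -
    obtain b i where "v = K.P b i" "b \<in> periods K" "i \<in> I" using v by (rule K.vertexE)
    then show ?thesis using a yz by (auto simp: c r_def same K.shift_shift K.period_add)
  qed
  ultimately show ?thesis
    unfolding collapses_to_def using same by (intro conjI exI[of _ c]) auto
qed

section \<open>Isomorphic quotients and similar networks\<close>

lemma multigraph_iso_inverse:
  assumes iso: "multigraph_iso f g G H"
    and ends: "\<And>e. e \<in> medges G \<Longrightarrow> mends G e \<subseteq> mverts G"
  shows "multigraph_iso (inv_into (mverts G) f) (inv_into (medges G) g) H G"
proof -
  have f: "bij_betw f (mverts G) (mverts H)" and g: "bij_betw g (medges G) (medges H)"
    and fg: "\<And>e. e \<in> medges G \<Longrightarrow> mends H (g e) = f ` mends G e"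
    using iso by (auto simp: multigraph_iso_def)
  have "mends G (inv_into (medges G) g e) = inv_into (mverts G) f ` mends H e" if e: "e \<in> medges H" for e
  proof -
    have *: "inv_into (medges G) g e \<in> medges G" "g (inv_into (medges G) g e) = e"
      using e g by (metis bij_betw_def inv_into_into, metis bij_betw_inv_into_right)
    then have "mends H e = f ` mends G (inv_into (medges G) g e)" using fg by metis
    then show ?thesis
      using ends[OF *(1)] f by (simp add: bij_betw_def inv_into_image_cancel)
  qed
  then show ?thesis
    using f g by (simp add: multigraph_iso_def bij_betw_inv_into)
qed

lemma multigraph_iso_trans:
  assumes "multigraph_iso f g G H" "multigraph_iso f' g' H K"
  shows "multigraph_iso (f' \<circ> f) (g' \<circ> g) G K"
proof -
  have "mends K (g' (g e)) = f' ` f ` mends G e" if "e \<in> medges G" for e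
    using assms that by (metis bij_betwE multigraph_iso_def)
  then show ?thesis
    using assms by (auto simp: multigraph_iso_def image_comp intro: bij_betw_trans)
qed

text \<open>The bijection of vertices keeps the label and applies \<open>T\<close> to the lattice
  coordinate. The points \<open>o1\<close> and \<open>o2\<close> absorb the translation part, so
  only relative positions have to be matched.\<close>

lemma similar_lifted_graphs:
  assumes "lifted_graph N I base J src tgt vol" "lifted_graph N' I base' J src tgt vol'"
    and f: "orthogonal_transformation f" and c: "c > 0"
    and T: "T = (\<lambda>x. c *\<^sub>R f x)"
    and periods: "T ` periods N = periods N'"
    and vol: "\<And>j. j \<in> J \<Longrightarrow> T (vol j) = vol' j"
    and pos: "\<And>i. i \<in> I \<Longrightarrow> T (pos N (base i) - o1) = pos N' (base' i) - o2"
  shows "similar_networks N N'"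
proof -
  interpret A: lifted_graph N I base J src tgt vol by fact
  interpret B: lifted_graph N' I base' J src tgt vol' by fact
  have lin: "linear T"
    unfolding T using orthogonal_transformation_linear[OF f] by (rule linear_compose_scale_right)
  have inj: "inj T"
    using orthogonal_transformation_inj[OF f] c by (auto simp: T inj_def)
  let ?co = "inv_into (periods N \<times> I) (\<lambda>(a, i). A.P a i)"
  define h where "h v = B.P (T (fst (?co v))) (snd (?co v))" for v
  have Pinj: "inj_on (\<lambda>(a, i). A.P a i) (periods N \<times> I)"
    by (auto simp: inj_on_def A.P_eq_iff)
  have h: "h (A.P a i) = B.P (T a) i" if "a \<in> periods N" "i \<in> I" for a i
    using inv_into_f_f[OF Pinj, of "(a, i)"] that by (simp add: h_def)
  have TP: "T a \<in> periods N'" if "a \<in> periods N" for a using that periods by blast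
  have "inj_on h (vertices N)"
  proof (rule inj_onI)
    fix u v assume u: "u \<in> vertices N" and v: "v \<in> vertices N" and uv: "h u = h v"
    obtain a i where ai: "u = A.P a i" "a \<in> periods N" "i \<in> I" using u by (rule A.vertexE)
    obtain b k where bk: "v = A.P b k" "b \<in> periods N" "k \<in> I" using v by (rule A.vertexE)
    show "u = v"
      using uv ai bk inj by (auto simp: h B.P_eq_iff TP dest: injD)
  qed
  moreover have "h ` vertices N = vertices N'"
  proof -
    have "h ` vertices N = {h (A.P a i) | a i. a \<in> periods N \<and> i \<in> I}"
      by (auto simp: A.vertices_eq)
    also have "\<dots> = {B.P (T a) i | a i. a \<in> periods N \<and> i \<in> I}"
      using h by (metis (no_types, lifting))
    also have "\<dots> = {B.P a i | a i. a \<in> T ` periods N \<and> i \<in> I}"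
      by blast
    finally show ?thesis by (simp add: periods B.vertices_eq)
  qed
  moreover have "(`) h ` edges N = edges N'"
  proof -
    have hl: "h ` A.lift a j = B.lift (T a) j" if "a \<in> periods N" "j \<in> J" for a j
      using that by (simp add: A.lift_def B.lift_def h A.src A.tgt A.vol A.period_add linear_add[OF lin] vol)
    have "(`) h ` edges N = {h ` A.lift a j | a j. a \<in> periods N \<and> j \<in> J}"
      by (auto simp: A.edges_lift)
    also have "\<dots> = {B.lift (T a) j | a j. a \<in> periods N \<and> j \<in> J}"
      using hl by (metis (no_types, lifting))
    also have "\<dots> = {B.lift a j | a j. a \<in> T ` periods N \<and> j \<in> J}"
      by blast
    finally show ?thesis by (simp add: periods B.edges_lift)
  qed
  moreover have "pos N' (h v) = c *\<^sub>R f (pos N v) + (o2 - T o1)" if v: "v \<in> vertices N" for v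
  proof -
    obtain a i where ai: "v = A.P a i" "a \<in> periods N" "i \<in> I" using v by (rule A.vertexE)
    have "pos N' (h v) = T (pos N (base i) - o1) + o2 + T a"
      using ai pos[OF ai(3)] by (simp add: h B.pos_shift TP)
    also have "\<dots> = T (pos N v) + (o2 - T o1)"
      using ai by (simp add: A.pos_shift linear_diff[OF lin] linear_add[OF lin])
    finally show ?thesis by (simp add: T)
  qed
  moreover have "similarity (\<lambda>x. c *\<^sub>R f x + (o2 - T o1))"
    using f c unfolding similarity_def by blast
  ultimately show ?thesis
    unfolding similar_networks_def bij_betw_def by blast
qed

lemma dist_similarity:
  assumes "similarity S"
  obtains c where "c > 0" "\<And>x y. dist (S x) (S y) = c * dist x y"
proof -
  obtain c f b where *: "c > 0" "orthogonal_transformation f" "S = (\<lambda>x. c *\<^sub>R f x + b)"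
    using assms by (auto simp: similarity_def)
  have "dist (S x) (S y) = c * dist x y" for x y
  proof -
    have "dist (S x) (S y) = norm (c *\<^sub>R (f x - f y))"
      by (simp add: * dist_norm scaleR_diff_right)
    also have "\<dots> = c * dist (f x) (f y)"
      using *(1) by (simp add: dist_norm)
    finally show ?thesis
      using *(2)[unfolded orthogonal_transformation_isometry] by simp
  qed
  then show ?thesis using that *(1) by blast
qed

text \<open>A similarity of networks need not carry one lattice to the other, so quotients cannot be
  compared. The set of edge lengths up to a common factor is an invariant that survives, and it
  distinguishes the members of the family.\<close>

lemma similar_edge_lengths:
  assumes "similar_networks N N'"
    and pairs: "\<And>e. e \<in> edges N \<Longrightarrow> e \<subseteq> vertices N \<and> card e = 2"
  obtains c where "c > 0" "{dist (pos N' u) (pos N' v) | u v. {u, v} \<in> edges N'} =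
    (*) c ` {dist (pos N u) (pos N v) | u v. {u, v} \<in> edges N}"
proof -
  obtain S h where S: "similarity S" and h: "bij_betw h (vertices N) (vertices N')"
    and edges: "(`) h ` edges N = edges N'"
    and pos: "\<And>v. v \<in> vertices N \<Longrightarrow> pos N' (h v) = S (pos N v)"
    using assms(1) by (auto simp: similar_networks_def)
  obtain c where c: "c > 0" "\<And>x y. dist (S x) (S y) = c * dist x y"
    using dist_similarity[OF S] by blast
  have len: "dist (pos N' (h u)) (pos N' (h v)) = c * dist (pos N u) (pos N v)"
    if "{u, v} \<in> edges N" for u v
    using pairs[OF that] by (simp add: pos c)
  show ?thesis
  proof (rule that[OF c(1)], intro equalityI subsetI)
    fix x assume "x \<in> {dist (pos N' u) (pos N' v) | u v. {u, v} \<in> edges N'}"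
    then obtain u' v' where x: "x = dist (pos N' u') (pos N' v')" and e': "{u', v'} \<in> edges N'" by blast
    then obtain e where e: "e \<in> edges N" "{u', v'} = h ` e" using edges by blast
    then obtain u v where uv: "e = {u, v}" using pairs by (metis card_2_iff)
    then have "x = dist (pos N' (h u)) (pos N' (h v))"
      using e x by (auto simp: doubleton_eq_iff dist_commute)
    then show "x \<in> (*) c ` {dist (pos N u) (pos N v) | u v. {u, v} \<in> edges N}"
      using len e uv by auto
  next
    fix x assume "x \<in> (*) c ` {dist (pos N u) (pos N v) | u v. {u, v} \<in> edges N}"
    then obtain u v where uv: "{u, v} \<in> edges N" and x: "x = dist (pos N' (h u)) (pos N' (h v))"
      using len by auto
    have "h ` {u, v} \<in> edges N'" using uv edges by blast
    then show "x \<in> {dist (pos N' u) (pos N' v) | u v. {u, v} \<in> edges N'}"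
      using x by auto
  qed
qed

section \<open>Lattices in space\<close>

lemma int_span_subset_span: "int_span B \<subseteq> span B"
  by (rule int_span_least) (auto simp: add_subgroup_def span_zero span_diff span_base)

lemma int_span_tripleE:
  assumes "distinct [a, b, c]" "x \<in> int_span {a, b, c}"
  obtains i j k :: int where "x = of_int i *\<^sub>R a + of_int j *\<^sub>R b + of_int k *\<^sub>R c"
  using assms by (auto simp: int_span_triple)

lemma spanning_triple:
  fixes a b c :: "real^3"
  assumes span: "span {a, b, c} = UNIV"
  shows "independent {a, b, c} \<and> distinct [a, b, c]"
proof -
  have "3 \<le> card {a, b, c}"
    using dim_le_card[of "UNIV :: (real^3) set" "{a, b, c}"] span by (simp add: dim_UNIV)
  then have "card {a, b, c} = 3" "distinct [a, b, c]"
    by (auto simp: card_insert_if split: if_splits)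
  moreover from this have "independent {a, b, c}"
    using card_eq_dim[of "{a, b, c}" UNIV] span by (simp add: dim_UNIV)
  ultimately show ?thesis by simp
qed

text \<open>A full lattice contains a basis of space, so its generators span; three spanning vectors
  in dimension three are distinct and independent.\<close>

lemma lattice_basis_triple:
  fixes a b c :: "real^3"
  assumes "full_lattice \<Lambda>" "\<Lambda> = int_span {a, b, c}"
  shows "lattice_basis \<Lambda> {a, b, c} \<and> distinct [a, b, c]"
proof -
  obtain B where "span B = UNIV" "int_span B = \<Lambda>" "independent B"
    using assms(1) by (auto simp: full_lattice_def lattice_basis_def)
  moreover from this have "B \<subseteq> \<Lambda>"
    using int_span_base[of B] independent_bound by blast
  ultimately have "span {a, b, c} = UNIV"
    using assms(2) int_span_subset_span[of "{a, b, c}"] span_minimal[OF _ subspace_span, of B "{a, b, c}"]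
    by auto
  then show ?thesis using spanning_triple assms(2) by (simp add: lattice_basis_def)
qed

section \<open>Triple products and covolume\<close>

lemma triple_product_expand:
  "cross3 (a1 *\<^sub>R x + a2 *\<^sub>R y + a3 *\<^sub>R z) (b1 *\<^sub>R x + b2 *\<^sub>R y + b3 *\<^sub>R z) \<bullet>
      (c1 *\<^sub>R x + c2 *\<^sub>R y + c3 *\<^sub>R z) =
    (a1 * (b2 * c3 - b3 * c2) - a2 * (b1 * c3 - b3 * c1) + a3 * (b1 * c2 - b2 * c1)) *
      (cross3 x y \<bullet> z)"
  by (simp add: cross3_simps)

text \<open>Otherwise \<open>cross3 a b\<close> would be orthogonal to a spanning set, hence zero,
  and \<open>a\<close>, \<open>b\<close> would be collinear.\<close>

lemma triple_product_nonzero: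
  assumes "independent {a, b, c}" "distinct [a, b, c]"
  shows "cross3 a b \<bullet> c \<noteq> 0"
proof
  assume z: "cross3 a b \<bullet> c = 0"
  have "span {a, b, c} = UNIV"
    using assms card_eq_dim[of "{a, b, c}" UNIV] by (auto simp: dim_UNIV)
  moreover have "orthogonal (cross3 a b) x" if "x \<in> span {a, b, c}" for x
    using that
  proof (rule orthogonal_to_span)
    show "\<And>y. y \<in> {a, b, c} \<Longrightarrow> orthogonal (cross3 a b) y"
      using z by (auto simp: orthogonal_cross) (simp add: orthogonal_def)
  qed
  ultimately have "orthogonal (cross3 a b) (cross3 a b)" by blast
  then have "collinear {0, a, b}" by (simp add: orthogonal_def cross_eq_0)
  then obtain r where "a = 0 \<or> b = r *\<^sub>R a" using scaleR_zero_left by (metis collinear_lemma)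
  moreover have "independent {a, b}" using independent_mono[OF assms(1), of "{a, b}"] by auto
  moreover have "b \<noteq> r *\<^sub>R a"
  proof
    assume "b = r *\<^sub>R a"
    then have "b \<in> span ({a, b} - {b})" using assms(2) by (auto simp: span_base span_mul)
    then show False using \<open>independent {a, b}\<close> by (auto simp: dependent_def)
  qed
  ultimately show False by (auto simp: dependent_zero)
qed

lemma measure_half_open_cube: "{x::real^3. \<forall>i. 0 \<le> x $ i \<and> x $ i < 1} \<in> lmeasurable"
    "measure lebesgue {x::real^3. \<forall>i. 0 \<le> x $ i \<and> x $ i < 1} = 1"
proof -
  let ?Q = "{x::real^3. \<forall>i. 0 \<le> x $ i \<and> x $ i < 1}"
  have sub: "box 0 1 \<subseteq> ?Q" "?Q \<subseteq> cbox 0 1"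
    by (auto simp: mem_box_cart less_imp_le)
  have "negligible (cbox 0 1 - ?Q \<union> (?Q - cbox 0 1))"
    by (rule negligible_subset[OF negligible_frontier_interval[of 0 "1::real^3"]]) (use sub in auto)
  then show "?Q \<in> lmeasurable" "measure lebesgue ?Q = 1"
    using lmeasurable_negligible_symdiff[of "cbox 0 (1::real^3)" ?Q]
      measure_negligible_symdiff[of "cbox 0 (1::real^3)" ?Q]
    by (simp_all add: content_cbox_if_cart interval_eq_empty_cart measure_completion)
qed

lemma measure_parallelepiped:
  fixes a b c :: "real^3"
  assumes "distinct [a, b, c]"
  shows "measure lebesgue (fundamental_parallelepiped {a, b, c}) = \<bar>cross3 a b \<bullet> c\<bar>"
proof -
  let ?Q = "{x::real^3. \<forall>i. 0 \<le> x $ i \<and> x $ i < 1}"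
  let ?M = "transpose (vector [a, b, c] :: real^3^3)"
  have M: "?M *v y = y $ 1 *\<^sub>R a + y $ 2 *\<^sub>R b + y $ 3 *\<^sub>R c" for y
    by (simp add: vec_eq_iff forall_3 matrix_vector_mult_def sum_3 transpose_def algebra_simps)
  have "fundamental_parallelepiped {a, b, c} = (\<lambda>y. ?M *v y) ` ?Q"
  proof (intro equalityI subsetI)
    fix x assume "x \<in> fundamental_parallelepiped {a, b, c}"
    then obtain k where k: "\<forall>b\<in>{a, b, c}. 0 \<le> k b \<and> k b < (1::real)"
      and x: "x = k a *\<^sub>R a + k b *\<^sub>R b + k c *\<^sub>R c"
      using assms by (auto simp: fundamental_parallelepiped_def add.assoc)
    then show "x \<in> (\<lambda>y. ?M *v y) ` ?Q"
      unfolding M by (intro image_eqI[of _ _ "vector [k a, k b, k c]"]) (auto simp: forall_3)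
  next
    fix x assume "x \<in> (\<lambda>y. ?M *v y) ` ?Q"
    then obtain y :: "real^3" where y: "\<forall>i. 0 \<le> y $ i \<and> y $ i < 1"
      and x: "x = y $ 1 *\<^sub>R a + y $ 2 *\<^sub>R b + y $ 3 *\<^sub>R c"
      unfolding M by auto
    define k where "k = (\<lambda>v. if v = a then y $ 1 else if v = b then y $ 2 else y $ 3)"
    have "x = (\<Sum>v\<in>{a, b, c}. k v *\<^sub>R v)" "\<forall>v\<in>{a, b, c}. 0 \<le> k v \<and> k v < 1"
      using assms x y by (auto simp: k_def)
    then show "x \<in> fundamental_parallelepiped {a, b, c}"
      unfolding fundamental_parallelepiped_def by blast
  qed
  moreover have "matrix (\<lambda>y. ?M *v y) = ?M" by (rule matrix_of_matrix_vector_mul)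
  moreover have "det ?M = cross3 a b \<bullet> c"
    by (simp only: det_transpose) (simp add: cross3_simps)
  ultimately show ?thesis
    using measure_linear_image[OF matrix_vector_mul_linear measure_half_open_cube(1), of ?M]
    by (simp only: measure_half_open_cube(2) mult_1_right)
qed

text \<open>The covolume is defined through some chosen basis. Each of two bases has integer
  coordinates in the other, so their triple products are integer multiples of each other; the two
  factors multiply to 1, so they are units.\<close>

lemma covolume_triple:
  fixes a b c :: "real^3"
  assumes basis: "lattice_basis \<Lambda> {a, b, c}" and dist: "distinct [a, b, c]"
  shows "covolume \<Lambda> = \<bar>cross3 a b \<bullet> c\<bar>"
proof -
  define B where "B = (SOME B. lattice_basis \<Lambda> B)"
  have B: "lattice_basis \<Lambda> B" unfolding B_def using basis by (rule someI)
  then have "card B = 3" and "finite B"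
    using basis_card_eq_dim[of B UNIV] independent_bound[of B] by (auto simp: lattice_basis_def)
  then obtain x y z where Bxyz: "B = {x, y, z}" and dist': "distinct [x, y, z]"
    by (auto simp: card_3_iff)
  have L: "int_span {a, b, c} = \<Lambda>" "int_span {x, y, z} = \<Lambda>"
    using basis B Bxyz by (auto simp: lattice_basis_def)
  have int: "\<exists>m::int. cross3 u v \<bullet> w = of_int m * (cross3 p q \<bullet> r)"
    if uvw: "u \<in> int_span {p, q, r}" "v \<in> int_span {p, q, r}" "w \<in> int_span {p, q, r}"
      and d: "distinct [p, q, r]" for u v w p q r :: "real^3"
  proof -
    obtain a1 a2 a3 b1 b2 b3 c1 c2 c3 :: int
      where "u = of_int a1 *\<^sub>R p + of_int a2 *\<^sub>R q + of_int a3 *\<^sub>R r"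
        "v = of_int b1 *\<^sub>R p + of_int b2 *\<^sub>R q + of_int b3 *\<^sub>R r"
        "w = of_int c1 *\<^sub>R p + of_int c2 *\<^sub>R q + of_int c3 *\<^sub>R r"
      using uvw int_span_tripleE[OF d] by metis
    then have "cross3 u v \<bullet> w = of_int (a1 * (b2 * c3 - b3 * c2) - a2 * (b1 * c3 - b3 * c1) +
        a3 * (b1 * c2 - b2 * c1)) * (cross3 p q \<bullet> r)"
      by (simp only: triple_product_expand) simp
    then show ?thesis by blast
  qed
  obtain m where m: "cross3 a b \<bullet> c = of_int m * (cross3 x y \<bullet> z)"
    using int[of a x y z b c] dist' L int_span_base[of "{a, b, c}"] by auto
  obtain k where k: "cross3 x y \<bullet> z = of_int k * (cross3 a b \<bullet> c)"
    using int[of x a b c y z] dist L int_span_base[of "{x, y, z}"] by auto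
  have "cross3 a b \<bullet> c \<noteq> 0"
    using basis dist by (intro triple_product_nonzero) (auto simp: lattice_basis_def)
  moreover have "cross3 a b \<bullet> c = of_int (m * k) * (cross3 a b \<bullet> c)"
    by (subst m, subst k) simp
  ultimately have "real_of_int (m * k) = 1" by simp
  then have "m * k = 1" by linarith
  then have "\<bar>m\<bar> = 1" by (intro abs_zmult_eq_1[of m k]) simp
  then have "\<bar>cross3 a b \<bullet> c\<bar> = \<bar>cross3 x y \<bullet> z\<bar>"
    using m by (simp add: abs_mult flip: of_int_abs)
  then show ?thesis
    using measure_parallelepiped[OF dist'] by (simp add: covolume_def B_def[symmetric] Bxyz)
qed


section \<open>The ths graph\<close>

declare One_nat_def [simp del]

text \<open>Voltages on the quotient: after the choice of base vertices joined by the edges 1, 5, 6,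
  the lifts of the other edges are described by three lattice vectors.\<close>

fun ths_src ths_tgt :: "nat \<Rightarrow> quad" where
  "ths_src j = (if j \<in> {1, 2, 5} then VA else if j = 6 then VB else VC)"
| "ths_tgt j = (if j \<in> {1, 2} then VB else if j = 5 then VC else VD)"

text \<open>The signs are those for which the oriented sums of edge vectors around the two double
  edges and around the cycle through \<open>A\<close>, \<open>B\<close>, \<open>D\<close>,
  \<open>C\<close> are \<open>a\<close>, \<open>b\<close> and \<open>c\<close>.\<close>

definition ths_vol :: "'a::real_vector \<Rightarrow> 'a \<Rightarrow> 'a \<Rightarrow> nat \<Rightarrow> 'a"
  where "ths_vol a b c j = (if j = 2 then - a else if j = 3 then - c else if j = 4 then - c - b else 0)"

lemma UNIV_quad: "(UNIV :: quad set) = {VA, VB, VC, VD}"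
  using quad.exhaust by blast

lemma atLeastAtMost_1_6: "{1..6} = {1, 2, 3, 4, 5, 6::nat}"
  by auto

locale ths_graph = lifted_graph N UNIV base "{1..6}" ths_src ths_tgt "ths_vol a b c"
  for N :: "('v, real^3) network" and base :: "quad \<Rightarrow> 'v" and a b c :: "real^3" +
  assumes basis: "lattice_basis (periods N) {a, b, c}" and basis_distinct: "distinct [a, b, c]"
begin

lemma evecs:
  "evec 1 - evec 2 = a" "evec 3 - evec 4 = b" "evec 1 + evec 6 - evec 3 - evec 5 = c"
  by (simp_all add: evec_def ths_vol_def algebra_simps)

lemma periods_eq: "periods N = int_span {a, b, c}"
  using basis by (simp add: lattice_basis_def)

lemma darts_eq:
  "darts VA = {(1, True), (2, True), (5, True)}"
  "darts VB = {(1, False), (2, False), (6, True)}"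
  "darts VC = {(3, True), (4, True), (5, False)}"
  "darts VD = {(3, False), (4, False), (6, False)}"
  unfolding darts_def unfolding atLeastAtMost_1_6 by auto

lemma length_eq: "total_length N = norm (evec 1) + norm (evec 2) + norm (evec 3) + norm (evec 4) +
    norm (evec 5) + norm (evec 6)"
  unfolding total_length_eq atLeastAtMost_1_6 by simp

lemma volume_eq: "spanned_volume N = \<bar>cross3 a b \<bullet> c\<bar>"
  using covolume_triple[OF basis basis_distinct] by (simp add: spanned_volume_def)

lemma volume_pos: "spanned_volume N > 0"
  using triple_product_nonzero[OF _ basis_distinct] basis
  by (simp add: volume_eq lattice_basis_def)

lemma quotient_iso_D:
  "multigraph_iso (\<lambda>i. vertex_orbit N (base i)) (\<lambda>j. edge_orbit N (lift 0 j)) D1_square_D2 (quotient_graph N)"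
proof -
  have "{ths_src j, ths_tgt j} = mends D1_square_D2 j" if "j \<in> {1..6}" for j
    using that by (auto simp: D1_square_D2_def)
  then show ?thesis
    using quotient_iso by (auto simp: multigraph_iso_def D1_square_D2_def)
qed

end

section \<open>From a quotient graph to voltages\<close>

lemma vertex_orbit_self:
  assumes "periodic_placed_graph N" "v \<in> vertices N"
  shows "v \<in> vertex_orbit N v"
proof -
  have "0 \<in> periods N" "v = shift N 0 v"
    using assms add_subgroup_zero[OF add_subgroup_full_lattice]
    by (auto simp: periodic_placed_graph_def)
  then show ?thesis unfolding vertex_orbit_def by (rule_tac image_eqI)
qed

lemma vertex_orbit_shift:
  assumes N: "periodic_placed_graph N" and v: "v \<in> vertices N" and w: "w \<in> vertex_orbit N v"
  shows "vertex_orbit N w = vertex_orbit N v"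
proof -
  have sub: "add_subgroup (periods N)"
    using N add_subgroup_full_lattice by (auto simp: periodic_placed_graph_def)
  obtain a where a: "a \<in> periods N" and w: "w = shift N a v" using w by (auto simp: vertex_orbit_def)
  have add: "shift N b (shift N a v) = shift N (b + a) v" if "b \<in> periods N" for b
    using N a v that by (simp add: periodic_placed_graph_def)
  have "(\<lambda>b. b + a) ` periods N = periods N" by (rule add_subgroup_translate[OF sub a])
  then have "vertex_orbit N v = (\<lambda>b. shift N b v) ` (\<lambda>b. b + a) ` periods N"
    by (simp add: vertex_orbit_def)
  then show ?thesis by (simp add: vertex_orbit_def w image_image add)
qed

lemma edge_orbit_shift:
  assumes N: "periodic_placed_graph N" and e: "e \<in> edges N" and u: "u \<in> edge_orbit N e"
  shows "edge_orbit N u = edge_orbit N e"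
proof -
  have sub: "add_subgroup (periods N)"
    using N add_subgroup_full_lattice by (auto simp: periodic_placed_graph_def)
  have ev: "e \<subseteq> vertices N" using N e by (auto simp: periodic_placed_graph_def)
  obtain a where a: "a \<in> periods N" and u: "u = shift N a ` e" using u by (auto simp: edge_orbit_def)
  have add: "shift N b ` shift N a ` e = shift N (b + a) ` e" if "b \<in> periods N" for b
  proof -
    have "shift N b (shift N a v) = shift N (b + a) v" if "v \<in> vertices N" for v
      using N a \<open>b \<in> periods N\<close> that by (simp add: periodic_placed_graph_def)
    then show ?thesis unfolding image_image using ev by (intro image_cong) auto
  qed
  have "(\<lambda>b. b + a) ` periods N = periods N" by (rule add_subgroup_translate[OF sub a])
  then have "edge_orbit N e = (\<lambda>b. shift N b ` e) ` (\<lambda>b. b + a) ` periods N"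
    by (simp add: edge_orbit_def)
  also have "\<dots> = (\<lambda>b. shift N (b + a) ` e) ` periods N" by (rule image_image)
  also have "\<dots> = (\<lambda>b. shift N b ` u) ` periods N"
    by (rule image_cong[OF refl]) (simp only: add u)
  finally show ?thesis by (simp add: edge_orbit_def)
qed

text \<open>Some representative of the edge joins the two orbits, and a translation moves its end
  over \<open>U\<close> to the prescribed vertex \<open>u\<close>.\<close>

lemma lift_quotient_edge:
  assumes N: "periodic_placed_graph N" and E: "E \<in> medges (quotient_graph N)"
    and ends: "mends (quotient_graph N) E = {U, W}" and u: "u \<in> U" "U \<noteq> W"
  obtains w where "w \<in> W" "{u, w} \<in> E"
proof -
  obtain e where e: "e \<in> edges N" and Ee: "E = edge_orbit N e"
    using E by (auto simp: quotient_graph_def)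
  have "card e = 2" and ev: "e \<subseteq> vertices N" using N e by (auto simp: periodic_placed_graph_def)
  then obtain x y where xy: "e = {x, y}" by (auto simp: card_2_iff)
  have v: "x \<in> vertices N" "y \<in> vertices N" using ev xy by auto
  have "e \<in> E"
  proof -
    have "0 \<in> periods N"
      using N add_subgroup_zero[OF add_subgroup_full_lattice] by (auto simp: periodic_placed_graph_def)
    moreover have "shift N 0 ` e = e" using N v by (simp add: xy periodic_placed_graph_def)
    ultimately show ?thesis by (force simp: Ee edge_orbit_def)
  qed
  then have "vertex_orbit N x \<in> {U, W}" "vertex_orbit N y \<in> {U, W}"
    using ends xy by (auto simp: quotient_graph_def)
  moreover have "{U, W} \<subseteq> {vertex_orbit N x, vertex_orbit N y}"
  proof -
    have "vertex_orbit N z \<in> {vertex_orbit N x, vertex_orbit N y}" if z: "z \<in> \<Union>E" for z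
    proof -
      obtain a where "a \<in> periods N" "z = shift N a x \<or> z = shift N a y"
        using z by (auto simp: Ee edge_orbit_def xy)
      then have "z \<in> vertex_orbit N x \<or> z \<in> vertex_orbit N y" by (auto simp: vertex_orbit_def)
      then show ?thesis using vertex_orbit_shift[OF N] v by blast
    qed
    then have "vertex_orbit N ` \<Union>E \<subseteq> {vertex_orbit N x, vertex_orbit N y}" by blast
    then show ?thesis using ends by (simp add: quotient_graph_def)
  qed
  ultimately consider "vertex_orbit N x = U" "vertex_orbit N y = W"
    | "vertex_orbit N y = U" "vertex_orbit N x = W" using \<open>U \<noteq> W\<close> by auto
  then obtain p q where pq: "e = {p, q}" "vertex_orbit N p = U" "vertex_orbit N q = W"
    using xy by (metis insert_commute)
  then obtain a where a: "a \<in> periods N" "u = shift N a p" using u by (auto simp: vertex_orbit_def)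
  then have "{u, shift N a q} \<in> E" "shift N a q \<in> W"
    using pq by (auto simp: Ee edge_orbit_def vertex_orbit_def)
  then show ?thesis using that by blast
qed

text \<open>The edges 1, 5, 6 form a spanning tree of the quotient. Lifting it from one vertex over
  \<open>A\<close> gives base vertices for which the tree has voltage zero. The voltages of the
  edges 2, 3, 4 are then solved for \<open>a\<close>, \<open>b\<close>, \<open>c\<close>; by
  connectedness these generate the lattice, and three generators of a lattice of rank three are a
  basis.\<close>

lemma ths_graph_exists:
  fixes N :: "('v, real^3) network"
  assumes N: "periodic_placed_graph N" and iso: "multigraph_iso f g D1_square_D2 (quotient_graph N)"
  obtains base a b c where "ths_graph N base a b c" "\<And>q. f q = vertex_orbit N (base q)"
    "\<And>j. j \<in> {1..6} \<Longrightarrow>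
      g j = edge_orbit N (lifted_graph.lift N base ths_src ths_tgt (ths_vol a b c) 0 j)"
proof -
  have f: "bij_betw f UNIV (vertex_orbit N ` vertices N)" and g: "bij_betw g {1..6} (edge_orbit N ` edges N)"
    using iso by (auto simp: multigraph_iso_def D1_square_D2_def quotient_graph_def)
  have lat: "full_lattice (periods N)" using N by (simp add: periodic_placed_graph_def)
  have sub: "add_subgroup (periods N)" by (rule add_subgroup_full_lattice[OF lat])
  have ends: "mends (quotient_graph N) (g j) = {f (ths_src j), f (ths_tgt j)}" if "j \<in> {1..6}" for j
  proof -
    have "mends (quotient_graph N) (g j) = f ` mends D1_square_D2 j"
      using iso that by (simp add: multigraph_iso_def D1_square_D2_def)
    also have "mends D1_square_D2 j = {ths_src j, ths_tgt j}"
      using that by (auto simp: D1_square_D2_def)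
    finally show ?thesis by simp
  qed
  have step: "\<exists>w. w \<in> f (ths_tgt j) \<and> {u, w} \<in> g j" if j: "j \<in> {1..6}" and u: "u \<in> f (ths_src j)" for j u
  proof -
    have "ths_src j \<noteq> ths_tgt j" by auto
    then have "f (ths_src j) \<noteq> f (ths_tgt j)" using f by (auto simp: bij_betw_def inj_on_def)
    moreover have "g j \<in> medges (quotient_graph N)"
    proof -
      have "g j \<in> g ` {1..6}" using j by blast
      then show ?thesis using g by (simp add: quotient_graph_def bij_betw_def)
    qed
    ultimately show ?thesis
      using lift_quotient_edge[OF N _ ends[OF j] u] by blast
  qed
  have orb: "\<exists>v\<in>vertices N. f q = vertex_orbit N v" for q
  proof -
    have "f q \<in> range f" by blast
    then have "f q \<in> vertex_orbit N ` vertices N" using f by (simp only: bij_betw_def)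
    then show ?thesis by blast
  qed
  have vert: "f q \<subseteq> vertices N" for q
    using orb[of q] N by (auto simp: vertex_orbit_def periodic_placed_graph_def)
  have orb': "f q = vertex_orbit N v" if "v \<in> f q" for q v
    using orb[of q] vertex_orbit_shift[OF N] that by metis
  obtain vA where vA: "vA \<in> f VA" using orb[of VA] vertex_orbit_self[OF N] by auto
  obtain vB where vB: "vB \<in> f VB" "{vA, vB} \<in> g 1" using step[of 1 vA] vA by auto
  obtain vC where vC: "vC \<in> f VC" "{vA, vC} \<in> g 5" using step[of 5 vA] vA by auto
  obtain vD where vD: "vD \<in> f VD" "{vB, vD} \<in> g 6" using step[of 6 vB] vB by auto
  define base where "base q = (case q of VA \<Rightarrow> vA | VB \<Rightarrow> vB | VC \<Rightarrow> vC | VD \<Rightarrow> vD)" for q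
  have base: "base q \<in> f q" for q using vA vB vC vD by (cases q) (auto simp: base_def)
  have f_base: "f q = vertex_orbit N (base q)" for q using orb'[OF base] .
  have base_vert: "base q \<in> vertices N" for q using base vert by blast
  have zero: "shift N 0 (base q) = base q" for q
    using N base_vert by (simp add: periodic_placed_graph_def)
  have "\<exists>m\<in>periods N. {base (ths_src j), shift N m (base (ths_tgt j))} \<in> g j" if j: "j \<in> {1..6}" for j
  proof -
    obtain w where "w \<in> f (ths_tgt j)" "{base (ths_src j), w} \<in> g j"
      using step[OF j base] by blast
    then show ?thesis by (auto simp: f_base vertex_orbit_def)
  qed
  then obtain m where m: "\<And>j. j \<in> {1..6} \<Longrightarrow> m j \<in> periods N"
    "\<And>j. j \<in> {1..6} \<Longrightarrow> {base (ths_src j), shift N (m j) (base (ths_tgt j))} \<in> g j"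
    by metis
  define a b c where "a = - m 2" and "b = m 3 - m 4" and "c = - m 3"
  let ?vol = "ths_vol a b c"
  have abc: "a \<in> periods N" "b \<in> periods N" "c \<in> periods N"
    using m(1) by (auto simp: a_def b_def c_def intro!: add_subgroup_minus[OF sub] add_subgroup_diff[OF sub])
  have vol: "?vol j \<in> periods N" for j
    using abc by (auto simp: ths_vol_def intro!: add_subgroup_minus[OF sub] add_subgroup_diff[OF sub]
        add_subgroup_zero[OF sub])
  have lift: "{base (ths_src j), shift N (?vol j) (base (ths_tgt j))} \<in> g j" if j: "j \<in> {1..6}" for j
  proof -
    have "j \<in> {1, 5, 6} \<or> j \<in> {2, 3, 4}" using j unfolding atLeastAtMost_1_6 by blast
    moreover have "?vol j = m j" if "j \<in> {2, 3, 4}"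
      using that by (auto simp: ths_vol_def a_def b_def c_def)
    ultimately consider "j = 1" | "j = 5" | "j = 6" | "?vol j = m j" by blast
    then show ?thesis
      using m(2)[OF j] vB(2) vC(2) vD(2) zero[of VB] zero[of VC] zero[of VD]
      by cases (simp_all add: ths_vol_def base_def)
  qed
  have shift_vol: "shift N u (shift N v (base q)) = shift N (u + v) (base q)"
    if "u \<in> periods N" "v \<in> periods N" for u v q
    using N base_vert that by (simp add: periodic_placed_graph_def)
  have E: "g j = {{shift N u (base (ths_src j)), shift N (u + ?vol j) (base (ths_tgt j))} | u. u \<in> periods N}"
    if j: "j \<in> {1..6}" for j
  proof -
    let ?e = "{base (ths_src j), shift N (?vol j) (base (ths_tgt j))}"
    obtain e where e: "e \<in> edges N" "g j = edge_orbit N e"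
      using bij_betwE[OF g] j by blast
    then have "g j = edge_orbit N ?e" using edge_orbit_shift[OF N e(1)] lift[OF j] by simp
    then show ?thesis by (auto simp: edge_orbit_def shift_vol vol)
  qed
  have lifted: "lifted_graph N UNIV base {1..6} ths_src ths_tgt ?vol"
  proof
    show "finite (UNIV :: quad set)" by (simp add: UNIV_quad)
    have "vertices N = \<Union>(range f)"
    proof (intro equalityI subsetI)
      fix v assume "v \<in> vertices N"
      then have "v \<in> vertex_orbit N v" "vertex_orbit N v \<in> range f"
        using vertex_orbit_self[OF N] f by (auto simp: bij_betw_def)
      then show "v \<in> \<Union>(range f)" by blast
    qed (use vert in blast)
    then show "vertices N = {shift N u (base i) | u i. u \<in> periods N \<and> i \<in> UNIV}"
      by (auto simp: f_base vertex_orbit_def)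
    show "edges N = {{shift N u (base (ths_src j)), shift N (u + ?vol j) (base (ths_tgt j))} | u j.
        u \<in> periods N \<and> j \<in> {1..6}}"
    proof -
      have "edges N = \<Union>(g ` {1..6})"
      proof (intro equalityI subsetI)
        fix e assume e: "e \<in> edges N"
        have "e \<subseteq> vertices N" using N e by (auto simp: periodic_placed_graph_def)
        then have "shift N 0 v = v" if "v \<in> e" for v
          using that N by (auto simp: periodic_placed_graph_def)
        then have "e = shift N 0 ` e" by auto
        then have "e \<in> edge_orbit N e"
          unfolding edge_orbit_def using add_subgroup_zero[OF sub] by (rule image_eqI)
        then show "e \<in> \<Union>(g ` {1..6})" using g e by (auto simp: bij_betw_def)
      next
        fix e assume "e \<in> \<Union>(g ` {1..6})"
        then obtain e' where "e' \<in> edges N" "e \<in> edge_orbit N e'"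
          using bij_betwE[OF g] by blast
        then show "e \<in> edges N" using N by (auto simp: edge_orbit_def periodic_placed_graph_def)
      qed
      also have "\<dots> = {{shift N u (base (ths_src j)), shift N (u + ?vol j) (base (ths_tgt j))} | u j.
        u \<in> periods N \<and> j \<in> {1..6}}" using E by blast
      finally show ?thesis .
    qed
    show pos: "pos N (shift N u (base i)) = pos N (base i) + u" if "u \<in> periods N" for u i
      using N base_vert that by (simp add: periodic_placed_graph_def)
    show "u = v \<and> i = k" if "u \<in> periods N" "v \<in> periods N" "shift N u (base i) = shift N v (base k)"
      for u v i k
    proof -
      have "shift N u (base i) \<in> f i" "shift N v (base k) \<in> f k"
        unfolding f_base vertex_orbit_def using that(1,2) by blast+
      from this[THEN orb'] have "f i = f k" using that(3) by simp
      then have "i = k" using f by (simp add: bij_betw_def inj_eq)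
      moreover have "pos N (base i) + u = pos N (base k) + v"
        unfolding pos[OF that(1), symmetric] pos[OF that(2), symmetric] that(3) by (rule refl)
      ultimately show ?thesis by simp
    qed
    show "j = k" if "j \<in> {1..6}" "k \<in> {1..6}" "ths_src j = ths_src k" "ths_tgt j = ths_tgt k"
      "?vol j = ?vol k" for j k
    proof -
      have "g j = g k" using that E by simp
      then show ?thesis using g that by (auto simp: bij_betw_def inj_on_def)
    qed
    show "ths_tgt j \<noteq> ths_src k" if "j \<in> {1..6}" "k \<in> {1..6}" "ths_src j = ths_tgt k" for j k
      using that by (auto split: if_splits)
  qed (use lat vol zero shift_vol in auto)
  then interpret L: lifted_graph N UNIV base "{1..6}" ths_src ths_tgt ?vol .
  have "?vol ` {1..6} \<subseteq> int_span {a, b, c}"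
  proof -
    have "a \<in> int_span {a, b, c}" "b \<in> int_span {a, b, c}" "c \<in> int_span {a, b, c}"
      by (auto intro: int_span_base)
    then show ?thesis
      using add_subgroup_int_span[of "{a, b, c}"]
      by (auto simp: ths_vol_def intro!: add_subgroup_minus add_subgroup_diff add_subgroup_zero)
  qed
  then have "periods N \<subseteq> int_span {a, b, c}"
    using L.placed_imp_generating[OF N] add_subgroup_int_span unfolding L.generating_def by blast
  moreover have "int_span {a, b, c} \<subseteq> periods N"
    using abc by (intro int_span_least sub) auto
  ultimately have "lattice_basis (periods N) {a, b, c} \<and> distinct [a, b, c]"
    using lat by (intro lattice_basis_triple) auto
  then have "ths_graph N base a b c"
    by (intro ths_graph.intro ths_graph_axioms.intro lifted) auto
  moreover have "g j = edge_orbit N (L.lift 0 j)" if "j \<in> {1..6}" for j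
    using that E add_subgroup_zero[OF sub] by (simp add: L.edge_orbit_lift) (simp add: L.lift_def)
  ultimately show ?thesis using that f_base by blast
qed

section \<open>The inequality and its equality case\<close>

lemma cauchy_unit:
  fixes d u :: "'a::real_inner"
  assumes "norm u = 1"
  shows "d \<bullet> u \<le> norm d" and "d \<bullet> u = norm d \<Longrightarrow> d = norm d *\<^sub>R u"
  using norm_cauchy_schwarz[of d u] norm_cauchy_schwarz_eq[of d u] assms by simp_all

text \<open>The components are \<open>sqrt 3 / 2\<close> and \<open>1 / 2\<close> along orthogonal
  unit vectors, so the line of this vector makes 60 degrees with that of \<open>n\<close>. The signs
  \<open>k\<close> and \<open>h\<close> give the directions of the four edges on the double edges of
  the quotient.\<close>

lemma unit_combination:
  fixes w n :: "'a::real_inner"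
  assumes "norm n = 1" "w \<bullet> n = 0" "w \<noteq> 0" "k\<^sup>2 = 1" "h\<^sup>2 = 1"
  shows "norm ((k * sqrt 3 / (2 * norm w)) *\<^sub>R w + (h / 2) *\<^sub>R n) = 1"
proof -
  let ?u = "(k * sqrt 3 / (2 * norm w)) *\<^sub>R w" and ?v = "(h / 2) *\<^sub>R n"
  have "orthogonal ?u ?v" using assms(2) by (simp add: orthogonal_def)
  then have "(norm (?u + ?v))\<^sup>2 = (norm ?u)\<^sup>2 + (norm ?v)\<^sup>2" by (rule norm_add_Pythagorean)
  also have "(norm ?u)\<^sup>2 = 3 / 4"
    using assms by (simp add: power_mult_distrib power_divide)
  also have "(norm ?v)\<^sup>2 = 1 / 4"
    using assms by (simp add: power_mult_distrib power_divide)
  finally have "(norm (?u + ?v))\<^sup>2 = 1" by simp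
  then show ?thesis by (smt (verit) norm_ge_zero power2_eq_1_iff)
qed

text \<open>The defect is written as a sum of terms that are visibly nonnegative, so that
  \<open>B\<close> and \<open>D\<close> alone reveal the equality case.\<close>

lemma amgm3:
  fixes p q r :: real
  assumes "p > 0" "q > 0" "r > 0"
  shows "27 * (p * q * r) \<le> (p + q + r)^3"
    and "27 * (p * q * r) = (p + q + r)^3 \<Longrightarrow> p = q \<and> q = r"
proof -
  define A B C D where "A = (p + q + r) * ((p - q)\<^sup>2 + (q - r)\<^sup>2 + (p - r)\<^sup>2) / 2"
    and "B = p * (q - r)\<^sup>2" and "C = q * (p - r)\<^sup>2" and "D = r * (p - q)\<^sup>2"
  have id: "(p + q + r)^3 - 27 * (p * q * r) = A + 3 * (B + C + D)"
    unfolding A_def B_def C_def D_def by (simp add: power2_eq_square power3_eq_cube field_simps)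
  have nonneg: "A \<ge> 0" "B \<ge> 0" "C \<ge> 0" "D \<ge> 0"
    using assms by (simp_all add: A_def B_def C_def D_def)
  then have "0 \<le> (p + q + r)^3 - 27 * (p * q * r)" unfolding id by simp
  then show "27 * (p * q * r) \<le> (p + q + r)^3" by simp
  assume "27 * (p * q * r) = (p + q + r)^3"
  then have "A + 3 * (B + C + D) = 0" using id by simp
  then have "B = 0" "D = 0" using nonneg by (simp_all add: add_nonneg_eq_0_iff)
  then show "p = q \<and> q = r" using assms by (simp add: B_def D_def)
qed

text \<open>Each edge vector is tested against the direction it has in the optimal network; by
  orthogonality to \<open>n\<close> the six estimates add up to three terms whose product controls the volume.\<close>

lemma ths_length_volume:
  fixes d1 d2 d3 d4 d5 d6 :: "real^3"
  assumes a: "a = d1 - d2" and b: "b = d3 - d4" and c: "c = d1 + d6 - d3 - d5"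
    and V: "V = \<bar>cross3 a b \<bullet> c\<bar>" "V > 0"
    and L: "L = norm d1 + norm d2 + norm d3 + norm d4 + norm d5 + norm d6"
  shows "81 / 4 * V \<le> L^3"
    and "L^3 = 81 / 4 * V \<Longrightarrow> \<exists>l n. l > 0 \<and> norm n = 1 \<and> a \<bullet> n = 0 \<and> b \<bullet> n = 0 \<and> a \<bullet> b = 0 \<and>
      norm a = sqrt 3 * l \<and> norm b = sqrt 3 * l \<and> norm d5 + norm d6 = l / 2 \<and>
      d1 = (1/2) *\<^sub>R a + (l/2) *\<^sub>R n \<and> d3 = (1/2) *\<^sub>R b - (l/2) *\<^sub>R n \<and>
      d5 = - norm d5 *\<^sub>R n \<and> d6 = norm d6 *\<^sub>R n"
proof -
  let ?X = "cross3 a b"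
  have X0: "?X \<noteq> 0" using V by auto
  then have ab0: "a \<noteq> 0" "b \<noteq> 0" by auto
  \<comment> \<open>The sign orients the normal so that the height \<open>n \<bullet> c\<close> is
    positive.\<close>
  define n where "n = (sgn (?X \<bullet> c) / norm ?X) *\<^sub>R ?X"
  have n: "norm n = 1" using V X0 by (simp add: n_def abs_sgn_eq split: if_splits)
  have an: "a \<bullet> n = 0" and bn: "b \<bullet> n = 0" by (simp_all add: n_def dot_cross_self)
  have nc: "n \<bullet> c = \<bar>?X \<bullet> c\<bar> / norm ?X" by (simp add: n_def sgn_if abs_if)
  define p q r where "p = sqrt 3 / 2 * norm a" and "q = sqrt 3 / 2 * norm b" and "r = n \<bullet> c"
  have pqr: "p > 0" "q > 0" "r > 0"
    using ab0 X0 V by (simp_all add: p_def q_def r_def nc)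
  have Vr: "V = norm ?X * r" using X0 V by (simp add: r_def nc)
  have X: "(norm ?X)\<^sup>2 + (a \<bullet> b)\<^sup>2 = (norm a * norm b)\<^sup>2" by (rule norm_cross_dot)
  then have Xle: "norm ?X \<le> norm a * norm b"
    by (metis le_add_same_cancel1 mult_nonneg_nonneg norm_ge_zero power2_le_imp_le zero_le_power2)
  have pq: "norm a * norm b = 4 / 3 * (p * q)"
    by (simp add: p_def q_def)
  \<comment> \<open>The factor 4/3 relating \<open>norm a * norm b\<close> to \<open>p * q\<close>
    turns 81/4 into 27, the constant of the inequality of means for three terms.\<close>
  have Vle: "81 / 4 * V \<le> 27 * (p * q * r)"
    using mult_right_mono[OF Xle, of r] pqr(3) unfolding Vr pq by (simp add: mult.assoc)
  define u1 u2 u3 u4 where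
    "u1 = (1 * sqrt 3 / (2 * norm a)) *\<^sub>R a + (1 / 2) *\<^sub>R n" and
    "u2 = (-1 * sqrt 3 / (2 * norm a)) *\<^sub>R a + (1 / 2) *\<^sub>R n" and
    "u3 = (1 * sqrt 3 / (2 * norm b)) *\<^sub>R b + (-1 / 2) *\<^sub>R n" and
    "u4 = (-1 * sqrt 3 / (2 * norm b)) *\<^sub>R b + (-1 / 2) *\<^sub>R n"
  have u: "norm u1 = 1" "norm u2 = 1" "norm u3 = 1" "norm u4 = 1" "norm (- n) = 1"
    unfolding u1_def u2_def u3_def u4_def
    by (rule unit_combination[OF n an ab0(1)] unit_combination[OF n bn ab0(2)]; simp)+ (simp add: n)
  \<comment> \<open>Along \<open>a\<close> only the difference of \<open>d1\<close> and
    \<open>d2\<close> enters, and along \<open>n\<close> both have the same component because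
    \<open>a\<close> is orthogonal to \<open>n\<close>. The pair 3, 4 is treated alike with
    \<open>b\<close> and opposite normal direction.\<close>
  have d12: "d1 \<bullet> u1 + d2 \<bullet> u2 = p + d1 \<bullet> n"
  proof -
    have "d1 \<bullet> u1 + d2 \<bullet> u2 = (sqrt 3 / (2 * norm a)) * (d1 \<bullet> a - d2 \<bullet> a) + (1/2) * (d1 \<bullet> n + d2 \<bullet> n)"
      by (simp add: u1_def u2_def inner_add_right inner_diff_right right_diff_distrib)
    then have "d1 \<bullet> u1 + d2 \<bullet> u2 = (sqrt 3 / (2 * norm a)) * (a \<bullet> a) + (1/2) * (d1 \<bullet> n + d2 \<bullet> n)"
      by (simp only: inner_diff_left[symmetric] a[symmetric])
    moreover have "d2 \<bullet> n = d1 \<bullet> n" using an by (simp add: a inner_diff_left)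
    moreover have "(sqrt 3 / (2 * norm a)) * (a \<bullet> a) = p"
      using ab0 by (simp add: p_def dot_square_norm power2_eq_square)
    ultimately show ?thesis by simp
  qed
  have d34: "d3 \<bullet> u3 + d4 \<bullet> u4 = q - d3 \<bullet> n"
  proof -
    have "d3 \<bullet> u3 + d4 \<bullet> u4 = (sqrt 3 / (2 * norm b)) * (d3 \<bullet> b - d4 \<bullet> b) - (1/2) * (d3 \<bullet> n + d4 \<bullet> n)"
      by (simp add: u3_def u4_def inner_add_right inner_diff_right right_diff_distrib add_divide_distrib)
    then have "d3 \<bullet> u3 + d4 \<bullet> u4 = (sqrt 3 / (2 * norm b)) * (b \<bullet> b) - (1/2) * (d3 \<bullet> n + d4 \<bullet> n)"
      by (simp only: inner_diff_left[symmetric] b[symmetric])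
    moreover have "d4 \<bullet> n = d3 \<bullet> n" using bn by (simp add: b inner_diff_left)
    moreover have "(sqrt 3 / (2 * norm b)) * (b \<bullet> b) = q"
      using ab0 by (simp add: q_def dot_square_norm power2_eq_square)
    ultimately show ?thesis by simp
  qed
  have r_eq: "r = d1 \<bullet> n + d6 \<bullet> n - d3 \<bullet> n - d5 \<bullet> n"
    by (simp add: r_def c inner_add_right inner_diff_right inner_commute)
  have S: "p + q + r = d1 \<bullet> u1 + d2 \<bullet> u2 + d3 \<bullet> u3 + d4 \<bullet> u4 + d5 \<bullet> (- n) + d6 \<bullet> n"
    using d12 d34 r_eq by simp
  note cs = cauchy_unit(1)[OF u(1), of d1] cauchy_unit(1)[OF u(2), of d2] cauchy_unit(1)[OF u(3), of d3]
    cauchy_unit(1)[OF u(4), of d4] cauchy_unit(1)[OF u(5), of d5] cauchy_unit(1)[OF n, of d6]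
  have SL: "p + q + r \<le> L" using S cs L by linarith
  then have SL3: "(p + q + r)^3 \<le> L^3" using pqr by (intro power_mono) auto
  show "81 / 4 * V \<le> L^3"
    using Vle amgm3(1)[OF pqr] SL3 by linarith
  assume "L^3 = 81 / 4 * V"
  \<comment> \<open>Equality at the two ends of the chain of estimates makes every link an
    equality.\<close>
  then have eq: "81 / 4 * V = 27 * (p * q * r)" "27 * (p * q * r) = (p + q + r)^3" "(p + q + r)^3 = L^3"
    using Vle amgm3(1)[OF pqr] SL3 by linarith+
  have pq_eq: "p = q" "q = r" using amgm3(2)[OF pqr eq(2)] by auto
  have "p + q + r = L"
    using power_eq_imp_eq_base[OF eq(3)] pqr SL by auto
  \<comment> \<open>Six inequalities whose sum is tight are tight one by one, so each edge points
    along its test direction.\<close>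
  then have "d1 \<bullet> u1 = norm d1" "d2 \<bullet> u2 = norm d2" "d3 \<bullet> u3 = norm d3" "d4 \<bullet> u4 = norm d4"
    "d5 \<bullet> (- n) = norm d5" "d6 \<bullet> n = norm d6"
    using S cs L by linarith+
  then have d: "d1 = norm d1 *\<^sub>R u1" "d2 = norm d2 *\<^sub>R u2" "d3 = norm d3 *\<^sub>R u3" "d4 = norm d4 *\<^sub>R u4"
    "d5 = norm d5 *\<^sub>R (- n)" "d6 = norm d6 *\<^sub>R n"
    by (intro cauchy_unit(2) u n; simp)+
  have nn: "n \<bullet> n = 1" using n by (simp add: norm_eq_1)
  have un: "u1 \<bullet> n = 1/2" "u2 \<bullet> n = 1/2" "u3 \<bullet> n = -1/2" "u4 \<bullet> n = -1/2"
    using an bn nn by (simp_all add: u1_def u2_def u3_def u4_def inner_add_left inner_diff_left)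
  have inn: "d1 \<bullet> n = norm d1 / 2" "d2 \<bullet> n = norm d2 / 2" "d3 \<bullet> n = - norm d3 / 2"
    "d4 \<bullet> n = - norm d4 / 2"
    by (subst d, simp add: un)+
  \<comment> \<open>The two edges of a pair have equal normal components, and each of these is half
    the length of its edge up to the common sign.\<close>
  have n12: "norm d1 = norm d2" "norm d3 = norm d4"
    using an bn inn by (auto simp: a b inner_diff_left)
  have "a = (norm d1 * sqrt 3 / norm a) *\<^sub>R a"
  proof -
    have "a = norm d1 *\<^sub>R (u1 - u2)" using d(1,2) n12 a by (metis scaleR_diff_right)
    also have "u1 - u2 = (sqrt 3 / norm a) *\<^sub>R a"
      by (simp add: u1_def u2_def vec_eq_iff field_simps)
    finally show ?thesis by simp
  qed
  then have "norm d1 * sqrt 3 / norm a = 1"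
    using ab0 by (metis scaleR_cancel_right scaleR_one)
  then have na: "norm a = sqrt 3 * norm d1" using ab0 by (simp add: field_simps)
  have "b = (norm d3 * sqrt 3 / norm b) *\<^sub>R b"
  proof -
    have "b = norm d3 *\<^sub>R (u3 - u4)" using d(3,4) n12 b by (metis scaleR_diff_right)
    also have "u3 - u4 = (sqrt 3 / norm b) *\<^sub>R b"
      by (simp add: u3_def u4_def vec_eq_iff field_simps)
    finally show ?thesis by simp
  qed
  then have "norm d3 * sqrt 3 / norm b = 1"
    using ab0 by (metis scaleR_cancel_right scaleR_one)
  then have nb: "norm b = sqrt 3 * norm d3" using ab0 by (simp add: field_simps)
  have l13: "norm d3 = norm d1"
    using pq_eq(1) na nb by (simp add: p_def q_def)
  define l where "l = norm d1"
  have l: "l > 0" using na ab0 by (auto simp: l_def)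
  have d1: "d1 = (1/2) *\<^sub>R a + (l/2) *\<^sub>R n"
  proof -
    have "d1 = l *\<^sub>R u1" using d(1) by (simp add: l_def)
    also have "l *\<^sub>R u1 = (l * (sqrt 3 / (2 * norm a))) *\<^sub>R a + (l/2) *\<^sub>R n"
      by (simp add: u1_def scaleR_add_right)
    also have "l * (sqrt 3 / (2 * norm a)) = 1/2" using l by (simp add: na l_def[symmetric])
    finally show ?thesis .
  qed
  have d3: "d3 = (1/2) *\<^sub>R b - (l/2) *\<^sub>R n"
  proof -
    have "d3 = l *\<^sub>R u3" using d(3) l13 by (simp add: l_def)
    also have "l *\<^sub>R u3 = (l * (sqrt 3 / (2 * norm b))) *\<^sub>R b - (l/2) *\<^sub>R n"
      by (simp add: u3_def scaleR_add_right scaleR_diff_right)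
    also have "l * (sqrt 3 / (2 * norm b)) = 1/2" using l by (simp add: nb l13 l_def[symmetric])
    finally show ?thesis .
  qed
  have "d5 \<bullet> n = - norm d5" "d6 \<bullet> n = norm d6"
    by (subst d(5), simp add: nn) (subst d(6), simp add: nn)
  then have "r = l / 2 + norm d6 + l / 2 + norm d5"
    using inn l13 by (simp add: r_eq l_def)
  moreover have "r = 3 / 2 * l"
  proof -
    have "r = sqrt 3 / 2 * (sqrt 3 * l)" using pq_eq by (simp only: p_def na l_def)
    also have "\<dots> = sqrt 3 * sqrt 3 / 2 * l" by simp
    finally show ?thesis by simp
  qed
  ultimately have x: "norm d5 + norm d6 = l / 2" by simp
  \<comment> \<open>A tight volume bound means that \<open>a\<close> and \<open>b\<close> span a
    parallelogram of area \<open>norm a * norm b\<close>, so by Lagrange's identity they are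
    orthogonal.\<close>
  have "norm a * norm b * r = 4 / 3 * (p * q * r)" unfolding pq by simp
  then have "norm ?X * r = norm a * norm b * r" using eq(1) unfolding Vr by linarith
  then have ab: "a \<bullet> b = 0" using X pqr by simp
  show "\<exists>l n. l > 0 \<and> norm n = 1 \<and> a \<bullet> n = 0 \<and> b \<bullet> n = 0 \<and> a \<bullet> b = 0 \<and>
      norm a = sqrt 3 * l \<and> norm b = sqrt 3 * l \<and> norm d5 + norm d6 = l / 2 \<and>
      d1 = (1/2) *\<^sub>R a + (l/2) *\<^sub>R n \<and> d3 = (1/2) *\<^sub>R b - (l/2) *\<^sub>R n \<and>
      d5 = - norm d5 *\<^sub>R n \<and> d6 = norm d6 *\<^sub>R n"
  proof (intro exI conjI)
    show "d5 = - norm d5 *\<^sub>R n" by (rule trans[OF d(5)]) simp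
    show "norm a = sqrt 3 * l" "norm b = sqrt 3 * l" using na nb l13 by (simp_all add: l_def)
  qed (rule l n an bn ab x d1 d3 d(6))+
qed


section \<open>Orthonormal frames\<close>

definition frame :: "real^3 \<Rightarrow> real^3 \<Rightarrow> real^3 \<Rightarrow> bool"
  where "frame u v w \<longleftrightarrow> norm u = 1 \<and> norm v = 1 \<and> norm w = 1 \<and> u \<bullet> v = 0 \<and> u \<bullet> w = 0 \<and> v \<bullet> w = 0"

text \<open>Parseval's identity: the matrix with these three rows is orthogonal.\<close>

lemma frame_inner:
  assumes "frame u v w"
  shows "x \<bullet> y = (u \<bullet> x) * (u \<bullet> y) + (v \<bullet> x) * (v \<bullet> y) + (w \<bullet> x) * (w \<bullet> y)"
proof -
  let ?Q = "vector [u, v, w] :: real^3^3"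
  have "orthogonal_matrix ?Q"
    using assms unfolding orthogonal_matrix_orthonormal_rows
    by (simp add: forall_3 row_def frame_def orthogonal_def inner_commute vec_lambda_eta)
  then have "orthogonal_transformation ((*v) ?Q)"
    by (simp add: orthogonal_transformation_matrix matrix_vector_mul_linear)
  then have "x \<bullet> y = (?Q *v x) \<bullet> (?Q *v y)" by (simp add: orthogonal_transformation_def)
  also have "\<dots> = (u \<bullet> x) * (u \<bullet> y) + (v \<bullet> x) * (v \<bullet> y) + (w \<bullet> x) * (w \<bullet> y)"
    by (simp add: inner_vec_def sum_3 matrix_vector_mult_def)
  finally show ?thesis .
qed

lemma frame_map:
  assumes uvw: "frame u v w" and uvw': "frame u' v' w'"
  obtains f where "orthogonal_transformation f" "f u = u'" "f v = v'" "f w = w'"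
proof -
  define f where "f x = (u \<bullet> x) *\<^sub>R u' + (v \<bullet> x) *\<^sub>R v' + (w \<bullet> x) *\<^sub>R w'" for x
  have lin: "linear f"
    by (auto simp: f_def linear_iff inner_add_right algebra_simps)
  have 1: "u' \<bullet> u' = 1" "v' \<bullet> v' = 1" "w' \<bullet> w' = 1" "u' \<bullet> v' = 0" "u' \<bullet> w' = 0" "v' \<bullet> w' = 0"
    "v' \<bullet> u' = 0" "w' \<bullet> u' = 0" "w' \<bullet> v' = 0"
    using uvw' by (auto simp: frame_def norm_eq_1 inner_commute)
  have 2: "u \<bullet> u = 1" "v \<bullet> v = 1" "w \<bullet> w = 1" "u \<bullet> v = 0" "u \<bullet> w = 0" "v \<bullet> w = 0"
    "v \<bullet> u = 0" "w \<bullet> u = 0" "w \<bullet> v = 0"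
    using uvw by (auto simp: frame_def norm_eq_1 inner_commute)
  have "f x \<bullet> f y = x \<bullet> y" for x y
    unfolding frame_inner[OF uvw, of x y]
    by (simp add: f_def inner_add_left inner_add_right 1)
  then have "orthogonal_transformation f"
    using lin by (simp add: orthogonal_transformation_def)
  moreover have "f u = u'" "f v = v'" "f w = w'"
    by (simp_all add: f_def 2)
  ultimately show ?thesis using that by blast
qed

text \<open>A normal of the first plane has only a coordinate along \<open>b\<close>, a normal of
  the second only one along \<open>a\<close>, so every term of their product in the frame
  vanishes.\<close>

lemma perpendicular_coordinate_planes:
  assumes "a \<noteq> 0" "b \<noteq> 0" "n \<noteq> 0" "a \<bullet> b = 0" "a \<bullet> n = 0" "b \<bullet> n = 0"
  shows "perpendicular_planes (span {a, n}) (span {b, n})"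
proof -
  have dim: "dim (span {p, n}) = 2" if "p \<noteq> 0" "p \<bullet> n = 0" for p
  proof -
    have "p \<noteq> n" using that assms(3) by auto
    moreover have "independent {p, n}"
      by (rule pairwise_orthogonal_independent)
        (use that assms(3) in \<open>auto simp: pairwise_def orthogonal_def inner_commute\<close>)
    ultimately show ?thesis by (simp add: dim_eq_card_independent)
  qed
  have fr: "frame (sgn a) (sgn b) (sgn n)"
    using assms by (simp add: frame_def norm_sgn) (simp add: sgn_div_norm)
  have "orthogonal m k" if m: "m \<in> orthogonal_comp (span {a, n})" and k: "k \<in> orthogonal_comp (span {b, n})" for m k
  proof -
    have "orthogonal a m" "orthogonal n m" "orthogonal b k" "orthogonal n k"
      using m k by (auto simp: orthogonal_comp_def span_base)
    then show ?thesis
      using frame_inner[OF fr, of m k] by (simp add: orthogonal_def sgn_div_norm)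
  qed
  then show ?thesis using dim assms by (simp add: perpendicular_planes_def)
qed


section \<open>Normal form of the minimizing networks\<close>

lemma sgn_inner_sgn: "sgn (w \<bullet> u) = sgn (w \<bullet> sgn u)"
  for u w :: "'a::real_inner"
proof (cases "u = 0")
  case False
  then have "w \<bullet> u = norm u * (w \<bullet> sgn u)" by (simp add: sgn_div_norm)
  then show ?thesis using False by (simp only: sgn_mult) simp
qed simp

text \<open>A linear functional that is positive, negative and zero on three vectors separates their
  directions. This is the test for immersion at all stars below.\<close>

lemma sgn_distinct3:
  fixes u1 u2 u3 w :: "'a::real_inner"
  assumes "w \<bullet> u1 > 0" "w \<bullet> u2 < 0" "w \<bullet> u3 = 0"
  shows "sgn u1 \<noteq> sgn u2 \<and> sgn u1 \<noteq> sgn u3 \<and> sgn u2 \<noteq> sgn u3"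
  using assms sgn_inner_sgn[of w u1] sgn_inner_sgn[of w u2] sgn_inner_sgn[of w u3]
  by (auto simp: sgn_if split: if_splits)

lemma (in lifted_graph) zero_vol_edge:
  assumes "j \<in> J" "vol j = 0" "d \<in> periods N"
  shows "(P d (src j), P d (tgt j)) \<in> adj_rel\<^sup>*" "(P d (tgt j), P d (src j)) \<in> adj_rel\<^sup>*"
  using adj_rel_lift[OF assms(3,1)] assms(2) by (auto simp: insert_commute)

lemma (in lifted_graph) dart_vec_simps [simp]:
  "dart_vec (j, True) = evec j" "dart_vec (j, False) = - evec j"
  by (simp_all add: dart_vec_def)

lemma (in lifted_graph) generating_triple:
  assumes "periods N = int_span {a, b, c}" "{- a, - c, - c - b} \<subseteq> vol ` J"
  shows "generating"
  unfolding generating_def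
proof (intro allI impI, elim conjE)
  fix G assume G: "add_subgroup G" "vol ` J \<subseteq> G"
  then have "- a \<in> G" "- c \<in> G" "- c - b \<in> G" using assms(2) by auto
  then have "a \<in> G" "c \<in> G" "b \<in> G"
    using add_subgroup_minus[OF G(1), of "- a"] add_subgroup_minus[OF G(1), of "- c"]
      add_subgroup_diff[OF G(1), of "- c" "- c - b"] by simp_all
  then show "periods N \<subseteq> G"
    unfolding assms(1) by (intro int_span_least G) auto
qed

lemma ths_vol_image: "{2, 3, 4} \<subseteq> J \<Longrightarrow> {- a, - c, - c - b} \<subseteq> ths_vol a b c ` J"
  by (force simp: ths_vol_def image_iff)

context ths_graph
begin

lemma placed: "periodic_placed_graph N"
proof (rule placed_graphI[of VA])
  show generating
    by (rule generating_triple[OF periods_eq]) (rule ths_vol_image, simp)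
  fix d i assume d: "d \<in> periods N"
  note e = zero_vol_edge[of 1, OF _ _ d] zero_vol_edge[of 5, OF _ _ d] zero_vol_edge[of 6, OF _ _ d]
  show "(P d i, P d VA) \<in> adj_rel\<^sup>*"
    using e by (cases i) (auto simp: ths_vol_def)
qed auto

end

lemma span_plane:
  fixes p n :: "'a::real_vector"
  assumes "t \<noteq> 0" "r \<noteq> 0"
    and 1: "d1 = r *\<^sub>R p + s *\<^sub>R n" and 2: "d2 = r' *\<^sub>R p + s' *\<^sub>R n"
  shows "span {d1, d2, t *\<^sub>R n} = span {p, n}"
proof -
  let ?S = "{d1, d2, t *\<^sub>R n}"
  have "(1 / t) *\<^sub>R t *\<^sub>R n \<in> span ?S" by (intro span_scale span_base) simp
  then have n: "n \<in> span ?S" using assms by simp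
  moreover have "d1 \<in> span ?S" by (intro span_base) simp
  ultimately have "(1 / r) *\<^sub>R (d1 - s *\<^sub>R n) \<in> span ?S"
    by (intro span_scale span_diff)
  then have "p \<in> span ?S" using assms by simp
  moreover have "d1 \<in> span {p, n}" "d2 \<in> span {p, n}" "t *\<^sub>R n \<in> span {p, n}"
    unfolding 1 2 by (intro span_add span_scale span_base; simp)+
  ultimately show ?thesis unfolding span_eq using n by blast
qed

text \<open>The optimal networks in normal form: \<open>l\<close> is the length of the edges 1 to 4,
  \<open>x\<close> that of edge 5, and edge 6 has the rest of \<open>l / 2\<close>. The vectors
  \<open>a\<close>, \<open>b\<close>, \<open>n\<close> are orthogonal and the two planes of edges
  share the axis \<open>n\<close>.\<close>

locale ths_form = ths_graph N base a b c
  for N :: "('v, real^3) network" and base :: "quad \<Rightarrow> 'v" and a b c :: "real^3" +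
  fixes l x :: real and n :: "real^3"
  assumes l: "l > 0" and x: "0 < x" "x < l / 2"
    and n: "norm n = 1" and an: "a \<bullet> n = 0" and bn: "b \<bullet> n = 0" and ab: "a \<bullet> b = 0"
    and norm_a: "norm a = sqrt 3 * l" and norm_b: "norm b = sqrt 3 * l"
    and evec1: "evec 1 = (1/2) *\<^sub>R a + (l/2) *\<^sub>R n"
    and evec3: "evec 3 = (1/2) *\<^sub>R b - (l/2) *\<^sub>R n"
    and evec5: "evec 5 = - x *\<^sub>R n"
    and evec6: "evec 6 = (l/2 - x) *\<^sub>R n"
begin

lemma evec2: "evec 2 = - (1/2) *\<^sub>R a + (l/2) *\<^sub>R n"
proof -
  have "evec 2 = evec 1 - a" using evecs(1) by (simp add: algebra_simps)
  also have "\<dots> = (1/2 - 1) *\<^sub>R a + (l/2) *\<^sub>R n" unfolding evec1 scaleR_diff_left by simp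
  finally show ?thesis by simp
qed

lemma evec4: "evec 4 = - (1/2) *\<^sub>R b - (l/2) *\<^sub>R n"
proof -
  have "evec 4 = evec 3 - b" using evecs(2) by (simp add: algebra_simps)
  also have "\<dots> = (1/2 - 1) *\<^sub>R b - (l/2) *\<^sub>R n" unfolding evec3 scaleR_diff_left by simp
  finally show ?thesis by simp
qed

lemmas evec_forms = evec1 evec2 evec3 evec4 evec5 evec6

text \<open>The contributions of \<open>x\<close> from the edges 5 and 6 cancel around the cycle;
  this is why all members of the family have the same lattice up to similarity.\<close>

lemma c_eq: "c = (1/2) *\<^sub>R a - (1/2) *\<^sub>R b + (3 * l / 2) *\<^sub>R n"
proof -
  have "c = evec 1 + evec 6 - evec 3 - evec 5" by (rule evecs(3)[symmetric])
  also have "\<dots> = (1/2) *\<^sub>R a - (1/2) *\<^sub>R b + (l/2 + (l/2 - x) + l/2 + x) *\<^sub>R n"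
    unfolding evec1 evec3 evec5 evec6 scaleR_add_left by simp
  also have "l/2 + (l/2 - x) + l/2 + x = 3 * l / 2" by simp
  finally show ?thesis .
qed

lemma inner_abn:
  "a \<bullet> a = 3 * l\<^sup>2" "b \<bullet> b = 3 * l\<^sup>2" "n \<bullet> n = 1" "n \<bullet> a = 0" "n \<bullet> b = 0" "b \<bullet> a = 0"
  using n an bn ab
  by (simp_all add: dot_square_norm norm_a norm_b power_mult_distrib inner_commute)

lemmas inner_all = inner_abn an bn ab

lemma norm_evec: "norm (evec 1) = l" "norm (evec 2) = l" "norm (evec 3) = l" "norm (evec 4) = l"
  "norm (evec 5) = x" "norm (evec 6) = l / 2 - x"
proof -
  have *: "norm v = l" if "v \<bullet> v = l\<^sup>2" for v :: "real^3"
    using that l by (simp add: norm_eq_sqrt_inner real_sqrt_unique)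
  show "norm (evec 1) = l" "norm (evec 2) = l" "norm (evec 3) = l" "norm (evec 4) = l"
    by (rule *; simp add: evec_forms inner_add_left inner_add_right inner_diff_left inner_diff_right inner_all
        power2_eq_square field_simps)+
  show "norm (evec 5) = x" "norm (evec 6) = l / 2 - x"
    using x by (simp_all add: evec_forms n)
qed

lemma evec_ne_0: "j \<in> {1..6} \<Longrightarrow> evec j \<noteq> 0"
  using norm_evec l x unfolding atLeastAtMost_1_6 by auto

lemma periodic: "periodic_network N"
proof (rule periodic_networkI[OF placed evec_ne_0])
  fix i :: quad
  have A: "a \<bullet> evec 1 > 0" "a \<bullet> evec 2 < 0" "a \<bullet> evec 5 = 0" "a \<bullet> evec 6 = 0"
    and B: "b \<bullet> evec 3 > 0" "b \<bullet> evec 4 < 0" "b \<bullet> evec 5 = 0" "b \<bullet> evec 6 = 0"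
    using l by (simp_all add: evec_forms inner_add_right inner_diff_right inner_all)
  show "inj_on (\<lambda>x. sgn (dart_vec x)) (darts i)"
  proof (cases i)
    case VA
    show ?thesis unfolding VA darts_eq
      using sgn_distinct3[of a "evec 1" "evec 2" "evec 5"] A by (auto simp: inj_on_def)
  next
    case VB
    show ?thesis unfolding VB darts_eq
      using sgn_distinct3[of a "- evec 2" "- evec 1" "evec 6"] A by (auto simp: inj_on_def)
  next
    case VC
    show ?thesis unfolding VC darts_eq
      using sgn_distinct3[of b "evec 3" "evec 4" "- evec 5"] B by (auto simp: inj_on_def)
  next
    case VD
    show ?thesis unfolding VD darts_eq
      using sgn_distinct3[of b "- evec 4" "- evec 3" "- evec 6"] B by (auto simp: inj_on_def)
  qed
qed

lemma sgn_evec: "j \<in> {1, 2, 3, 4} \<Longrightarrow> sgn (evec j) = (1 / l) *\<^sub>R evec j"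
  "sgn (evec 5) = - n" "sgn (evec 6) = n"
proof -
  show "sgn (evec j) = (1 / l) *\<^sub>R evec j" if "j \<in> {1, 2, 3, 4}"
  proof -
    have "norm (evec j) = l" using that by (elim insertE emptyE) (simp_all only: norm_evec)
    then show ?thesis by (simp only: sgn_div_norm divide_inverse mult_1_left)
  qed
  have "sgn (evec 5) = (1 / x) *\<^sub>R evec 5" "sgn (evec 6) = (1 / (l / 2 - x)) *\<^sub>R evec 6"
    by (simp_all only: sgn_div_norm norm_evec divide_inverse mult_1_left)
  then show "sgn (evec 5) = - n" "sgn (evec 6) = n"
    using x by (simp_all add: evec5 evec6)
qed

lemma steiner: "steiner_network N"
proof -
  have s: "sgn (evec 1) + sgn (evec 2) = n" "sgn (evec 3) + sgn (evec 4) = - n"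
  proof -
    have "sgn (evec 1) + sgn (evec 2) = (1 / l) *\<^sub>R (evec 1 + evec 2)"
      "sgn (evec 3) + sgn (evec 4) = (1 / l) *\<^sub>R (evec 3 + evec 4)"
      by (simp_all add: sgn_evec scaleR_add_right)
    moreover have "evec 1 + evec 2 = l *\<^sub>R n" "evec 3 + evec 4 = - l *\<^sub>R n"
      unfolding evec_forms by (simp_all add: vec_eq_iff field_simps)
    ultimately show "sgn (evec 1) + sgn (evec 2) = n" "sgn (evec 3) + sgn (evec 4) = - n"
      using l by simp_all
  qed
  have "(\<Sum>x\<in>darts i. sgn (dart_vec x)) = 0" for i
  proof -
    have "sgn (evec 2) = n - sgn (evec 1)" "sgn (evec 4) = - n - sgn (evec 3)"
      using s by (metis add_diff_cancel_left')+
    then show ?thesis by (cases i) (simp_all add: darts_eq sgn_minus sgn_evec(2,3))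
  qed
  moreover have "card (darts i) = 3" for i
    by (cases i) (simp_all add: darts_eq)
  ultimately show ?thesis using periodic by (simp add: steiner_iff)
qed

lemma length_form: "total_length N = 9 / 2 * l"
  by (simp add: length_eq norm_evec)

lemma volume_form: "spanned_volume N = 9 / 2 * l^3"
proof -
  let ?X = "cross3 a b"
  have "?X \<bullet> c = (3 * l / 2) * (?X \<bullet> n)"
    by (simp add: c_eq inner_add_right inner_diff_right dot_cross_self)
  moreover have "\<bar>?X \<bullet> n\<bar> = 3 * l\<^sup>2"
  proof -
    \<comment> \<open>\<open>n\<close> is orthogonal to \<open>a\<close> and \<open>b\<close>, hence
      parallel to their cross product, so its inner product with it has the full absolute
      value.\<close>
    have "cross3 n ?X = 0" by (simp add: Lagrange inner_all)
    then have "(n \<bullet> ?X)\<^sup>2 = (norm ?X)\<^sup>2" using norm_cross_dot[of n ?X] n by simp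
    also have "\<dots> = (3 * l\<^sup>2)\<^sup>2"
      using norm_cross_dot[of a b] by (simp add: ab norm_a norm_b power2_eq_square)
    finally have "\<bar>n \<bullet> ?X\<bar>\<^sup>2 = (3 * l\<^sup>2)\<^sup>2" by simp
    then have "\<bar>n \<bullet> ?X\<bar> = 3 * l\<^sup>2" by (rule power2_eq_imp_eq) simp_all
    then show ?thesis by (simp add: inner_commute)
  qed
  ultimately have "\<bar>?X \<bullet> c\<bar> = (3 * l / 2) * (3 * l\<^sup>2)"
    using l by (simp only: abs_mult)
  then show ?thesis by (simp add: volume_eq power2_eq_square power3_eq_cube)
qed

lemma ratio: "total_length N ^ 3 / spanned_volume N = 81 / 4"
  using l by (simp add: length_form volume_form power3_eq_cube)

lemma frame_abn: "frame ((1 / (sqrt 3 * l)) *\<^sub>R a) ((1 / (sqrt 3 * l)) *\<^sub>R b) n"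
  using l by (simp add: frame_def norm_a norm_b n inner_all)

lemma nonzero_abn: "a \<noteq> 0" "b \<noteq> 0" "n \<noteq> 0"
  using norm_a norm_b n l by auto

lemma planes:
  assumes d: "d \<in> periods N"
  shows "star_plane N (P d VA) = span {a, n}" "star_plane N (P d VC) = span {b, n}"
    "star_plane N (P d VB) = span {a, n}" "star_plane N (P d VD) = span {b, n}"
  using x span_plane[of "- x" "1/2" "evec 1" a "l/2" n "evec 2" "- (1/2)" "l/2"]
    span_plane[of "x" "1/2" "evec 3" b "- l/2" n "evec 4" "- (1/2)" "- l/2"]
    span_plane[of "l/2 - x" "- (1/2)" "- evec 1" a "- l/2" n "- evec 2" "1/2" "- l/2"]
    span_plane[of "- (l/2 - x)" "- (1/2)" "- evec 3" b "l/2" n "- evec 4" "1/2" "l/2"]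
  by (simp_all add: star_plane_P[OF d] darts_eq evec_forms scaleR_diff_left)

lemma minimizing: "minimizing_ths_with_parameter N (x / l)"
proof -
  have "perpendicular_planes (star_plane N u) (star_plane N v)"
    if uv: "u \<in> vertex_orbit N (base VA)" "v \<in> vertex_orbit N (base VC)" for u v
  proof -
    obtain d e where "d \<in> periods N" "u = P d VA" "e \<in> periods N" "v = P e VC"
      using uv by (auto simp: vertex_orbit_def)
    then show ?thesis
      using perpendicular_coordinate_planes[OF nonzero_abn ab an bn] by (simp add: planes)
  qed
  then show ?thesis
    unfolding minimizing_ths_with_parameter_def Let_def
    by (intro conjI[OF steiner] exI[of _ "\<lambda>i. vertex_orbit N (base i)"]
        exI[of _ "\<lambda>j. edge_orbit N (lift 0 j)"] conjI[OF quotient_iso_D])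
      (simp add: orbit_length_lift norm_evec)
qed

end

lemma (in ths_graph) equality_ths_form:
  assumes "periodic_network N" "total_length N ^ 3 = 81 / 4 * spanned_volume N"
  obtains l x n where "ths_form N base a b c l x n"
proof -
  obtain l n where *: "l > 0" "norm n = 1" "a \<bullet> n = 0" "b \<bullet> n = 0" "a \<bullet> b = 0"
      "norm a = sqrt 3 * l" "norm b = sqrt 3 * l" "norm (evec 5) + norm (evec 6) = l / 2"
      "evec 1 = (1/2) *\<^sub>R a + (l/2) *\<^sub>R n" "evec 3 = (1/2) *\<^sub>R b - (l/2) *\<^sub>R n"
      "evec 5 = - norm (evec 5) *\<^sub>R n" "evec 6 = norm (evec 6) *\<^sub>R n"
    using ths_length_volume(2)[OF evecs(1,2,3)[symmetric] volume_eq volume_pos length_eq assms(2)] by metis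
  have pos: "norm (evec 5) > 0" "norm (evec 6) > 0"
    using evec_nonzero[OF assms(1)] by auto
  have x6: "norm (evec 6) = l / 2 - norm (evec 5)" using *(8) by simp
  have lt: "norm (evec 5) < l / 2" using pos x6 by linarith
  have e6: "evec 6 = (l / 2 - norm (evec 5)) *\<^sub>R n" using *(12) by (simp only: x6)
  have "ths_form N base a b c l (norm (evec 5)) n"
    by unfold_locales (rule * pos lt e6)+
  then show ?thesis by (rule that)
qed

text \<open>Balance puts the edges 5 and 6 on one axis \<open>n\<close> and makes the sums of the
  two pairs equal to \<open>l *\<^sub>R n\<close> and its negative. Perpendicularity of the planes
  then passes to the differences of the pairs, since crossing these with \<open>n\<close> gives
  normals of the planes.\<close>

lemma steiner_frame:
  fixes d1 d2 d3 d4 d5 d6 :: "real^3"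
  assumes len: "norm d1 = l" "norm d2 = l" "norm d3 = l" "norm d4 = l" "l > 0"
    and nz: "d5 \<noteq> 0"
    and A: "sgn d1 + sgn d2 + sgn d5 = 0" and B: "sgn d1 + sgn d2 = sgn d6"
    and C: "sgn d3 + sgn d4 = sgn d5"
    and perp: "perpendicular_planes (span {d1, d2, d5}) (span {d3, d4, - d5})"
  shows "\<exists>n. norm n = 1 \<and> (d1 - d2) \<bullet> n = 0 \<and> (d3 - d4) \<bullet> n = 0 \<and> (d1 - d2) \<bullet> (d3 - d4) = 0 \<and>
    norm (d1 - d2) = sqrt 3 * l \<and> norm (d3 - d4) = sqrt 3 * l \<and>
    d1 = (1/2) *\<^sub>R (d1 - d2) + (l/2) *\<^sub>R n \<and> d3 = (1/2) *\<^sub>R (d3 - d4) - (l/2) *\<^sub>R n \<and>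
    d5 = - norm d5 *\<^sub>R n \<and> d6 = norm d6 *\<^sub>R n"
proof -
  define n where "n = - sgn d5"
  have n: "norm n = 1" using nz by (simp add: n_def norm_sgn)
  have ns: "norm d *\<^sub>R sgn d = d" for d :: "real^3" by (cases "d = 0") (simp_all add: sgn_div_norm)
  have sum1: "d1 + d2 = l *\<^sub>R n"
  proof -
    have "d1 + d2 = l *\<^sub>R (sgn d1 + sgn d2)" using ns[of d1] ns[of d2] len by (simp add: scaleR_add_right)
    also have "sgn d1 + sgn d2 = n" using A by (simp add: n_def eq_neg_iff_add_eq_0)
    finally show ?thesis .
  qed
  have sum3: "d3 + d4 = - l *\<^sub>R n"
  proof -
    have "d3 + d4 = l *\<^sub>R (sgn d3 + sgn d4)" using ns[of d3] ns[of d4] len by (simp add: scaleR_add_right)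
    then show ?thesis using C by (simp add: n_def)
  qed
  \<comment> \<open>If \<open>d\<close>, \<open>e\<close> and their sum have length
    \<open>l\<close>, they bound two equilateral triangles; the other diagonal of this rhombus is
    orthogonal to the sum and has length \<open>sqrt 3 * l\<close>. The sign of \<open>r\<close>
    covers both pairs.\<close>
  have geom: "(d - e) \<bullet> n = 0 \<and> norm (d - e) = sqrt 3 * l"
    if "d + e = r *\<^sub>R n" "r\<^sup>2 = l\<^sup>2" "norm d = l" "norm e = l" for d e :: "real^3" and r
  proof -
    have dd: "d \<bullet> d = l\<^sup>2" "e \<bullet> e = l\<^sup>2" using that by (simp_all add: dot_square_norm)
    have "(d - e) \<bullet> (d + e) = 0" using dd by (simp add: inner_diff_left inner_add_right inner_diff_right inner_commute)
    moreover have "r \<noteq> 0" using that(2) len(5) by auto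
    ultimately have 1: "(d - e) \<bullet> n = 0" using that(1) by simp
    have "(d + e) \<bullet> (d + e) = l\<^sup>2" using that(1,2) n by (simp add: norm_eq_1 power2_eq_square)
    then have "(d - e) \<bullet> (d - e) = 3 * l\<^sup>2"
      using dd by (simp add: inner_diff_left inner_add_right inner_diff_right inner_add_left inner_commute)
    then have "norm (d - e) = sqrt (3 * l\<^sup>2)" by (simp add: norm_eq_sqrt_inner)
    then show ?thesis using 1 len(5) by (simp add: real_sqrt_mult)
  qed
  have g1: "(d1 - d2) \<bullet> n = 0" "norm (d1 - d2) = sqrt 3 * l"
    using geom[OF sum1] len by auto
  have g3: "(d3 - d4) \<bullet> n = 0" "norm (d3 - d4) = sqrt 3 * l"
    using geom[OF sum3] len by auto
  have d5: "d5 = - norm d5 *\<^sub>R n" using ns[of d5] by (simp add: n_def)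
  have d6: "d6 = norm d6 *\<^sub>R n"
  proof -
    have "sgn d6 = n" using A B by (simp add: n_def eq_neg_iff_add_eq_0)
    then show ?thesis using ns[of d6] by simp
  qed
  have d1: "d1 = (1/2) *\<^sub>R (d1 - d2) + (l/2) *\<^sub>R n"
  proof -
    have "(1/2) *\<^sub>R (d1 - d2) + (1/2) *\<^sub>R (d1 + d2) = d1" by (simp add: algebra_simps flip: scaleR_add_left)
    then show ?thesis using sum1 by simp
  qed
  have d3: "d3 = (1/2) *\<^sub>R (d3 - d4) - (l/2) *\<^sub>R n"
  proof -
    have "(1/2) *\<^sub>R (d3 - d4) + (1/2) *\<^sub>R (d3 + d4) = d3" by (simp add: algebra_simps flip: scaleR_add_left)
    then show ?thesis using sum3 by simp
  qed
  have "(d1 - d2) \<bullet> (d3 - d4) = 0"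
  proof -
    have orth: "cross3 (d - e) n \<in> orthogonal_comp (span {d, e, s})"
      if "d = (1/2) *\<^sub>R (d - e) + r *\<^sub>R n" "s = q *\<^sub>R n" for d e s :: "real^3" and r q
    proof -
      let ?w = "cross3 (d - e) n"
      have wn: "orthogonal ?w n" and we: "orthogonal ?w (d - e)" by (simp_all add: orthogonal_cross)
      have "orthogonal ?w d"
        by (subst that(1)) (intro orthogonal_clauses wn we)
      moreover from this we have "orthogonal ?w e"
        by (simp add: orthogonal_def inner_diff_right)
      moreover have "orthogonal ?w s" unfolding that(2) by (intro orthogonal_clauses wn)
      ultimately have "orthogonal ?w y" if "y \<in> span {d, e, s}" for y
        using that by (rule_tac orthogonal_to_span) auto
      then show ?thesis by (auto simp: orthogonal_comp_def orthogonal_commute)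
    qed
    have "cross3 (d1 - d2) n \<in> orthogonal_comp (span {d1, d2, d5})" by (rule orth[OF d1 d5])
    moreover have "cross3 (d3 - d4) n \<in> orthogonal_comp (span {d3, d4, - d5})"
    proof (rule orth)
      show "d3 = (1/2) *\<^sub>R (d3 - d4) + (- l/2) *\<^sub>R n" using d3 by simp
      show "- d5 = norm d5 *\<^sub>R n" using d5 by (metis minus_minus scaleR_minus_left)
    qed
    ultimately have "orthogonal (cross3 (d1 - d2) n) (cross3 (d3 - d4) n)"
      using perp by (simp add: perpendicular_planes_def)
    \<comment> \<open>On the plane orthogonal to the unit vector \<open>n\<close>, crossing with
      \<open>n\<close> is a quarter turn and preserves inner products.\<close>
    moreover have "cross3 p n \<bullet> cross3 q n = p \<bullet> q" if "p \<bullet> n = 0" "q \<bullet> n = 0" for p q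
    proof -
      have "cross3 p n \<bullet> cross3 q n = cross3 n (cross3 q n) \<bullet> p" by (rule cross_triple)
      also have "\<dots> = p \<bullet> q" using that n by (simp add: Lagrange inner_diff_left inner_commute norm_eq_1)
      finally show ?thesis .
    qed
    ultimately show ?thesis using g1 g3 by (simp add: orthogonal_def)
  qed
  then show ?thesis using n g1 g3 d1 d3 d5 d6 by blast
qed

lemma minimizing_ths_form:
  fixes N :: "('v, real^3) network"
  assumes "minimizing_ths_with_parameter N s"
  obtains base a b c l x n where "ths_form N base a b c l x n" "x = s * l"
proof -
  obtain f g where st: "steiner_network N" and iso: "multigraph_iso f g D1_square_D2 (quotient_graph N)"
    and len: "orbit_length N (g 1) = orbit_length N (g 2)" "orbit_length N (g 2) = orbit_length N (g 3)"
      "orbit_length N (g 3) = orbit_length N (g 4)"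
      "orbit_length N (g 4) = 2 * orbit_length N (g 5) + 2 * orbit_length N (g 6)"
    and perp: "\<forall>u\<in>f VA. \<forall>v\<in>f VC. perpendicular_planes (star_plane N u) (star_plane N v)"
    and s: "s = orbit_length N (g 5) / orbit_length N (g 1)"
    using assms unfolding minimizing_ths_with_parameter_def Let_def
    by (elim conjE exE) (rule that)
  have net: "periodic_network N" using st by (simp add: steiner_network_def)
  then have placed: "periodic_placed_graph N" by (simp add: periodic_network_def)
  obtain base a b c where "ths_graph N base a b c" and f: "\<And>q. f q = vertex_orbit N (base q)"
    and g: "\<And>j. j \<in> {1..6} \<Longrightarrow>
      g j = edge_orbit N (lifted_graph.lift N base ths_src ths_tgt (ths_vol a b c) 0 j)"
    using ths_graph_exists[OF placed iso] by metis
  then interpret ths_graph N base a b c by simp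
  have g_len: "orbit_length N (g j) = norm (evec j)" if "j \<in> {1..6}" for j
    using g[OF that] orbit_length_lift[OF that] by simp
  define l where "l = norm (evec 1)"
  have nl: "norm (evec 1) = l" "norm (evec 2) = l" "norm (evec 3) = l" "norm (evec 4) = l"
    "l = 2 * norm (evec 5) + 2 * norm (evec 6)"
    using len by (auto simp: g_len l_def)
  have pos: "norm (evec 5) > 0" "norm (evec 6) > 0" "l > 0"
    using evec_nonzero[OF net] by (auto simp: l_def)
  have sum: "(\<Sum>x\<in>darts i. sgn (dart_vec x)) = 0" for i
    using st by (simp add: steiner_iff)
  have sums: "sgn (evec 1) + sgn (evec 2) + sgn (evec 5) = 0" "sgn (evec 1) + sgn (evec 2) = sgn (evec 6)"
      "sgn (evec 3) + sgn (evec 4) = sgn (evec 5)"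
    using sum[of VA] sum[of VB] sum[of VC]
    by (simp_all add: darts_eq sgn_minus algebra_simps add_eq_0_iff2)
  have "base VA \<in> f VA" "base VC \<in> f VC"
    using vertex_orbit_self[OF placed, of "base VA"] vertex_orbit_self[OF placed, of "base VC"]
      P_vertex[OF period_zero] by (auto simp: f shift_zero)
  then have "perpendicular_planes (star_plane N (P 0 VA)) (star_plane N (P 0 VC))"
    using perp by (simp add: shift_zero)
  then have perp': "perpendicular_planes (span {evec 1, evec 2, evec 5}) (span {evec 3, evec 4, - evec 5})"
    by (simp add: star_plane_P period_zero darts_eq)
  have nz: "evec 5 \<noteq> 0" using pos by auto
  obtain n where *: "norm n = 1" "a \<bullet> n = 0" "b \<bullet> n = 0" "a \<bullet> b = 0"
      "norm a = sqrt 3 * l" "norm b = sqrt 3 * l"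
      "evec 1 = (1/2) *\<^sub>R a + (l/2) *\<^sub>R n" "evec 3 = (1/2) *\<^sub>R b - (l/2) *\<^sub>R n"
      "evec 5 = - norm (evec 5) *\<^sub>R n" "evec 6 = norm (evec 6) *\<^sub>R n"
    using steiner_frame[OF nl(1-4) pos(3) nz sums perp'] unfolding evecs by blast
  have x6: "norm (evec 6) = l / 2 - norm (evec 5)" using nl(5) by linarith
  have lt: "norm (evec 5) < l / 2" using pos x6 by linarith
  have e6: "evec 6 = (l / 2 - norm (evec 5)) *\<^sub>R n" using *(10) by (simp only: x6)
  have "ths_form N base a b c l (norm (evec 5)) n"
    by unfold_locales (rule * pos lt e6)+
  moreover have "norm (evec 5) = s * l"
    using s pos by (simp add: g_len l_def)
  ultimately show ?thesis using that by blast
qed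

section \<open>Existence\<close>

text \<open>The normal form for \<open>l = 1\<close> and \<open>x = s\<close>, solved for the
  positions with the base vertex over \<open>A\<close> at the origin. A vertex carries its lattice
  coordinate, so the action is free by construction.\<close>

definition ths_model :: "real \<Rightarrow> (quad \<times> (real^3), real^3) network"
  where "ths_model s = (let a = sqrt 3 *\<^sub>R axis 1 1; b = sqrt 3 *\<^sub>R axis 2 1; n = axis 3 1;
      c = (1/2) *\<^sub>R a - (1/2) *\<^sub>R b + (3/2) *\<^sub>R n; L = int_span {a, b, c};
      p = (\<lambda>q. case q of VA \<Rightarrow> 0 | VB \<Rightarrow> (1/2) *\<^sub>R a + (1/2) *\<^sub>R n | VC \<Rightarrow> - s *\<^sub>R n
        | VD \<Rightarrow> (1/2) *\<^sub>R a + (1 - s) *\<^sub>R n)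
    in \<lparr>vertices = UNIV \<times> L,
      edges = {{(ths_src j, u), (ths_tgt j, u + ths_vol a b c j)} | u j. u \<in> L \<and> j \<in> {1..6}},
      pos = (\<lambda>(q, u). p q + u), periods = L, shift = (\<lambda>u (q, v). (q, u + v))\<rparr>)"

lemma ths_parallel:
  assumes "distinct [a, b, c]" "0 \<notin> {a, b, c}"
    "j \<in> {1..6}" "k \<in> {1..6}" "ths_src j = ths_src k" "ths_tgt j = ths_tgt k"
    "ths_vol a b c j = ths_vol a b c k"
  shows "j = k"
  using assms unfolding atLeastAtMost_1_6 by (auto simp: ths_vol_def)

lemma ths_vol_period:
  assumes "add_subgroup G" "a \<in> G" "b \<in> G" "c \<in> G"
  shows "ths_vol a b c j \<in> G"
  using assms by (auto simp: ths_vol_def intro: add_subgroup_minus add_subgroup_diff add_subgroup_zero)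

lemma ths_model_form:
  assumes "0 < s" "s < 1 / 2"
  shows "\<exists>base a b c n. ths_form (ths_model s) base a b c 1 s n"
proof -
  define a b n :: "real^3" where "a = sqrt 3 *\<^sub>R axis 1 1" and "b = sqrt 3 *\<^sub>R axis 2 1" and "n = axis 3 1"
  define c where "c = (1/2) *\<^sub>R a - (1/2) *\<^sub>R b + (3/2) *\<^sub>R n"
  define p where "p q = (case q of VA \<Rightarrow> 0 | VB \<Rightarrow> (1/2) *\<^sub>R a + (1/2) *\<^sub>R n | VC \<Rightarrow> - s *\<^sub>R n
    | VD \<Rightarrow> (1/2) *\<^sub>R a + (1 - s) *\<^sub>R n)" for q
  let ?N = "ths_model s" and ?L = "int_span {a, b, c}" and ?v = "ths_vol a b c"
  have N: "vertices ?N = UNIV \<times> ?L" "periods ?N = ?L"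
    "edges ?N = {{(ths_src j, u), (ths_tgt j, u + ?v j)} | u j. u \<in> ?L \<and> j \<in> {1..6}}"
    "pos ?N (q, u) = p q + u" "shift ?N u (q, v) = (q, u + v)" for q u v
    unfolding ths_model_def Let_def a_def b_def c_def n_def p_def by simp_all
  have "y \<in> span {a, b, c}" for y
  proof -
    have abc: "a \<in> span {a, b, c}" "b \<in> span {a, b, c}" "c \<in> span {a, b, c}"
      by (auto intro: span_base)
    have "(2/3) *\<^sub>R (c - (1/2) *\<^sub>R a + (1/2) *\<^sub>R b) \<in> span {a, b, c}"
      by (intro span_scale span_add span_diff abc)
    also have "(2/3) *\<^sub>R (c - (1/2) *\<^sub>R a + (1/2) *\<^sub>R b) = n" by (simp add: c_def)
    finally have "(y $ 1 / sqrt 3) *\<^sub>R a + (y $ 2 / sqrt 3) *\<^sub>R b + y $ 3 *\<^sub>R n \<in> span {a, b, c}"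
      by (intro span_scale span_add abc)
    also have "(y $ 1 / sqrt 3) *\<^sub>R a + (y $ 2 / sqrt 3) *\<^sub>R b + y $ 3 *\<^sub>R n = y"
      by (simp add: vec_eq_iff forall_3 a_def b_def n_def axis_def)
    finally show ?thesis .
  qed
  then have "span {a, b, c} = UNIV" by blast
  then have indep: "independent {a, b, c}" and dist: "distinct [a, b, c]"
    and basis: "lattice_basis ?L {a, b, c}"
    using spanning_triple[of a b c] by (simp_all add: lattice_basis_def)
  have nz: "0 \<notin> {a, b, c}" using indep dependent_zero[of "{a, b, c}"] by (rule_tac notI) simp
  have par: "j = k" if "j \<in> {1..6}" "k \<in> {1..6}" "ths_src j = ths_src k" "ths_tgt j = ths_tgt k"
    "?v j = ?v k" for j k
    by (rule ths_parallel[OF dist nz that])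
  have sub: "add_subgroup ?L" by (rule add_subgroup_int_span)
  have vol: "?v j \<in> ?L" for j
    by (rule ths_vol_period[OF sub]) (auto intro: int_span_base)
  let ?base = "\<lambda>q. (q, 0 :: real^3)"
  have "lifted_graph ?N UNIV ?base {1..6} ths_src ths_tgt ?v"
  proof
    show "full_lattice (periods ?N)" using basis by (auto simp: N full_lattice_def)
    show "finite (UNIV :: quad set)" by (simp add: UNIV_quad)
    show "j = k" if "j \<in> {1..6}" "k \<in> {1..6}" "ths_src j = ths_src k" "ths_tgt j = ths_tgt k"
      "?v j = ?v k" for j k using par[OF that] .
    show "ths_tgt j \<noteq> ths_src k" if "j \<in> {1..6}" "k \<in> {1..6}" "ths_src j = ths_tgt k" for j k
      using that by (auto split: if_splits)
  qed (auto simp: N vol)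
  then interpret G: ths_graph ?N ?base a b c
    by (rule ths_graph.intro) (use basis dist in \<open>simp add: ths_graph_axioms_def N\<close>)
  have "ths_form ?N ?base a b c 1 s n"
  proof
    have ev: "G.evec j = p (ths_tgt j) + ?v j - p (ths_src j)" for j
      by (simp add: G.evec_def N)
    show "G.evec 1 = (1/2) *\<^sub>R a + (1/2) *\<^sub>R n" "G.evec 3 = (1/2) *\<^sub>R b - (1/2) *\<^sub>R n"
      "G.evec 5 = - s *\<^sub>R n" "G.evec 6 = (1/2 - s) *\<^sub>R n"
      unfolding ev by (simp_all add: p_def ths_vol_def c_def vec_eq_iff field_simps)
    show "0 < s" "s < 1 / 2" by fact+
    show "norm n = 1" "norm a = sqrt 3 * 1" "norm b = sqrt 3 * 1" by (simp_all add: n_def a_def b_def)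
    show "a \<bullet> n = 0" "b \<bullet> n = 0" "a \<bullet> b = 0" by (simp_all add: n_def a_def b_def inner_axis_axis)
  qed simp
  then show ?thesis by blast
qed


section \<open>Similarity\<close>

text \<open>In the normal form, lattice and edges are fixed combinations of \<open>a\<close>,
  \<open>b\<close> and \<open>n\<close> with coefficients depending on \<open>l\<close> and
  \<open>x\<close>. The isometry between the two frames, scaled by \<open>l' / l\<close>, matches
  everything once the ratios agree.\<close>

lemma ths_forms_similar:
  assumes "ths_form N base a b c l x n" "ths_form N' base' a' b' c' l' x' n'" and s: "x / l = x' / l'"
  shows "similar_networks N N'"
proof -
  interpret A: ths_form N base a b c l x n by fact
  interpret B: ths_form N' base' a' b' c' l' x' n' by fact
  obtain f where f: "orthogonal_transformation f"
    and fa: "f ((1 / (sqrt 3 * l)) *\<^sub>R a) = (1 / (sqrt 3 * l')) *\<^sub>R a'"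
    and fb: "f ((1 / (sqrt 3 * l)) *\<^sub>R b) = (1 / (sqrt 3 * l')) *\<^sub>R b'" and fn: "f n = n'"
    using frame_map[OF A.frame_abn B.frame_abn] by blast
  define T where "T y = (l' / l) *\<^sub>R f y" for y
  have k: "l' / l > 0" using A.l B.l by simp
  have lin: "linear T"
    unfolding T_def using orthogonal_transformation_linear[OF f] by (rule linear_compose_scale_right)
  have inj: "inj T" using orthogonal_transformation_inj[OF f] k by (auto simp: T_def inj_def)
  note T_simps = linear_add[OF lin] linear_diff[OF lin] linear_cmul[OF lin] linear_neg[OF lin] linear_0[OF lin]
  have scale: "T u = u'" if "f ((1 / (sqrt 3 * l)) *\<^sub>R u) = (1 / (sqrt 3 * l')) *\<^sub>R u'" for u u'
  proof -
    have "T u = (l' * sqrt 3) *\<^sub>R f ((1 / (sqrt 3 * l)) *\<^sub>R u)"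
      using A.l by (simp add: T_def orthogonal_transformation_scaleR[OF f])
    then show ?thesis using B.l that by simp
  qed
  have Ta: "T a = a'" and Tb: "T b = b'" and Tn: "T n = (l' / l) *\<^sub>R n'"
    using scale[OF fa] scale[OF fb] fn by (simp_all add: T_def)
  have Tc: "T c = c'"
    unfolding A.c_eq B.c_eq using A.l by (simp add: T_simps Ta Tb Tn)
  have x': "x * (l' / l) = x'" using s A.l B.l by (simp add: field_simps)
  have T1: "T (A.evec 1) = B.evec 1" unfolding A.evec1 B.evec1 using A.l by (simp add: T_simps Ta Tn)
  have T5: "T (A.evec 5) = B.evec 5" unfolding A.evec5 B.evec5 x'[symmetric] by (simp add: T_simps Tn)
  have T6: "T (A.evec 6) = B.evec 6"
  proof -
    have "(l / 2 - x) * (l' / l) = l / 2 * (l' / l) - x * (l' / l)" by (rule left_diff_distrib)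
    also have "\<dots> = l' / 2 - x'" unfolding x' using A.l by simp
    finally have "(l / 2 - x) * (l' / l) = l' / 2 - x'" .
    then show ?thesis unfolding A.evec6 B.evec6 by (simp only: T_simps Tn scaleR_scaleR)
  qed
  show ?thesis
  proof (rule similar_lifted_graphs[OF A.lifted_graph_axioms B.lifted_graph_axioms f k])
    show "T = (\<lambda>y. (l' / l) *\<^sub>R f y)" by (simp add: fun_eq_iff T_def)
    have "T ` periods N = int_span (T ` {a, b, c})"
      unfolding A.periods_eq by (rule int_span_image[OF lin inj_on_subset[OF inj], symmetric]) simp
    then show "T ` periods N = periods N'" by (simp add: B.periods_eq Ta Tb Tc)
    show "T (ths_vol a b c j) = ths_vol a' b' c' j" for j
      by (simp add: ths_vol_def T_simps Ta Tb Tc)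
    show "T (pos N (base i) - pos N (base VA)) = pos N' (base' i) - pos N' (base' VA)" for i
    proof (cases i)
      case VD
      have "T (A.evec 1 + A.evec 6) = B.evec 1 + B.evec 6" by (simp only: T_simps T1 T6)
      then show ?thesis by (simp add: VD A.evec_def B.evec_def ths_vol_def)
    qed (use T1 T5 in \<open>simp_all add: A.evec_def B.evec_def ths_vol_def T_simps\<close>)
  qed
qed

lemma (in ths_form) edge_length_set:
  "{dist (pos N u) (pos N v) | u v. {u, v} \<in> edges N} = {l, x, l / 2 - x}"
  unfolding edge_lengths atLeastAtMost_1_6 by (simp add: norm_evec)

text \<open>The only lengths are \<open>l\<close>, \<open>x\<close> and \<open>l / 2 - x\<close>. As
  \<open>l\<close> is twice the sum of the other two it is the largest, so it must correspond to
  \<open>l'\<close> and fixes the scale; only two values are then left for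
  \<open>x'\<close>.\<close>

lemma similar_ths_forms_parameter:
  assumes "ths_form N base a b c l x n" "ths_form N' base' a' b' c' l' x' n'"
    and "similar_networks N N'"
  shows "x' / l' = x / l \<or> x' / l' = 1 / 2 - x / l"
proof -
  interpret A: ths_form N base a b c l x n by fact
  interpret B: ths_form N' base' a' b' c' l' x' n' by fact
  have "e \<subseteq> vertices N \<and> card e = 2" if "e \<in> edges N" for e
    using A.placed that by (auto simp: periodic_placed_graph_def)
  then obtain k where k: "k > 0" "{l', x', l' / 2 - x'} = (*) k ` {l, x, l / 2 - x}"
    using similar_edge_lengths[OF assms(3)] unfolding A.edge_length_set B.edge_length_set by metis
  then have eq: "{l', x', l' / 2 - x'} = {k * l, k * x, k * (l / 2 - x)}" by simp
  have kl: "k * x > 0" "k * (l / 2 - x) > 0" "k * l = 2 * (k * x + k * (l / 2 - x))"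
    using k(1) A.x by (simp_all add: right_diff_distrib)
  have "l' \<in> {k * l, k * x, k * (l / 2 - x)}" by (simp only: eq[symmetric]) simp
  moreover have "k * l \<in> {l', x', l' / 2 - x'}" by (simp only: eq) simp
  moreover have "u = y" if "u \<in> {y, p, q}" "y \<in> {u, z, u / 2 - z}" "0 < p" "0 < q" "y = 2 * (p + q)"
    "0 < z" "z < u / 2" for u y z p q :: real
    using that by auto
  ultimately have l': "l' = k * l" using kl B.x by blast
  have "x' \<in> {k * l, k * x, k * (l / 2 - x)}" by (simp only: eq[symmetric]) simp
  then have "x' = k * x \<or> x' = k * (l / 2 - x)" using B.x B.l unfolding l' by auto
  then show ?thesis unfolding l' using k(1) A.l by (auto simp: diff_divide_distrib)
qed

text \<open>The symmetry that reverses both double edges exchanges the edges 5 and 6. Hence one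
  network has the parameters \<open>s\<close> and \<open>1 / 2 - s\<close> under two identifications
  of its quotient.\<close>

lemma multigraph_iso_flip:
  "multigraph_iso (\<lambda>q. case q of VA \<Rightarrow> VB | VB \<Rightarrow> VA | VC \<Rightarrow> VD | VD \<Rightarrow> VC)
    (\<lambda>j. if j = 5 then 6 else if j = 6 then 5 else j) D1_square_D2 D1_square_D2"
    (is "multigraph_iso ?f ?g _ _")
proof -
  have "bij_betw ?f UNIV UNIV"
    by (rule bij_betw_byWitness[where f' = ?f]) (auto split: quad.split)
  moreover have "bij_betw ?g {1..6} {1..6}"
    by (rule bij_betw_byWitness[where f' = ?g]) auto
  moreover have "mends D1_square_D2 (?g j) = ?f ` mends D1_square_D2 j" if "j \<in> {1..6}" for j
    using that unfolding atLeastAtMost_1_6 by (auto simp: D1_square_D2_def)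
  ultimately show ?thesis by (simp add: multigraph_iso_def D1_square_D2_def)
qed

lemma (in ths_form) minimizing_flipped: "minimizing_ths_with_parameter N (1 / 2 - x / l)"
proof -
  have perp: "perpendicular_planes (star_plane N u) (star_plane N v)"
    if uv: "u \<in> vertex_orbit N (base VB)" "v \<in> vertex_orbit N (base VD)" for u v
  proof -
    obtain d e where "d \<in> periods N" "u = P d VB" "e \<in> periods N" "v = P e VD"
      using uv by (auto simp: vertex_orbit_def)
    then show ?thesis
      using perpendicular_coordinate_planes[OF nonzero_abn ab an bn] by (simp add: planes)
  qed
  have "1 / 2 - x / l = (l / 2 - x) / l" using l by (simp add: field_simps)
  with perp show ?thesis
    unfolding minimizing_ths_with_parameter_def Let_def
    by - (rule conjI[OF steiner], rule exI, rule exI, rule conjI[OF multigraph_iso_trans[OF multigraph_iso_flip quotient_iso_D]],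
        simp add: orbit_length_lift norm_evec)
qed

lemma ths_similar_iff:
  fixes N :: "('v, real^3) network" and N' :: "('w, real^3) network"
  assumes "minimizing_ths_with_parameter N s" "minimizing_ths_with_parameter N' s'"
  shows "similar_networks N N' \<longleftrightarrow> s' = s \<or> s' = 1 / 2 - s"
proof -
  obtain base a b c l x n where F: "ths_form N base a b c l x n" and x: "x = s * l"
    using minimizing_ths_form[OF assms(1)] by metis
  obtain base' a' b' c' l' x' n' where F': "ths_form N' base' a' b' c' l' x' n'" and x': "x' = s' * l'"
    using minimizing_ths_form[OF assms(2)] by metis
  interpret A: ths_form N base a b c l x n by fact
  interpret B: ths_form N' base' a' b' c' l' x' n' by fact
  have s: "s = x / l" "s' = x' / l'" using x x' A.l B.l by simp_all
  show ?thesis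
  proof
    assume "similar_networks N N'"
    then show "s' = s \<or> s' = 1 / 2 - s"
      using similar_ths_forms_parameter[OF F F'] by (simp add: s)
  next
    assume "s' = s \<or> s' = 1 / 2 - s"
    then show "similar_networks N N'"
    proof
      assume "s' = s"
      then show ?thesis using ths_forms_similar[OF F F'] s by simp
    next
      \<comment> \<open>Under the reversed identification \<open>N\<close> itself has parameter
        \<open>s'\<close>, which leads back to equal parameters.\<close>
      assume flip: "s' = 1 / 2 - s"
      obtain base'' a'' b'' c'' l'' x'' n''
        where F'': "ths_form N base'' a'' b'' c'' l'' x'' n''" and x'': "x'' = (1 / 2 - x / l) * l''"
        using minimizing_ths_form[OF A.minimizing_flipped] by metis
      interpret C: ths_form N base'' a'' b'' c'' l'' x'' n'' by fact
      have "x'' / l'' = x' / l'" using x'' C.l flip s by simp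
      then show ?thesis by (rule ths_forms_similar[OF F'' F'])
    qed
  qed
qed

lemma (in ths_form) similar_ths_lattice: "similar_lattices (periods N) ths_lattice"
proof -
  define e1 e2 e3 :: "real^3" where "e1 = vector [1, 0, 0]" and "e2 = vector [0, 1, 0]" and "e3 = vector [0, 0, 1]"
  \<comment> \<open>Sending \<open>b\<close> to the negative direction of \<open>e2\<close> turns
    its coefficient -1/2 in \<open>c\<close> into the 1/2 of the standard generator; the sign does
    not affect the lattice spanned.\<close>
  have fr: "frame e1 (- e2) e3"
    by (simp add: frame_def e1_def e2_def e3_def norm_eq_sqrt_inner inner_vec_def sum_3)
  obtain f where f: "orthogonal_transformation f"
    and fa: "f ((1 / (sqrt 3 * l)) *\<^sub>R a) = e1"
    and fb: "f ((1 / (sqrt 3 * l)) *\<^sub>R b) = - e2" and fn: "f n = e3"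
    using frame_map[OF frame_abn fr] by blast
  define T where "T y = (1 / (sqrt 3 * l)) *\<^sub>R f y" for y
  have k: "1 / (sqrt 3 * l) > 0" using l by simp
  have lin: "linear T"
    unfolding T_def using orthogonal_transformation_linear[OF f] by (rule linear_compose_scale_right)
  have inj: "inj T" using orthogonal_transformation_inj[OF f] k by (auto simp: T_def inj_def)
  note T_simps = linear_add[OF lin] linear_diff[OF lin] linear_cmul[OF lin]
  have Ta: "T a = e1" and Tb: "T b = - e2" and Tn: "T n = (1 / (sqrt 3 * l)) *\<^sub>R e3"
    using fa fb fn by (simp_all add: T_def orthogonal_transformation_scaleR[OF f])
  have "3 * l / 2 * (1 / (sqrt 3 * l)) = sqrt 3 / 2"
    using l real_sqrt_mult_self[of 3] by (simp add: field_simps)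
  then have Tc: "T c = (1/2) *\<^sub>R e1 + (1/2) *\<^sub>R e2 + (sqrt 3 / 2) *\<^sub>R e3"
    unfolding c_eq by (simp only: T_simps Ta Tb Tn scaleR_scaleR) simp
  have v: "vector [1/2, 1/2, sqrt 3 / 2] = (1/2) *\<^sub>R e1 + (1/2) *\<^sub>R e2 + (sqrt 3 / 2) *\<^sub>R e3"
    by (simp add: vec_eq_iff forall_3 e1_def e2_def e3_def)
  have "T ` periods N = int_span (T ` {a, b, c})"
    unfolding periods_eq by (rule int_span_image[OF lin inj_on_subset[OF inj], symmetric]) simp
  also have "\<dots> = int_span {e1, - e2, T c}" by (simp add: Ta Tb)
  also have "\<dots> = int_span {e1, e2, T c}"
  proof
    have "e1 \<in> int_span {e1, e2, T c}" "e2 \<in> int_span {e1, e2, T c}" "T c \<in> int_span {e1, e2, T c}"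
      by (auto intro: int_span_base)
    then show "int_span {e1, - e2, T c} \<subseteq> int_span {e1, e2, T c}"
      by (intro int_span_least add_subgroup_int_span) (auto intro: add_subgroup_minus add_subgroup_int_span)
    have "e1 \<in> int_span {e1, - e2, T c}" "- (- e2) \<in> int_span {e1, - e2, T c}"
      "T c \<in> int_span {e1, - e2, T c}"
      by (rule int_span_base add_subgroup_minus[OF add_subgroup_int_span int_span_base]; simp)+
    then show "int_span {e1, e2, T c} \<subseteq> int_span {e1, - e2, T c}"
      by (intro int_span_least add_subgroup_int_span) auto
  qed
  also have "\<dots> = ths_lattice" by (simp add: ths_lattice_def v Tc e1_def e2_def)
  finally have "T ` periods N = ths_lattice" .
  moreover have "similarity T" unfolding similarity_def
    by (intro exI[of _ "1 / (sqrt 3 * l)"] exI[of _ f] exI[of _ 0]) (simp add: k[simplified] f T_def fun_eq_iff l)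
  moreover have "T 0 = 0" by (rule linear_0[OF lin])
  ultimately show ?thesis unfolding similar_lattices_def by blast
qed

section \<open>The homotopy\<close>

text \<open>This differs from \<open>ths_src\<close> and \<open>ths_tgt\<close> only in the sources
  of the edges 2 and 3, which are exchanged. Reading \<open>VA\<close> for \<open>VC\<close> in
  either graph and omitting edge 5 gives \<open>cross_src\<close> and
  \<open>cross_tgt\<close>.\<close>

fun k4_src k4_tgt :: "nat \<Rightarrow> quad" where
  "k4_src j = (if j \<in> {1, 3, 5} then VA else if j = 6 then VB else VC)"
| "k4_tgt j = (if j \<in> {1, 2} then VB else if j = 5 then VC else VD)"

fun cross_src cross_tgt :: "nat \<Rightarrow> quad" where
  "cross_src j = (if j = 6 then VB else VA)"
| "cross_tgt j = (if j \<in> {1, 2} then VB else VD)"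

lemma atLeastAtMost_1_6_minus: "{1..6} - {5} = {1, 2, 3, 4, 6::nat}"
  by auto

lemma card_2_quad:
  "{e :: quad set. card e = 2} = {{VA, VB}, {VA, VC}, {VA, VD}, {VB, VC}, {VB, VD}, {VC, VD}}"
proof (intro equalityI subsetI)
  fix e :: "quad set" assume "e \<in> {e. card e = 2}"
  then obtain u v where "e = {u, v}" "u \<noteq> v" by (auto simp: card_2_iff)
  then show "e \<in> {{VA, VB}, {VA, VC}, {VA, VD}, {VB, VC}, {VB, VD}, {VC, VD}}"
    by (cases u; cases v) (auto simp: insert_commute)
qed auto

lemma k4_presentation:
  "multigraph_iso id (\<lambda>j. {k4_src j, k4_tgt j})
    \<lparr>mverts = UNIV, medges = {1..6}, mends = (\<lambda>j. {k4_src j, k4_tgt j})\<rparr> K4"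
proof -
  have "inj_on (\<lambda>j. {k4_src j, k4_tgt j}) {1..6}"
    unfolding atLeastAtMost_1_6 by (auto simp: inj_on_def doubleton_eq_iff)
  moreover have "(\<lambda>j. {k4_src j, k4_tgt j}) ` {1..6} = {e. card e = 2}"
    unfolding atLeastAtMost_1_6 card_2_quad by (auto simp: insert_commute)
  ultimately show ?thesis by (simp add: multigraph_iso_def K4_def bij_betw_def)
qed

lemma quotient_ends:
  assumes "periodic_placed_graph N" "E \<in> medges (quotient_graph N)"
  shows "mends (quotient_graph N) E \<subseteq> mverts (quotient_graph N)"
proof -
  obtain e where e: "e \<in> edges N" "E = edge_orbit N e" using assms(2) by (auto simp: quotient_graph_def)
  have "u \<in> vertices N" if u: "u \<in> \<Union>E" for u
  proof -
    obtain d where "d \<in> periods N" "u \<in> shift N d ` e" using u e by (auto simp: edge_orbit_def)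
    moreover have "e \<subseteq> vertices N" using assms(1) e(1) by (simp add: periodic_placed_graph_def)
    ultimately show ?thesis using assms(1) by (auto simp: periodic_placed_graph_def)
  qed
  then show ?thesis by (auto simp: quotient_graph_def)
qed

context ths_form
begin

text \<open>With these constants the edges of the final network meet at equal angles.\<close>

definition kap :: real where "kap = l * (1 / 2 - sqrt 3 / 4)"
definition p0 :: real where "p0 = (2 - sqrt 2) / 8"
definition w :: "real^3" where "w = p0 *\<^sub>R (a + b)"

text \<open>Two clocks, one running in each half of the unit interval and constant in the other, so
  that a single continuous formula describes the whole motion.\<close>

definition slide :: "real \<Rightarrow> real" where "slide t = min 1 (2 * t)"
definition spread :: "real \<Rightarrow> real" where "spread t = max 0 (2 * t - 1)"

text \<open>While sliding, \<open>C\<close> and \<open>D\<close> move by the same vector: the edges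
  3 and 4 are carried along rigidly and edge 6 gains what edge 5 loses. Afterwards \<open>A\<close>
  and \<open>C\<close> part along \<open>w\<close>, \<open>B\<close> and \<open>D\<close> along
  \<open>n\<close>. The motion is the same for all vertices of an orbit, which keeps the lattice
  fixed.\<close>

definition displacement :: "real \<Rightarrow> quad \<Rightarrow> real^3"
  where "displacement t q = (case q of
      VA \<Rightarrow> spread t *\<^sub>R w
    | VB \<Rightarrow> - (spread t * kap) *\<^sub>R n
    | VC \<Rightarrow> (slide t * x) *\<^sub>R n - spread t *\<^sub>R w
    | VD \<Rightarrow> (slide t * x + spread t * kap) *\<^sub>R n)"

definition moved :: "real \<Rightarrow> 'v \<Rightarrow> real^3"
  where "moved t v = pos N v + displacement t (THE q. v \<in> vertex_orbit N (base q))"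

definition slid :: "real \<Rightarrow> ('v, real^3) network"
  where "slid t = regraph N UNIV base {1..6} ths_src ths_tgt (ths_vol a b c) (moved t)"

definition crossed :: "real \<Rightarrow> ('v, real^3) network"
  where "crossed t = regraph N (UNIV - {VC}) base ({1..6} - {5}) cross_src cross_tgt (ths_vol a b c) (moved t)"

definition resolved :: "real \<Rightarrow> ('v, real^3) network"
  where "resolved t = regraph N UNIV base {1..6} k4_src k4_tgt (ths_vol a b c) (moved t)"

definition path :: "real \<Rightarrow> ('v, real^3) network"
  where "path t = (if t < 1 / 2 then slid t else if t = 1 / 2 then crossed t else resolved t)"

section \<open>The three graphs along the path\<close>

lemma moved_P: "d \<in> periods N \<Longrightarrow> moved t (P d i) = pos N (base i) + displacement t i + d"
proof -
  assume d: "d \<in> periods N"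
  have "(THE q. P d i \<in> vertex_orbit N (base q)) = i"
    using d by (intro the_equality) (auto simp: vertex_orbit_base P_eq_iff)
  then show ?thesis using d by (simp add: moved_def pos_shift)
qed

lemma moved_base: "moved t (base i) = pos N (base i) + displacement t i"
  using moved_P[OF period_zero] by (simp add: shift_zero)

lemma moved_0: "moved 0 = pos N"
proof
  fix v
  have "displacement 0 q = 0" for q
    by (cases q) (simp_all add: displacement_def slide_def spread_def)
  then show "moved 0 v = pos N v" by (simp add: moved_def)
qed

lemma ths_vol_in: "ths_vol a b c j \<in> periods N"
  unfolding periods_eq by (rule ths_vol_period[OF add_subgroup_int_span]) (auto intro: int_span_base)

lemma basis_nonzero: "0 \<notin> {a, b, c}"
  using basis dependent_zero[of "{a, b, c}"] by (intro notI) (simp add: lattice_basis_def)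

lemma lifted_slid: "lifted_graph (slid t) UNIV base {1..6} ths_src ths_tgt (ths_vol a b c)"
  unfolding slid_def
proof (rule lifted_regraph)
  show "j = k" if "j \<in> {1..6}" "k \<in> {1..6}" "ths_src j = ths_src k" "ths_tgt j = ths_tgt k"
    "ths_vol a b c j = ths_vol a b c k" for j k
    by (rule ths_parallel[OF basis_distinct basis_nonzero that])
  show "ths_tgt j \<noteq> ths_src k" if "j \<in> {1..6}" "k \<in> {1..6}" "ths_src j = ths_tgt k" for j k
    by (rule no_loop[OF that])
qed (auto simp: ths_vol_in moved_P moved_base)

lemma lifted_crossed:
  "lifted_graph (crossed t) (UNIV - {VC}) base ({1..6} - {5}) cross_src cross_tgt (ths_vol a b c)"
  unfolding crossed_def
proof (rule lifted_regraph)
  show "j = k" if "j \<in> {1..6} - {5}" "k \<in> {1..6} - {5}" "cross_src j = cross_src k" "cross_tgt j = cross_tgt k"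
    "ths_vol a b c j = ths_vol a b c k" for j k
    using that basis_nonzero basis_distinct unfolding atLeastAtMost_1_6_minus by (auto simp: ths_vol_def)
qed (auto simp: ths_vol_in moved_P moved_base split: if_splits)

lemma lifted_resolved: "lifted_graph (resolved t) UNIV base {1..6} k4_src k4_tgt (ths_vol a b c)"
  unfolding resolved_def
proof (rule lifted_regraph)
  show "j = k" if "j \<in> {1..6}" "k \<in> {1..6}" "k4_src j = k4_src k" "k4_tgt j = k4_tgt k"
    "ths_vol a b c j = ths_vol a b c k" for j k
    using that unfolding atLeastAtMost_1_6 by auto
  show "k4_tgt j \<noteq> k4_src k" if "j \<in> {1..6}" "k \<in> {1..6}" "k4_src j = k4_tgt k" for j k
    using that(3) by (auto split: if_splits)
qed (auto simp: ths_vol_in moved_P moved_base)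

lemma path_simps [simp]:
  "periods (slid t) = periods N" "periods (crossed t) = periods N" "periods (resolved t) = periods N"
  "shift (slid t) = shift N" "shift (crossed t) = shift N" "shift (resolved t) = shift N"
  "pos (slid t) = moved t" "pos (crossed t) = moved t" "pos (resolved t) = moved t"
  by (simp_all add: slid_def crossed_def resolved_def)

lemma kap_pos: "kap > 0"
proof -
  have "sqrt 3 < 2" by (rule real_less_lsqrt) simp_all
  then show ?thesis using l by (simp add: kap_def)
qed

lemma p0_bounds: "p0 > 0" "p0 < 1 / 4"
proof -
  have "sqrt 2 < 2" by (rule real_less_lsqrt) simp_all
  then show "p0 > 0" "p0 < 1 / 4" by (simp_all add: p0_def)
qed

lemma base_pos:
  "pos N (base VB) = pos N (base VA) + (1/2) *\<^sub>R a + (l/2) *\<^sub>R n"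
  "pos N (base VC) = pos N (base VA) - x *\<^sub>R n"
  "pos N (base VD) = pos N (base VA) + (1/2) *\<^sub>R a + (l - x) *\<^sub>R n"
proof -
  show B: "pos N (base VB) = pos N (base VA) + (1/2) *\<^sub>R a + (l/2) *\<^sub>R n"
    using evec1 by (simp add: evec_def ths_vol_def algebra_simps)
  show "pos N (base VC) = pos N (base VA) - x *\<^sub>R n"
    using evec5 by (simp add: evec_def ths_vol_def algebra_simps)
  have "pos N (base VD) = pos N (base VB) + (l/2 - x) *\<^sub>R n"
    using evec6 by (simp add: evec_def ths_vol_def algebra_simps)
  then show "pos N (base VD) = pos N (base VA) + (1/2) *\<^sub>R a + (l - x) *\<^sub>R n"
    unfolding B by (simp add: vec_eq_iff field_simps)
qed

lemma slid_graph: "ths_graph (slid t) base a b c"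
  by (intro ths_graph.intro lifted_slid) (use basis basis_distinct in \<open>simp add: ths_graph_axioms_def\<close>)

text \<open>Sliding runs through the minimizing family with fixed lattice and \<open>l\<close>, only
  edge 5 gets shorter. So the first half inherits immersion and constant length from the normal
  form.\<close>

lemma slid_form:
  assumes "0 \<le> t" "t < 1 / 2"
  shows "ths_form (slid t) base a b c l ((1 - 2 * t) * x) n"
proof -
  interpret S: ths_graph "slid t" base a b c by (rule slid_graph)
  have st: "slide t = 2 * t" "spread t = 0" using assms by (auto simp: slide_def spread_def)
  show ?thesis
  proof
    have ev: "S.evec j = moved t (base (ths_tgt j)) + ths_vol a b c j - moved t (base (ths_src j))" for j
      by (simp add: S.evec_def)
    show "S.evec 1 = (1/2) *\<^sub>R a + (l/2) *\<^sub>R n" "S.evec 3 = (1/2) *\<^sub>R b - (l/2) *\<^sub>R n"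
      "S.evec 5 = - ((1 - 2 * t) * x) *\<^sub>R n" "S.evec 6 = (l/2 - (1 - 2 * t) * x) *\<^sub>R n"
      unfolding ev moved_base
      by (simp_all add: base_pos displacement_def ths_vol_def c_eq st vec_eq_iff field_simps)
    show "(1 - 2 * t) * x > 0" using assms x by simp
    have "(1 - 2 * t) * x \<le> 1 * x" using assms x by (intro mult_right_mono) auto
    then show "(1 - 2 * t) * x < l / 2" using x by linarith
  qed (rule l n an bn ab norm_a norm_b)+
qed

lemma crossed_evec:
  "lifted_graph.evec (crossed (1/2)) base cross_src cross_tgt (ths_vol a b c) 1 = (1/2) *\<^sub>R a + (l/2) *\<^sub>R n"
  "lifted_graph.evec (crossed (1/2)) base cross_src cross_tgt (ths_vol a b c) 2 = - (1/2) *\<^sub>R a + (l/2) *\<^sub>R n"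
  "lifted_graph.evec (crossed (1/2)) base cross_src cross_tgt (ths_vol a b c) 3 = (1/2) *\<^sub>R b - (l/2) *\<^sub>R n"
  "lifted_graph.evec (crossed (1/2)) base cross_src cross_tgt (ths_vol a b c) 4 = - (1/2) *\<^sub>R b - (l/2) *\<^sub>R n"
  "lifted_graph.evec (crossed (1/2)) base cross_src cross_tgt (ths_vol a b c) 6 = (l/2) *\<^sub>R n"
  unfolding lifted_graph.evec_def[OF lifted_crossed] path_simps moved_base
  by (simp_all add: base_pos displacement_def ths_vol_def c_eq slide_def spread_def vec_eq_iff field_simps)

lemma resolved_evec:
  assumes "1 / 2 \<le> t"
  defines "s \<equiv> 2 * t - 1"
  shows
  "lifted_graph.evec (resolved t) base k4_src k4_tgt (ths_vol a b c) 1 =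
    (1/2) *\<^sub>R a + (l/2 - s * kap) *\<^sub>R n - s *\<^sub>R w"
  "lifted_graph.evec (resolved t) base k4_src k4_tgt (ths_vol a b c) 2 =
    - (1/2) *\<^sub>R a + (l/2 - s * kap) *\<^sub>R n + s *\<^sub>R w"
  "lifted_graph.evec (resolved t) base k4_src k4_tgt (ths_vol a b c) 3 =
    (1/2) *\<^sub>R b - (l/2 - s * kap) *\<^sub>R n - s *\<^sub>R w"
  "lifted_graph.evec (resolved t) base k4_src k4_tgt (ths_vol a b c) 4 =
    - (1/2) *\<^sub>R b - (l/2 - s * kap) *\<^sub>R n + s *\<^sub>R w"
  "lifted_graph.evec (resolved t) base k4_src k4_tgt (ths_vol a b c) 5 = - (2 * s) *\<^sub>R w"
  "lifted_graph.evec (resolved t) base k4_src k4_tgt (ths_vol a b c) 6 = (l/2 + 2 * s * kap) *\<^sub>R n"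
proof -
  have st: "slide t = 1" "spread t = s" using assms by (auto simp: slide_def spread_def)
  show "lifted_graph.evec (resolved t) base k4_src k4_tgt (ths_vol a b c) 1 =
      (1/2) *\<^sub>R a + (l/2 - s * kap) *\<^sub>R n - s *\<^sub>R w"
    "lifted_graph.evec (resolved t) base k4_src k4_tgt (ths_vol a b c) 2 =
      - (1/2) *\<^sub>R a + (l/2 - s * kap) *\<^sub>R n + s *\<^sub>R w"
    "lifted_graph.evec (resolved t) base k4_src k4_tgt (ths_vol a b c) 3 =
      (1/2) *\<^sub>R b - (l/2 - s * kap) *\<^sub>R n - s *\<^sub>R w"
    "lifted_graph.evec (resolved t) base k4_src k4_tgt (ths_vol a b c) 4 =
      - (1/2) *\<^sub>R b - (l/2 - s * kap) *\<^sub>R n + s *\<^sub>R w"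
    "lifted_graph.evec (resolved t) base k4_src k4_tgt (ths_vol a b c) 5 = - (2 * s) *\<^sub>R w"
    "lifted_graph.evec (resolved t) base k4_src k4_tgt (ths_vol a b c) 6 = (l/2 + 2 * s * kap) *\<^sub>R n"
    unfolding lifted_graph.evec_def[OF lifted_resolved] path_simps moved_base
    by (simp_all add: base_pos displacement_def ths_vol_def c_eq st vec_eq_iff field_simps)
qed

lemma inner_w:
  "w \<bullet> a = 3 * l\<^sup>2 * p0" "w \<bullet> b = 3 * l\<^sup>2 * p0" "w \<bullet> n = 0" "w \<bullet> w = 6 * l\<^sup>2 * p0\<^sup>2"
  "a \<bullet> w = 3 * l\<^sup>2 * p0" "b \<bullet> w = 3 * l\<^sup>2 * p0" "n \<bullet> w = 0"
  by (simp_all add: w_def inner_add_left inner_add_right inner_all power2_eq_square)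

lemma norm_w: "norm w = sqrt 6 * l * p0"
proof -
  have "norm w = sqrt (6 * l\<^sup>2 * p0\<^sup>2)" by (simp add: norm_eq_sqrt_inner inner_w)
  then show ?thesis using l p0_bounds by (simp add: real_sqrt_mult)
qed

lemma placed_crossed: "periodic_placed_graph (crossed t)"
proof -
  interpret X: lifted_graph "crossed t" "UNIV - {VC}" base "{1..6} - {5}" cross_src cross_tgt "ths_vol a b c"
    by (rule lifted_crossed)
  show ?thesis
  proof (rule X.placed_graphI[of VA])
    show X.generating
      by (rule X.generating_triple) (simp add: periods_eq, rule ths_vol_image, simp)
    fix d i assume d: "d \<in> periods (crossed t)" and i: "i \<in> UNIV - {VC}"
    have B: "(X.P d VB, X.P d VA) \<in> X.adj_rel\<^sup>*"
      using X.zero_vol_edge(2)[of 1, OF _ _ d] by (simp add: ths_vol_def)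
    moreover have "(X.P d VD, X.P d VB) \<in> X.adj_rel\<^sup>*"
      using X.zero_vol_edge(2)[of 6, OF _ _ d] by (simp add: ths_vol_def)
    ultimately show "(X.P d i, X.P d VA) \<in> X.adj_rel\<^sup>*"
      using i by (cases i) (auto intro: rtrancl_trans)
  qed simp
qed

lemma placed_resolved: "periodic_placed_graph (resolved t)"
proof -
  interpret X: lifted_graph "resolved t" UNIV base "{1..6}" k4_src k4_tgt "ths_vol a b c"
    by (rule lifted_resolved)
  show ?thesis
  proof (rule X.placed_graphI[of VA])
    show X.generating
      by (rule X.generating_triple) (simp add: periods_eq, rule ths_vol_image, simp)
    fix d i assume d: "d \<in> periods (resolved t)"
    have B: "(X.P d VB, X.P d VA) \<in> X.adj_rel\<^sup>*"
      using X.zero_vol_edge(2)[of 1, OF _ _ d] by (simp add: ths_vol_def)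
    moreover have "(X.P d VD, X.P d VB) \<in> X.adj_rel\<^sup>*"
      using X.zero_vol_edge(2)[of 6, OF _ _ d] by (simp add: ths_vol_def)
    moreover have "(X.P d VC, X.P d VA) \<in> X.adj_rel\<^sup>*"
      using X.zero_vol_edge(2)[of 5, OF _ _ d] by (simp add: ths_vol_def)
    ultimately show "(X.P d i, X.P d VA) \<in> X.adj_rel\<^sup>*"
      by (cases i) (auto intro: rtrancl_trans)
  qed simp
qed

lemma periodic_crossed: "periodic_network (crossed (1/2))"
proof -
  interpret X: lifted_graph "crossed (1/2)" "UNIV - {VC}" base "{1..6} - {5}" cross_src cross_tgt "ths_vol a b c"
    by (rule lifted_crossed)
  note ev = crossed_evec
  have A: "a \<bullet> X.evec 1 > 0" "a \<bullet> X.evec 2 < 0" "a \<bullet> X.evec 3 = 0" "a \<bullet> X.evec 4 = 0" "a \<bullet> X.evec 6 = 0"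
    and B: "b \<bullet> X.evec 1 = 0" "b \<bullet> X.evec 2 = 0" "b \<bullet> X.evec 3 > 0" "b \<bullet> X.evec 4 < 0" "b \<bullet> X.evec 6 = 0"
    and n6: "n \<bullet> X.evec 6 > 0"
    using l by (simp_all add: ev inner_add_right inner_diff_right inner_all)
  have darts: "X.darts VA = {(1, True), (2, True), (3, True), (4, True)}"
    "X.darts VB = {(1, False), (2, False), (6, True)}" "X.darts VD = {(3, False), (4, False), (6, False)}"
    unfolding X.darts_def unfolding atLeastAtMost_1_6_minus by auto
  show ?thesis
  proof (rule X.periodic_networkI[OF placed_crossed])
    fix j assume "j \<in> {1..6} - {5 :: nat}"
    then show "X.evec j \<noteq> 0"
      using A B n6 unfolding atLeastAtMost_1_6_minus by auto
  next
    fix i assume i: "i \<in> UNIV - {VC}"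
    show "inj_on (\<lambda>x. sgn (X.dart_vec x)) (X.darts i)"
    proof (cases i)
      case VA
      \<comment> \<open>The vertex has degree four and needs two functionals: \<open>a\<close>
        separates the edges 1 and 2 from each other and from 3 and 4, while \<open>b\<close>
        separates 3 from 4.\<close>
      show ?thesis unfolding VA darts
        using sgn_distinct3[of a "X.evec 1" "X.evec 2" "X.evec 3"] sgn_distinct3[of a "X.evec 1" "X.evec 2" "X.evec 4"]
          sgn_distinct3[of b "X.evec 3" "X.evec 4" "X.evec 1"] A B by (auto simp: inj_on_def)
    next
      case VB
      show ?thesis unfolding VB darts
        using sgn_distinct3[of a "- X.evec 2" "- X.evec 1" "X.evec 6"] A by (auto simp: inj_on_def)
    next
      case VD
      show ?thesis unfolding VD darts
        using sgn_distinct3[of b "- X.evec 4" "- X.evec 3" "- X.evec 6"] B by (auto simp: inj_on_def)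
    qed (use i in simp)
  qed
qed

lemma resolved_darts:
  "lifted_graph.darts {1..6} k4_src k4_tgt VA = {(1, True), (3, True), (5, True)}"
  "lifted_graph.darts {1..6} k4_src k4_tgt VB = {(1, False), (2, False), (6, True)}"
  "lifted_graph.darts {1..6} k4_src k4_tgt VC = {(2, True), (4, True), (5, False)}"
  "lifted_graph.darts {1..6} k4_src k4_tgt VD = {(3, False), (4, False), (6, False)}"
  unfolding lifted_graph.darts_def[OF lifted_resolved] unfolding atLeastAtMost_1_6 by auto

text \<open>Throughout this half the edges 1 to 4 keep a nonzero normal component, with coefficient
  \<open>l / 2 - s * kap\<close>, which separates the directions at \<open>A\<close> and
  \<open>C\<close>. The coefficient \<open>1 / 2 - s * p0\<close> also stays positive, so
  \<open>a\<close> and \<open>b\<close> separate those at \<open>B\<close> and \<open>D\<close>. At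
  \<open>t = 1 / 2\<close> edge 5 has length zero.\<close>

lemma periodic_resolved:
  assumes "1 / 2 < t" "t \<le> 1"
  shows "periodic_network (resolved t)"
proof -
  interpret X: lifted_graph "resolved t" UNIV base "{1..6}" k4_src k4_tgt "ths_vol a b c"
    by (rule lifted_resolved)
  define s where "s = 2 * t - 1"
  have s: "0 < s" "s \<le> 1" using assms by (simp_all add: s_def)
  have ev: "X.evec 1 = (1/2) *\<^sub>R a + (l/2 - s * kap) *\<^sub>R n - s *\<^sub>R w"
    "X.evec 2 = - (1/2) *\<^sub>R a + (l/2 - s * kap) *\<^sub>R n + s *\<^sub>R w"
    "X.evec 3 = (1/2) *\<^sub>R b - (l/2 - s * kap) *\<^sub>R n - s *\<^sub>R w"
    "X.evec 4 = - (1/2) *\<^sub>R b - (l/2 - s * kap) *\<^sub>R n + s *\<^sub>R w"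
    "X.evec 5 = - (2 * s) *\<^sub>R w" "X.evec 6 = (l/2 + 2 * s * kap) *\<^sub>R n"
    using resolved_evec[of t] assms(1) by (simp_all only: s_def less_imp_le)
  have "s * kap \<le> 1 * kap" using s kap_pos by (intro mult_right_mono) auto
  also have "1 * kap < l * (1 / 2)" unfolding kap_def mult_1_left using l by (intro mult_strict_left_mono) simp
  finally have bet: "l / 2 - s * kap > 0" by simp
  have "s * p0 \<le> 1 * p0" using s p0_bounds by (intro mult_right_mono) auto
  then have sp: "1 / 2 - s * p0 > 0" using p0_bounds by linarith
  then have lsp: "3 * l\<^sup>2 * (1 / 2 - s * p0) > 0" using l by simp
  have A: "a \<bullet> X.evec 1 = 3 * l\<^sup>2 * (1 / 2 - s * p0)" "a \<bullet> X.evec 2 = - (3 * l\<^sup>2 * (1 / 2 - s * p0))"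
    "a \<bullet> X.evec 6 = 0"
    and B: "b \<bullet> X.evec 3 = 3 * l\<^sup>2 * (1 / 2 - s * p0)" "b \<bullet> X.evec 4 = - (3 * l\<^sup>2 * (1 / 2 - s * p0))"
    "b \<bullet> X.evec 6 = 0"
    and C: "n \<bullet> X.evec 1 = l / 2 - s * kap" "n \<bullet> X.evec 2 = l / 2 - s * kap"
    "n \<bullet> X.evec 3 = - (l / 2 - s * kap)" "n \<bullet> X.evec 4 = - (l / 2 - s * kap)" "n \<bullet> X.evec 5 = 0"
    "n \<bullet> X.evec 6 = l / 2 + 2 * s * kap"
    unfolding ev by (simp_all add: inner_add_right inner_diff_right inner_all inner_w field_simps)
  have c6: "l / 2 + 2 * s * kap > 0" using l s kap_pos by (simp add: add_pos_pos)
  have w0: "w \<noteq> 0" using norm_w l p0_bounds by auto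
  show ?thesis
  proof (rule X.periodic_networkI[OF placed_resolved])
    fix j assume "j \<in> {1..6 :: nat}"
    moreover have "X.evec 5 \<noteq> 0" using w0 s by (simp add: ev)
    moreover have "X.evec j \<noteq> 0" if "j \<in> {1, 2, 3, 4, 6}"
    proof -
      have "n \<bullet> X.evec j \<noteq> 0"
        using that by (elim insertE emptyE) (simp_all only: C, use bet c6 in simp_all)
      then show ?thesis by auto
    qed
    ultimately show "X.evec j \<noteq> 0" unfolding atLeastAtMost_1_6 by auto
  next
    fix i :: quad
    show "inj_on (\<lambda>x. sgn (X.dart_vec x)) (X.darts i)"
    proof (cases i)
      case VA
      show ?thesis unfolding VA resolved_darts
        using sgn_distinct3[of n "X.evec 1" "X.evec 3" "X.evec 5"] C bet by (auto simp: inj_on_def)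
    next
      case VB
      show ?thesis unfolding VB resolved_darts
        using sgn_distinct3[of a "- X.evec 2" "- X.evec 1" "X.evec 6"] A lsp by (auto simp: inj_on_def)
    next
      case VC
      show ?thesis unfolding VC resolved_darts
        using sgn_distinct3[of n "X.evec 2" "X.evec 4" "- X.evec 5"] C bet by (auto simp: inj_on_def)
    next
      case VD
      show ?thesis unfolding VD resolved_darts
        using sgn_distinct3[of b "- X.evec 4" "- X.evec 3" "- X.evec 6"] B lsp by (auto simp: inj_on_def)
    qed
  qed
qed

section \<open>Length in the second half of the path\<close>

definition strut :: "real \<Rightarrow> real^3"
  where "strut s = (1/2) *\<^sub>R a + (l/2 - s * kap) *\<^sub>R n - s *\<^sub>R w"

definition len :: "real \<Rightarrow> real"
  where "len s = 4 * norm (strut s) + 2 * s * norm w + (l / 2 + 2 * s * kap)"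

text \<open>In coordinates along \<open>a\<close>, \<open>b\<close>, \<open>n\<close> the edges 1 to
  4 differ by signs and by exchanging \<open>a\<close> and \<open>b\<close>, which have equal
  norms.\<close>

lemma norm_struts:
  "norm (- (1/2) *\<^sub>R a + (l/2 - s * kap) *\<^sub>R n + s *\<^sub>R w) = norm (strut s)"
  "norm ((1/2) *\<^sub>R b - (l/2 - s * kap) *\<^sub>R n - s *\<^sub>R w) = norm (strut s)"
  "norm (- (1/2) *\<^sub>R b - (l/2 - s * kap) *\<^sub>R n + s *\<^sub>R w) = norm (strut s)"
  unfolding norm_eq_sqrt_inner strut_def
  by (simp_all add: inner_add_right inner_add_left inner_diff_left inner_diff_right inner_all inner_w
      field_simps)

lemma length_resolved:
  assumes "1 / 2 \<le> t"
  shows "total_length (resolved t) = len (2 * t - 1)"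
proof -
  interpret X: lifted_graph "resolved t" UNIV base "{1..6}" k4_src k4_tgt "ths_vol a b c"
    by (rule lifted_resolved)
  define s where "s = 2 * t - 1"
  have s: "0 \<le> s" using assms by (simp add: s_def)
  have "X.evec 1 = strut s"
    using resolved_evec(1)[OF assms] by (simp add: strut_def s_def)
  moreover have "norm (X.evec 2) = norm (strut s)" "norm (X.evec 3) = norm (strut s)"
      "norm (X.evec 4) = norm (strut s)"
    using norm_struts[of s] unfolding resolved_evec[OF assms] s_def by simp_all
  moreover have "norm (X.evec 5) = 2 * s * norm w"
    using s unfolding resolved_evec[OF assms] s_def by simp
  moreover have "norm (X.evec 6) = l / 2 + 2 * s * kap"
  proof -
    have "l / 2 + 2 * s * kap \<ge> 0" using l s kap_pos by simp
    then show ?thesis unfolding resolved_evec[OF assms] s_def by (simp add: n)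
  qed
  ultimately show ?thesis
    unfolding X.total_length_eq atLeastAtMost_1_6 by (simp add: len_def s_def)
qed

lemma len_0: "len 0 = 9 / 2 * l"
proof -
  have "strut 0 = evec 1" by (simp add: strut_def evec1)
  then show ?thesis by (simp add: len_def norm_evec)
qed

lemma length_crossed: "total_length (crossed (1/2)) = len 0"
proof -
  interpret X: lifted_graph "crossed (1/2)" "UNIV - {VC}" base "{1..6} - {5}" cross_src cross_tgt "ths_vol a b c"
    by (rule lifted_crossed)
  have "X.evec 1 = evec 1" "X.evec 2 = evec 2" "X.evec 3 = evec 3" "X.evec 4 = evec 4"
    by (simp_all only: crossed_evec evec_forms)
  moreover have "norm (X.evec 6) = l / 2" using l n by (simp add: crossed_evec)
  ultimately show ?thesis
    unfolding X.total_length_eq atLeastAtMost_1_6_minus by (simp add: norm_evec len_0)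
qed

text \<open>Origin of \<open>p0\<close>: in the balanced network the in-plane vectors of the edges 1
  and 3 add up to \<open>1 / 2 - 2 * p0\<close> times \<open>a + b\<close>, and this sum must have
  the common length of the edges 1 to 4. The angle of 60 degrees with the axis makes each in-plane
  part \<open>sqrt 3 / 2\<close> of that length. Comparing both conditions,
  \<open>1 / 2 - 2 * p0\<close> has square 1/8.\<close>

lemma p0_value: "1 / 2 - 2 * p0 = sqrt 2 / 4"
  by (simp add: p0_def field_simps)

text \<open>The first identity gives the final length of a strut. The second is the stationarity of
  the final network: per unit of \<open>s\<close>, the projections of four struts lose
  \<open>2 * kap + 2 * norm w\<close>, exactly what the edges 5 and 6 gain.\<close>

lemma strut_1: "strut 1 \<bullet> strut 1 = (sqrt 3 * l / 2)\<^sup>2" "(strut 0 - strut 1) \<bullet> strut 1 =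
    (sqrt 3 * l / 2) * (kap / 2 + norm w / 2)"
proof -
  have bet: "l/2 - 1 * kap = sqrt 3 * l / 4" by (simp add: kap_def field_simps)
  have S1: "strut 1 = (1/2) *\<^sub>R a + (sqrt 3 * l / 4) *\<^sub>R n - w"
    unfolding strut_def bet by simp
  have s2: "sqrt 2 * sqrt 2 = (2::real)" and s3: "sqrt 3 * sqrt 3 = (3::real)" by simp_all
  have poly: "p0\<^sup>2 * 6 - 3 * p0 + 3 / 4 = 9 / 16"
    by (simp add: p0_def power2_eq_square field_simps s2)
  have sq: "strut 1 \<bullet> strut 1 = l\<^sup>2 * (p0\<^sup>2 * 6 - 3 * p0 + 3 / 4) + (sqrt 3 * l / 4)\<^sup>2"
    unfolding S1 by (simp add: inner_add_right inner_add_left inner_diff_left inner_diff_right inner_all inner_w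
      field_simps power2_eq_square)
  show "strut 1 \<bullet> strut 1 = (sqrt 3 * l / 2)\<^sup>2"
    unfolding sq poly by (simp add: power_mult_distrib power_divide)
  have "strut 0 - strut 1 = kap *\<^sub>R n + w" by (simp add: strut_def vec_eq_iff field_simps)
  then have "(strut 0 - strut 1) \<bullet> strut 1 = kap * (sqrt 3 * l / 4) + 3 * l\<^sup>2 * p0 * (1 / 2 - 2 * p0)"
    unfolding S1 by (simp add: inner_add_right inner_add_left inner_diff_left inner_diff_right inner_all inner_w
      field_simps power2_eq_square)
  also have "\<dots> = (sqrt 3 * l / 2) * (kap / 2) + (sqrt 3 * sqrt 3) * l\<^sup>2 * p0 * (sqrt 2 / 4)"
    unfolding p0_value by simp
  also have "\<dots> = (sqrt 3 * l / 2) * (kap / 2 + norm w / 2)"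
  proof -
    have "sqrt 6 = sqrt 3 * sqrt (2::real)" by (simp flip: real_sqrt_mult)
    then show ?thesis unfolding norm_w by (simp only:) (simp add: field_simps power2_eq_square)
  qed
  finally show "(strut 0 - strut 1) \<bullet> strut 1 = (sqrt 3 * l / 2) * (kap / 2 + norm w / 2)" .
qed

lemma strut_affine: "strut ((1 - m) * s + m) = (1 - m) *\<^sub>R strut s + m *\<^sub>R strut 1"
  by (simp add: strut_def vec_eq_iff field_simps)

lemma norm_strut_1: "norm (strut 1) = sqrt 3 * l / 2"
  using l strut_1(1) by (simp add: norm_eq_sqrt_inner)

text \<open>The network at the end of the homotopy is balanced, so projecting the edges on their final
  directions shows that it is shortest.\<close>

lemma len_ge: "len 1 \<le> len s"
proof -
  define r y where "r = sqrt 3 * l / 2" and "y = kap / 2 + norm w / 2"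
  have r: "r > 0" using l by (simp add: r_def)
  have "strut s = strut 1 + (1 - s) *\<^sub>R (strut 0 - strut 1)"
    by (simp add: strut_def vec_eq_iff field_simps)
  then have "strut s \<bullet> strut 1 = r\<^sup>2 + (1 - s) * (r * y)"
    by (simp only: inner_add_left inner_scaleR_left strut_1 r_def y_def)
  also have "\<dots> = r * (r + (1 - s) * y)" by (simp add: power2_eq_square algebra_simps)
  finally have "r * (r + (1 - s) * y) \<le> r * norm (strut s)"
    using norm_cauchy_schwarz[of "strut s" "strut 1"] by (simp add: norm_strut_1 r_def mult.commute)
  then have "r + (1 - s) * y \<le> norm (strut s)"
    using r by (simp only: mult_le_cancel_left_pos)
  moreover have "len 1 = 4 * (r + (1 - s) * y) + 2 * s * norm w + (l / 2 + 2 * s * kap)"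
    by (simp add: len_def norm_strut_1 r_def y_def field_simps)
  ultimately show ?thesis unfolding len_def[of s] by simp
qed

lemma len_antimono:
  assumes "0 \<le> s" "s \<le> s'" "s' \<le> 1"
  shows "len s' \<le> len s"
proof (cases "s = 1")
  case True
  then show ?thesis using assms by simp
next
  case False
  \<comment> \<open>\<open>m\<close> writes \<open>s'\<close> as a convex combination of
    \<open>s\<close> and 1, so convexity compares \<open>len s'\<close> with the values at
    \<open>s\<close> and at the minimum.\<close>
  define m where "m = (s' - s) / (1 - s)"
  have m: "0 \<le> m" "m \<le> 1" using assms False by (auto simp: m_def field_simps)
  have "m * (1 - s) = s' - s" using False by (simp add: m_def)
  then have s': "s' = (1 - m) * s + m" by (simp add: algebra_simps)
  have "norm (strut s') \<le> norm ((1 - m) *\<^sub>R strut s) + norm (m *\<^sub>R strut 1)"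
    unfolding s' strut_affine by (rule norm_triangle_ineq)
  then have "norm (strut s') \<le> (1 - m) * norm (strut s) + m * norm (strut 1)" using m by simp
  moreover have "(1 - m) * len s + m * len 1 =
      4 * ((1 - m) * norm (strut s) + m * norm (strut 1)) + 2 * s' * norm w + (l / 2 + 2 * s' * kap)"
    unfolding s' len_def by (simp add: algebra_simps add_divide_distrib diff_divide_distrib)
  ultimately have "len s' \<le> (1 - m) * len s + m * len 1"
    unfolding len_def[of s'] by simp
  also have "\<dots> \<le> (1 - m) * len s + m * len s"
    using len_ge m by (intro add_left_mono mult_left_mono) auto
  finally show ?thesis by (simp add: algebra_simps)
qed

lemma len_1_less: "len 1 < len 0"
proof -
  \<comment> \<open>The final length is \<open>l * ((2 * sqrt 3 + sqrt 6) / 2 + 3 / 2)\<close>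
    against \<open>9 / 2 * l\<close>, so the claim amounts to
    \<open>2 * sqrt 3 + sqrt 6 < 6\<close>; these decimals bound the roots from above closely
    enough.\<close>
  have "sqrt 3 < 1.733" by (rule real_less_lsqrt) (simp_all add: power2_eq_square)
  moreover have "sqrt 6 < 2.4495" by (rule real_less_lsqrt) (simp_all add: power2_eq_square)
  ultimately have *: "2 * sqrt 3 + sqrt 6 < 6" by simp
  have "sqrt 6 * sqrt 2 = 2 * sqrt (3::real)"
  proof -
    have "sqrt 6 * sqrt 2 = sqrt (4 * 3)" by (simp flip: real_sqrt_mult)
    also have "\<dots> = 2 * sqrt 3" by (simp only: real_sqrt_mult real_sqrt_four)
    finally show ?thesis .
  qed
  then have "sqrt 6 * p0 = (sqrt 6 - sqrt 3) / 4" by (simp add: p0_def right_diff_distrib)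
  then have nw: "norm w = l * ((sqrt 6 - sqrt 3) / 4)" by (simp add: norm_w mult.commute mult.left_commute)
  have "len 1 = l * (2 * sqrt 3 + (sqrt 6 - sqrt 3) / 2 + 1 / 2 + (1 - sqrt 3 / 2))"
    unfolding len_def norm_strut_1 nw
    by (simp add: kap_def algebra_simps add_divide_distrib diff_divide_distrib)
  also have "\<dots> = l * ((2 * sqrt 3 + sqrt 6) / 2 + 3 / 2)"
    by (rule arg_cong[of _ _ "(*) l"]) (simp add: diff_divide_distrib add_divide_distrib)
  also have "\<dots> < l * (9 / 2)" using * l by (intro mult_strict_left_mono) auto
  finally show ?thesis by (simp add: len_0)
qed

text \<open>The edges 1 to 4 have one common length, so balance can be checked on the edge vectors:
  their pairs add up along \<open>a + b\<close> at \<open>A\<close> and \<open>C\<close>, along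
  \<open>n\<close> at \<open>B\<close> and \<open>D\<close>, which are the lines of the edges 5 and
  6.\<close>

lemma steiner_resolved: "steiner_network (resolved 1)"
proof -
  interpret X: lifted_graph "resolved 1" UNIV base "{1..6}" k4_src k4_tgt "ths_vol a b c"
    by (rule lifted_resolved)
  let ?r = "sqrt 3 * l / 2"
  have r: "?r > 0" using l by simp
  have bet: "l / 2 - kap = ?r / 2" by (simp add: kap_def field_simps)
  have ev: "X.evec 1 = (1/2) *\<^sub>R a + (?r / 2) *\<^sub>R n - w"
    "X.evec 2 = - (1/2) *\<^sub>R a + (?r / 2) *\<^sub>R n + w"
    "X.evec 3 = (1/2) *\<^sub>R b - (?r / 2) *\<^sub>R n - w"
    "X.evec 4 = - (1/2) *\<^sub>R b - (?r / 2) *\<^sub>R n + w"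
    "X.evec 5 = - 2 *\<^sub>R w" "X.evec 6 = (l/2 + 2 * kap) *\<^sub>R n"
    using resolved_evec[of 1] by (simp_all only: bet[symmetric], simp_all)
  have nr: "norm (X.evec j) = ?r" if "j \<in> {1, 2, 3, 4}" for j
  proof -
    have "strut 1 = X.evec 1" unfolding ev(1) strut_def by (simp add: bet)
    then have "norm (X.evec 1) = ?r" using norm_strut_1 by simp
    moreover have "norm (X.evec 2) = ?r" "norm (X.evec 3) = ?r" "norm (X.evec 4) = ?r"
      using norm_struts[of 1] norm_strut_1 unfolding ev(2-4) by (simp_all add: bet)
    ultimately show ?thesis using that by blast
  qed
  have sg: "sgn (X.evec j) = (1 / ?r) *\<^sub>R X.evec j" if "j \<in> {1, 2, 3, 4}" for j
    using nr[OF that] by (simp only: sgn_div_norm divide_inverse mult_1_left)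
  have w0: "w \<noteq> 0" using norm_w l p0_bounds by auto
  have s5: "sgn (X.evec 5) = - sgn w" unfolding ev(5) by (simp add: sgn_scaleR sgn_minus)
  have sw: "sgn w = (1 / (sqrt 6 * l)) *\<^sub>R (a + b)"
    using l p0_bounds unfolding sgn_div_norm norm_w by (simp add: w_def field_simps)
  have s6: "sgn (X.evec 6) = n"
  proof -
    have "l / 2 + 2 * kap > 0" using l kap_pos by simp
    then show ?thesis unfolding ev(6) using n by (simp add: sgn_scaleR) (simp add: sgn_div_norm)
  qed
  \<comment> \<open>This is the equation that determines \<open>p0\<close>: the two struts at
    \<open>A\<close> add up to a vector of the length of one strut.\<close>
  have coef: "(1 / ?r) * (1 / 2 - 2 * p0) = 1 / (sqrt 6 * l)"
  proof -
    have "sqrt 6 = sqrt 3 * sqrt (2::real)" by (simp flip: real_sqrt_mult)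
    moreover have "sqrt 2 * sqrt 2 = (2::real)" by simp
    ultimately show ?thesis unfolding p0_value using l by (simp add: field_simps)
  qed
  have "sgn (X.evec 1) + sgn (X.evec 3) = (1 / ?r) *\<^sub>R (X.evec 1 + X.evec 3)"
    by (simp add: sg scaleR_add_right)
  also have "X.evec 1 + X.evec 3 = (1 / 2 - 2 * p0) *\<^sub>R (a + b)"
    unfolding ev by (simp add: w_def vec_eq_iff field_simps)
  finally have A: "sgn (X.evec 1) + sgn (X.evec 3) = sgn w"
    unfolding scaleR_scaleR coef sw .
  have "sgn (X.evec 2) + sgn (X.evec 4) = (1 / ?r) *\<^sub>R (X.evec 2 + X.evec 4)"
    by (simp add: sg scaleR_add_right)
  also have "X.evec 2 + X.evec 4 = (1 / 2 - 2 * p0) *\<^sub>R (- (a + b))"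
    unfolding ev by (simp add: w_def vec_eq_iff field_simps)
  finally have C: "sgn (X.evec 2) + sgn (X.evec 4) = - sgn w"
    unfolding scaleR_scaleR coef sw scaleR_minus_right .
  have "sgn (X.evec 1) + sgn (X.evec 2) = (1 / ?r) *\<^sub>R (X.evec 1 + X.evec 2)"
    by (simp add: sg scaleR_add_right)
  also have "X.evec 1 + X.evec 2 = ?r *\<^sub>R n"
    unfolding ev by (simp add: vec_eq_iff field_simps)
  finally have B: "sgn (X.evec 1) + sgn (X.evec 2) = n"
    using l by (simp del: k4_src.simps k4_tgt.simps)
  have "sgn (X.evec 3) + sgn (X.evec 4) = (1 / ?r) *\<^sub>R (X.evec 3 + X.evec 4)"
    by (simp add: sg scaleR_add_right)
  also have "X.evec 3 + X.evec 4 = - ?r *\<^sub>R n"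
    unfolding ev by (simp add: vec_eq_iff field_simps)
  finally have D: "sgn (X.evec 3) + sgn (X.evec 4) = - n"
    using l by (simp del: k4_src.simps k4_tgt.simps)
  have alt: "sgn (X.evec 3) = sgn w - sgn (X.evec 1)" "sgn (X.evec 2) = n - sgn (X.evec 1)"
    "sgn (X.evec 4) = - n - sgn (X.evec 3)"
    using A B D by (metis add_diff_cancel_left')+
  have "(\<Sum>x\<in>X.darts i. sgn (X.dart_vec x)) = 0" for i
  proof (cases i)
    case VC
    have "sgn (X.evec 2) + sgn (X.evec 4) + sgn (- X.evec 5) = 0" using C s5 by (simp add: sgn_minus)
    then show ?thesis by (simp add: VC resolved_darts add.assoc)
  qed (simp_all add: resolved_darts sgn_minus s5 s6 alt(3), simp_all add: alt(1,2))
  moreover have "card (X.darts i) = 3" for i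
    by (cases i) (simp_all add: resolved_darts)
  ultimately show ?thesis
    using periodic_resolved[of 1] by (simp add: X.steiner_iff)
qed

lemma quotient_resolved: "isomorphic (quotient_graph (resolved 1)) K4"
proof -
  interpret X: lifted_graph "resolved 1" UNIV base "{1..6}" k4_src k4_tgt "ths_vol a b c"
    by (rule lifted_resolved)
  show ?thesis
    unfolding isomorphic_def
    using multigraph_iso_trans[OF multigraph_iso_inverse[OF X.quotient_iso] k4_presentation] by auto
qed

section \<open>The change of graph and the assembled homotopy\<close>

lemma moved_merge: "moved (1/2) (base VA) = moved (1/2) (base VC)"
  by (simp add: moved_base base_pos displacement_def slide_def spread_def)

lemma slid_collapses: "collapses_to (slid (1/2)) (crossed (1/2))"
proof (rule contraction_collapses[OF lifted_slid lifted_crossed, where y = VA])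
  show "pos (slid (1/2)) (base VA) = pos (slid (1/2)) (base VC)" using moved_merge by simp
  interpret X: lifted_graph "crossed (1/2)" "UNIV - {VC}" base "{1..6} - {5}" cross_src cross_tgt "ths_vol a b c"
    by (rule lifted_crossed)
  fix j assume j: "j \<in> {1..6} - {5 :: nat}"
  show s: "cross_src j = (if ths_src j = VC then VA else ths_src j)"
    and t: "cross_tgt j = (if ths_tgt j = VC then VA else ths_tgt j)"
    using j unfolding atLeastAtMost_1_6_minus by auto
  have "X.evec j \<noteq> 0" by (rule X.evec_nonzero[OF periodic_crossed j])
  moreover have "moved (1/2) (base (cross_src j)) = moved (1/2) (base (ths_src j))"
    "moved (1/2) (base (cross_tgt j)) = moved (1/2) (base (ths_tgt j))"
    unfolding s t using moved_merge by auto
  ultimately show "pos (slid (1/2)) (base (ths_tgt j)) + ths_vol a b c j \<noteq> pos (slid (1/2)) (base (ths_src j))"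
    by (simp only: X.evec_def path_simps) simp
qed (simp_all add: ths_vol_def)

lemma resolved_collapses: "collapses_to (resolved (1/2)) (crossed (1/2))"
proof (rule contraction_collapses[OF lifted_resolved lifted_crossed, where y = VA])
  show "pos (resolved (1/2)) (base VA) = pos (resolved (1/2)) (base VC)" using moved_merge by simp
  interpret X: lifted_graph "crossed (1/2)" "UNIV - {VC}" base "{1..6} - {5}" cross_src cross_tgt "ths_vol a b c"
    by (rule lifted_crossed)
  fix j assume j: "j \<in> {1..6} - {5 :: nat}"
  show s: "cross_src j = (if k4_src j = VC then VA else k4_src j)"
    and t: "cross_tgt j = (if k4_tgt j = VC then VA else k4_tgt j)"
    using j unfolding atLeastAtMost_1_6_minus by auto
  have "X.evec j \<noteq> 0" by (rule X.evec_nonzero[OF periodic_crossed j])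
  moreover have "moved (1/2) (base (cross_src j)) = moved (1/2) (base (k4_src j))"
    "moved (1/2) (base (cross_tgt j)) = moved (1/2) (base (k4_tgt j))"
    unfolding s t using moved_merge by auto
  ultimately show "pos (resolved (1/2)) (base (k4_tgt j)) + ths_vol a b c j \<noteq> pos (resolved (1/2)) (base (k4_src j))"
    by (simp only: X.evec_def path_simps) simp
qed (simp_all add: ths_vol_def)

lemma continuous_moved: "continuous_on S (\<lambda>t. moved t v)"
proof -
  have "continuous_on S (\<lambda>t. displacement t q)" for q
    by (cases q) (simp_all add: displacement_def slide_def spread_def, (intro continuous_intros)+)
  then show ?thesis unfolding moved_def by (intro continuous_intros)
qed

lemma path_periodic:
  assumes "t \<in> {0..1}"
  shows "periodic_network (path t)" "periods (path t) = periods N"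
proof -
  show "periods (path t) = periods N" by (simp add: path_def)
  consider "t < 1/2" | "t = 1/2" | "t > 1/2" by linarith
  then show "periodic_network (path t)"
  proof cases
    case 1
    then show ?thesis using ths_form.periodic[OF slid_form] assms by (simp add: path_def)
  next
    case 2
    show ?thesis unfolding 2 using periodic_crossed by (simp add: path_def)
  next
    case 3
    then show ?thesis using periodic_resolved assms by (simp add: path_def)
  qed
qed

lemma path_length:
  assumes "t \<in> {0..1}"
  shows "total_length (path t) = len (spread t)"
proof -
  consider "t < 1/2" | "t = 1/2" | "t > 1/2" by linarith
  then show ?thesis
  proof cases
    case 1
    then show ?thesis using ths_form.length_form[OF slid_form] assms by (simp add: path_def spread_def len_0)
  next
    case 2
    show ?thesis unfolding 2 using length_crossed by (simp add: path_def spread_def)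
  next
    case 3
    then show ?thesis using length_resolved by (simp add: path_def spread_def)
  qed
qed

lemma path_homotopy: "network_homotopy (periods N) path"
  unfolding network_homotopy_def
proof (intro conjI ballI exI allI impI)
  fix t :: real assume "t \<in> {0..1}"
  then show "periodic_network (path t)" "periods (path t) = periods N"
    by (fact path_periodic)+
next
  let ?tau = "\<lambda>j::nat. real j / 2"
  show "?tau 0 = 0" "?tau 2 = 1" by simp_all
  fix j :: nat assume j: "j < 2"
  show "?tau j < ?tau (Suc j)" by simp
  \<comment> \<open>Only the graph of \<open>?K\<close> matters, since its positions are overwritten
    by \<open>moved t\<close>. The two intervals meet at 1/2, where both graphs contract to
    \<open>crossed (1/2)\<close>.\<close>
  let ?K = "if j = 0 then slid 0 else resolved 0"
  show "continuous_on {?tau j..?tau (Suc j)} (\<lambda>t. moved t v)" for v by (rule continuous_moved)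
  have K: "(?K\<lparr>pos := moved t\<rparr>) = (if j = 0 then slid t else resolved t)" for t
    by (simp add: slid_def resolved_def)
  fix t assume t: "t \<in> {?tau j..?tau (Suc j)}"
  show "periodic_placed_graph (?K\<lparr>pos := moved t\<rparr>)"
    unfolding K using ths_graph.placed[OF slid_graph] placed_resolved by simp
  show "collapses_to (?K\<lparr>pos := moved t\<rparr>) (path t)"
  proof (cases "t = 1 / 2")
    case True
    show ?thesis unfolding True K using slid_collapses resolved_collapses by (simp add: path_def)
  next
    case False
    have t01: "t \<in> {0..1}" using t j by (cases "j = 0") auto
    have "(if j = 0 then slid t else resolved t) = path t"
      using t j False by (cases "j = 0") (auto simp: path_def)
    then show ?thesis unfolding K using collapses_to_refl[OF path_periodic(1)[OF t01]] by simp
  qed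
qed

lemma path_0: "path 0 = N"
  by (simp add: path_def slid_def regraph_same moved_0)

lemma homotopy_to_K4:
  "\<exists>M :: real \<Rightarrow> ('v, real^3) network.
     network_homotopy (periods N) M \<and> M 0 = N \<and>
     steiner_network (M 1) \<and> isomorphic (quotient_graph (M 1)) K4 \<and>
     total_length (M 1) < total_length N \<and>
     (\<forall>t\<in>{0..1}. \<forall>t'\<in>{0..1}. t \<le> t' \<longrightarrow> total_length (M t') \<le> total_length (M t))"
proof (intro exI conjI ballI impI)
  show "network_homotopy (periods N) path" by (rule path_homotopy)
  show "path 0 = N" by (rule path_0)
  show "steiner_network (path 1)" "isomorphic (quotient_graph (path 1)) K4"
    using steiner_resolved quotient_resolved by (simp_all add: path_def)
  show "total_length (path 1) < total_length N"
    using path_length[of 1] len_1_less by (simp add: spread_def length_form len_0)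
  fix t t' :: real assume t: "t \<in> {0..1}" "t' \<in> {0..1}" "t \<le> t'"
  show "total_length (path t') \<le> total_length (path t)"
    unfolding path_length[OF t(1)] path_length[OF t(2)]
    by (rule len_antimono) (use t in \<open>auto simp: spread_def\<close>)
qed

end

section \<open>The inequality for networks and the final assembly\<close>

lemma length_volume_inequality:
  fixes N :: "('v, real^3) network"
  assumes net: "periodic_network N" and iso: "isomorphic (quotient_graph N) D1_square_D2"
  shows "total_length N ^ 3 / spanned_volume N \<ge> 81 / 4"
    and "total_length N ^ 3 / spanned_volume N = 81 / 4 \<longleftrightarrow> minimizing_ths N"
proof -
  have placed: "periodic_placed_graph N" using net by (simp add: periodic_network_def)
  obtain f g where "multigraph_iso f g (quotient_graph N) D1_square_D2"
    using iso by (auto simp: isomorphic_def)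
  then obtain f' g' where "multigraph_iso f' g' D1_square_D2 (quotient_graph N)"
    using multigraph_iso_inverse quotient_ends[OF placed] by blast
  then obtain base a b c where "ths_graph N base a b c"
    using ths_graph_exists[OF placed] by metis
  then interpret ths_graph N base a b c .
  show "total_length N ^ 3 / spanned_volume N \<ge> 81 / 4"
    using ths_length_volume(1)[OF evecs(1,2,3)[symmetric] volume_eq volume_pos length_eq] volume_pos
    by (simp add: pos_le_divide_eq)
  show "total_length N ^ 3 / spanned_volume N = 81 / 4 \<longleftrightarrow> minimizing_ths N"
  proof
    assume "total_length N ^ 3 / spanned_volume N = 81 / 4"
    then have "total_length N ^ 3 = 81 / 4 * spanned_volume N" using volume_pos by (simp add: field_simps)
    then obtain l x n where "ths_form N base a b c l x n" using equality_ths_form[OF net] by metis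
    then show "minimizing_ths N" unfolding minimizing_ths_def using ths_form.minimizing by blast
  next
    assume "minimizing_ths N"
    then show "total_length N ^ 3 / spanned_volume N = 81 / 4"
      unfolding minimizing_ths_def using minimizing_ths_form ths_form.ratio by metis
  qed
qed

theorem theorem2:
  shows
    "(\<forall>N :: ('v, real^3) network. periodic_network N \<and> isomorphic (quotient_graph N) D1_square_D2 \<longrightarrow>
        total_length N ^ 3 / spanned_volume N \<ge> 81 / 4 \<and>
        (total_length N ^ 3 / spanned_volume N = 81 / 4 \<longleftrightarrow> minimizing_ths N)) \<and>
     (\<forall>s. 0 < s \<and> s < 1 / 2 \<longrightarrow>
        (\<exists>N :: (quad \<times> (real^3), real^3) network. minimizing_ths_with_parameter N s)) \<and>
     (\<forall>(N :: ('v, real^3) network) (N' :: ('w, real^3) network) s s'.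
        minimizing_ths_with_parameter N s \<and> minimizing_ths_with_parameter N' s' \<longrightarrow>
        (similar_networks N N' \<longleftrightarrow> s' = s \<or> s' = 1 / 2 - s)) \<and>
     (\<forall>N :: ('v, real^3) network. minimizing_ths N \<longrightarrow>
        similar_lattices (periods N) ths_lattice) \<and>
     (\<forall>N :: ('v, real^3) network. minimizing_ths N \<longrightarrow>
        (\<exists>M :: real \<Rightarrow> ('v, real^3) network.
           network_homotopy (periods N) M \<and> M 0 = N \<and>
           steiner_network (M 1) \<and> isomorphic (quotient_graph (M 1)) K4 \<and>
           total_length (M 1) < total_length N \<and>
           (\<forall>t\<in>{0..1}. \<forall>t'\<in>{0..1}. t \<le> t' \<longrightarrow> total_length (M t') \<le> total_length (M t))))"
proof (intro conjI allI impI)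
  fix N :: "('v, real^3) network"
  assume "periodic_network N \<and> isomorphic (quotient_graph N) D1_square_D2"
  then show "total_length N ^ 3 / spanned_volume N \<ge> 81 / 4"
    "total_length N ^ 3 / spanned_volume N = 81 / 4 \<longleftrightarrow> minimizing_ths N"
    using length_volume_inequality by blast+
next
  fix s :: real assume "0 < s \<and> s < 1 / 2"
  then obtain base a b c n where "ths_form (ths_model s) base a b c 1 s n"
    using ths_model_form by blast
  then show "\<exists>N :: (quad \<times> (real^3), real^3) network. minimizing_ths_with_parameter N s"
    using ths_form.minimizing by fastforce
next
  fix N :: "('v, real^3) network" and N' :: "('w, real^3) network" and s s'
  assume "minimizing_ths_with_parameter N s \<and> minimizing_ths_with_parameter N' s'"
  then show "similar_networks N N' \<longleftrightarrow> s' = s \<or> s' = 1 / 2 - s"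
    using ths_similar_iff by blast
next
  fix N :: "('v, real^3) network" assume "minimizing_ths N"
  then obtain base a b c l x n where N: "ths_form N base a b c l x n"
    unfolding minimizing_ths_def using minimizing_ths_form by metis
  show "similar_lattices (periods N) ths_lattice" by (rule ths_form.similar_ths_lattice[OF N])
next
  fix N :: "('v, real^3) network" assume "minimizing_ths N"
  then obtain base a b c l x n where N: "ths_form N base a b c l x n"
    unfolding minimizing_ths_def using minimizing_ths_form by metis
  show "\<exists>M :: real \<Rightarrow> ('v, real^3) network.
     network_homotopy (periods N) M \<and> M 0 = N \<and>
     steiner_network (M 1) \<and> isomorphic (quotient_graph (M 1)) K4 \<and>
     total_length (M 1) < total_length N \<and>
     (\<forall>t\<in>{0..1}. \<forall>t'\<in>{0..1}. t \<le> t' \<longrightarrow> total_length (M t') \<le> total_length (M t))"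
    by (rule ths_form.homotopy_to_K4[OF N])
qed

end
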